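(* The $\mathcal{A}$-modules $L_{\mathcal{A}}(\mu)$ for $\mu\in\mathbb{C}^{\times}$ form a complete list of irreducible $\mathbb{N}$-graded $\mathcal{A}$-modules up to isomorphism (that is, each $L_{\mathcal{A}}(\mu)$ is an irreducible $\mathbb{N}$-graded $\mathcal{A}$-module, and every irreducible $\mathbb{N}$-graded $\mathcal{A}$-module is isomorphic to $L_{\mathcal{A}}(\mu)$ for exactly one $\mu\in\mathbb{C}^{\times}$).
   Context: $\mathbb{N}$ is the set of nonnegative integers and $\mathbb{C}^\times=\mathbb{C}\setminus\{0\}$. $\mathcal{A}$ denotes the associative algebra with identity over $\mathbb{C}$ with generators $Y_n, Y_n^{*}$ ($n\in\mathbb{Z}$), subject to the relations $$Y_mY_n+Y_{n+1}Y_{m-1}=0,\qquad Y_m^{*}Y_n^{*}+Y_{n+1}^{*}Y_{m-1}^{*}=0,\qquad Y_mY_n^{*}+Y_{n-1}^{*}Y_{m+1}=\delta_{m+n,0}$$ for $m,n\in\mathbb{Z}$. It is $\mathbb{Z}$-graded by $\deg Y_n=-n=\deg Y_n^{*}$; $\mathcal{A}_n$ is the homogeneous subspace of degree $n$, and $\mathcal{A}_{-}=\oplus_{n\ge1}\mathcal{A}_{-n}$. An $\mathbb{N}$-graded $\mathcal{A}$-module is an $\mathcal{A}$-module $W=\oplus_{n\in\mathbb{N}}W(n)$ with $W(0)\ne0$ and $\mathcal{A}_mW(n)\subset W(m+n)$ for $m\in\mathbb{Z}$, $n\in\mathbb{N}$ (where $W(k)=0$ for $k<0$); it is irreducible if it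 has no graded submodules other than $0$ and $W$. Let $I_0=\sum_{n\ge1}\mathcal{A}_n\mathcal{A}_{-n}$, an ideal of $\mathcal{A}_0$, and $\bar{\mathcal{A}}_0=\mathcal{A}_0/I_0$. For each $\mu\in\mathbb{C}^{\times}$ there is a $1$-dimensional irreducible $\bar{\mathcal{A}}_0$-module $\mathbb{C}_\mu$ on which (the images of) $Y_0$ and $Y_0^{*}$ act as the scalars $\mu$ and $\mu^{-1}$. View $\mathbb{C}_\mu$ as an $(\mathcal{A}_-+\mathcal{A}_0)$-module with $\mathcal{A}_-$ acting as zero, and set $M_{\mathcal{A}}(\mu)=\mathcal{A}\otimes_{(\mathcal{A}_-+\mathcal{A}_0)}\mathbb{C}_\mu$, an $\mathbb{N}$-graded $\mathcal{A}$-module with degree-$0$ subspace $\mathbb{C}_\mu$. $L_{\mathcal{A}}(\mu)$ is the quotient of $M_{\mathcal{A}}(\mu)$ by its maximal proper $\mathbb{N}$-graded submodule. *)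

theory Defs
  imports
    "HOL.Complex"
    "HOL-Library.Poly_Mapping"
    "HOL-Algebra.QuotRing"
    "HOL-Algebra.Module"
    "HOL-Algebra.Generated_Groups"
begin

section \<open>Left modules over a ring that need not be commutative\<close>

text \<open>The locale \<open>module\<close> of HOL-Algebra insists on a commutative base ring, so its axioms are
  repeated here over an arbitrary ring.  The record type is reused; its fields \<open>mult\<close> and
  \<open>one\<close> play no role.\<close>

locale left_module = R?: ring R + M?: abelian_group M
  for R :: "('a, 'r) ring_scheme" (structure) and M :: "('a, 'b, 'm) module_scheme" (structure) +
  assumes smult_closed:
      "\<lbrakk>a \<in> carrier R; x \<in> carrier M\<rbrakk> \<Longrightarrow> a \<odot>\<^bsub>M\<^esub> x \<in> carrier M"
    and smult_l_distr:
      "\<lbrakk>a \<in> carrier R; b \<in> carrier R; x \<in> carrier M\<rbrakk> \<Longrightarrow>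
        (a \<oplus>\<^bsub>R\<^esub> b) \<odot>\<^bsub>M\<^esub> x = a \<odot>\<^bsub>M\<^esub> x \<oplus>\<^bsub>M\<^esub> b \<odot>\<^bsub>M\<^esub> x"
    and smult_r_distr:
      "\<lbrakk>a \<in> carrier R; x \<in> carrier M; y \<in> carrier M\<rbrakk> \<Longrightarrow>
        a \<odot>\<^bsub>M\<^esub> (x \<oplus>\<^bsub>M\<^esub> y) = a \<odot>\<^bsub>M\<^esub> x \<oplus>\<^bsub>M\<^esub> a \<odot>\<^bsub>M\<^esub> y"
    and smult_assoc:
      "\<lbrakk>a \<in> carrier R; b \<in> carrier R; x \<in> carrier M\<rbrakk> \<Longrightarrow>
        (a \<otimes>\<^bsub>R\<^esub> b) \<odot>\<^bsub>M\<^esub> x = a \<odot>\<^bsub>M\<^esub> (b \<odot>\<^bsub>M\<^esub> x)"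
    and smult_one:
      "x \<in> carrier M \<Longrightarrow> \<one>\<^bsub>R\<^esub> \<odot>\<^bsub>M\<^esub> x = x"

definition module_iso ::
  "('a, 'r) ring_scheme \<Rightarrow> ('a, 'b, 'm) module_scheme \<Rightarrow> ('a, 'c, 'n) module_scheme \<Rightarrow> ('b \<Rightarrow> 'c) set"
  where "module_iso R M N = {h. bij_betw h (carrier M) (carrier N) \<and>
    (\<forall>x\<in>carrier M. \<forall>y\<in>carrier M. h (x \<oplus>\<^bsub>M\<^esub> y) = h x \<oplus>\<^bsub>N\<^esub> h y) \<and>
    (\<forall>a\<in>carrier R. \<forall>x\<in>carrier M. h (a \<odot>\<^bsub>M\<^esub> x) = a \<odot>\<^bsub>N\<^esub> h x)}"

definition quotient_module :: "('a, 'b, 'm) module_scheme \<Rightarrow> 'b set \<Rightarrow> ('a, 'b set) module"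
  where "quotient_module M N =
    \<lparr>carrier = a_rcosets\<^bsub>M\<^esub> N, mult = undefined, one = undefined, zero = N, add = set_add M,
     smult = (\<lambda>a X. \<Union>x\<in>X. N +>\<^bsub>M\<^esub> (a \<odot>\<^bsub>M\<^esub> x))\<rparr>"

text \<open>For a subring \<open>B\<close> of \<open>R\<close> and a left \<open>B\<close>-module \<open>V\<close>, the left \<open>R\<close>-module
  \<open>R \<otimes>\<^sub>B V\<close> is the free abelian group on the pairs \<open>(r, v)\<close>, with \<open>R\<close> acting on the first
  entries, modulo the subgroup generated by the biadditivity and \<open>B\<close>-balance relations.\<close>

definition pairs_module ::
  "('a, 'r) ring_scheme \<Rightarrow> ('a, 'v, 'm) module_scheme \<Rightarrow> ('a, ('a \<times> 'v) \<Rightarrow>\<^sub>0 int) module"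
  where "pairs_module R V =
    \<lparr>carrier = {c. Poly_Mapping.keys c \<subseteq> carrier R \<times> carrier V},
     mult = undefined, one = undefined, zero = 0, add = (+),
     smult = (\<lambda>a. frag_extend (\<lambda>(r, v). frag_of (a \<otimes>\<^bsub>R\<^esub> r, v)))\<rparr>"

definition tensor_relations ::
  "('a, 'r) ring_scheme \<Rightarrow> 'a set \<Rightarrow> ('a, 'v, 'm) module_scheme \<Rightarrow> (('a \<times> 'v) \<Rightarrow>\<^sub>0 int) set"
  where "tensor_relations R B V = generate (add_monoid (pairs_module R V))
    ({frag_of (r \<oplus>\<^bsub>R\<^esub> s, v) - frag_of (r, v) - frag_of (s, v) | r s v.
        r \<in> carrier R \<and> s \<in> carrier R \<and> v \<in> carrier V} \<union>
     {frag_of (r, v \<oplus>\<^bsub>V\<^esub> w) - frag_of (r, v) - frag_of (r, w) | r v w.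
        r \<in> carrier R \<and> v \<in> carrier V \<and> w \<in> carrier V} \<union>
     {frag_of (r \<otimes>\<^bsub>R\<^esub> b, v) - frag_of (r, b \<odot>\<^bsub>V\<^esub> v) | r b v.
        r \<in> carrier R \<and> b \<in> B \<and> v \<in> carrier V})"

definition tensor_module ::
  "('a, 'r) ring_scheme \<Rightarrow> 'a set \<Rightarrow> ('a, 'v, 'm) module_scheme \<Rightarrow>
    ('a, (('a \<times> 'v) \<Rightarrow>\<^sub>0 int) set) module"
  where "tensor_module R B V = quotient_module (pairs_module R V) (tensor_relations R B V)"

definition pure_tensor ::
  "('a, 'r) ring_scheme \<Rightarrow> 'a set \<Rightarrow> ('a, 'v, 'm) module_scheme \<Rightarrow> 'a \<Rightarrow> 'v \<Rightarrow>
    (('a \<times> 'v) \<Rightarrow>\<^sub>0 int) set"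
  where "pure_tensor R B V r v = tensor_relations R B V +>\<^bsub>pairs_module R V\<^esub> frag_of (r, v)"


section \<open>The algebra \<open>\<A>\<close>\<close>

datatype gen = GenY int | GenYs int

text \<open>The wrapper makes the words over the generators an additive monoid, so that
  \<open>word \<Rightarrow>\<^sub>0 complex\<close> with the convolution product of \<open>Poly_Mapping\<close> is the free
  complex algebra on the generators.\<close>

datatype word = Word (letters: "gen list")

instantiation word :: monoid_add
begin

definition zero_word :: word where "0 = Word []"

definition plus_word :: "word \<Rightarrow> word \<Rightarrow> word" where "u + v = Word (letters u @ letters v)"

instance
  by standard (simp_all add: zero_word_def plus_word_def)

end

type_synonym free_elem = "word \<Rightarrow>\<^sub>0 complex"

definition free_algebra :: "free_elem ring"
  where "free_algebra = \<lparr>carrier = UNIV, mult = (*), one = 1, zero = 0, add = (+)\<rparr>"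

definition freeY :: "int \<Rightarrow> free_elem"
  where "freeY n = Poly_Mapping.single (Word [GenY n]) 1"

definition freeYs :: "int \<Rightarrow> free_elem"
  where "freeYs n = Poly_Mapping.single (Word [GenYs n]) 1"

definition defining_relations :: "free_elem set"
  where "defining_relations =
    {freeY m * freeY n + freeY (n + 1) * freeY (m - 1) | m n. True} \<union>
    {freeYs m * freeYs n + freeYs (n + 1) * freeYs (m - 1) | m n. True} \<union>
    {freeY m * freeYs n + freeYs (n - 1) * freeY (m + 1) - (if m + n = 0 then 1 else 0) | m n. True}"

definition relation_ideal :: "free_elem set"
  where "relation_ideal = Idl\<^bsub>free_algebra\<^esub> defining_relations"

type_synonym alg_elem = "free_elem set"

definition Alg :: "alg_elem ring"
  where "Alg = free_algebra Quot relation_ideal"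

definition alg_class :: "free_elem \<Rightarrow> alg_elem"
  where "alg_class p = relation_ideal +>\<^bsub>free_algebra\<^esub> p"

definition Y :: "int \<Rightarrow> alg_elem" where "Y n = alg_class (freeY n)"

definition Ys :: "int \<Rightarrow> alg_elem" where "Ys n = alg_class (freeYs n)"

text \<open>The complex scalars inside the algebra.  Every unital left module over the ring
  \<open>Alg\<close> is a complex vector space through them, and every \<open>Alg\<close>-linear map is complex linear.\<close>

definition scalar :: "complex \<Rightarrow> alg_elem"
  where "scalar c = alg_class (Poly_Mapping.single 0 c)"

primrec gen_degree :: "gen \<Rightarrow> int" where
  "gen_degree (GenY n) = - n"
| "gen_degree (GenYs n) = - n"

definition word_degree :: "word \<Rightarrow> int"
  where "word_degree w = sum_list (map gen_degree (letters w))"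

definition Alg_deg :: "int \<Rightarrow> alg_elem set"
  where "Alg_deg n = alg_class ` {p. \<forall>w\<in>Poly_Mapping.keys p. word_degree w = n}"

definition Alg_neg :: "alg_elem set"
  where "Alg_neg = generate (add_monoid Alg) (\<Union>n\<in>{1..}. Alg_deg (- n))"

definition Alg_nonpos :: "alg_elem set"
  where "Alg_nonpos = Alg_neg <+>\<^bsub>Alg\<^esub> Alg_deg 0"


section \<open>\<open>\<nat>\<close>-graded modules\<close>

definition grade_decomposition ::
  "('a, 'w, 'm) module_scheme \<Rightarrow> (nat \<Rightarrow> 'w set) \<Rightarrow> 'w \<Rightarrow> (nat \<Rightarrow> 'w) \<Rightarrow> bool"
  where "grade_decomposition W G w f \<longleftrightarrow>
    (\<forall>n. f n \<in> G n) \<and> finite {n. f n \<noteq> \<zero>\<^bsub>W\<^esub>} \<and>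
    w = (\<Oplus>\<^bsub>W\<^esub>n\<in>{n. f n \<noteq> \<zero>\<^bsub>W\<^esub>}. f n)"

definition grade_int :: "('a, 'w, 'm) module_scheme \<Rightarrow> (nat \<Rightarrow> 'w set) \<Rightarrow> int \<Rightarrow> 'w set"
  where "grade_int W G k = (if k < 0 then {\<zero>\<^bsub>W\<^esub>} else G (nat k))"

text \<open>The homogeneous components are only required to be additive subgroups; they are complex
  subspaces since the scalars lie in \<open>Alg_deg 0\<close>, which preserves every component.\<close>

definition N_graded_module :: "(alg_elem, 'w, 'm) module_scheme \<Rightarrow> (nat \<Rightarrow> 'w set) \<Rightarrow> bool"
  where "N_graded_module W G \<longleftrightarrow>
    left_module Alg W \<and>
    (\<forall>n. subgroup (G n) (add_monoid W)) \<and>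
    (\<forall>w\<in>carrier W. \<exists>!f. grade_decomposition W G w f) \<and>
    G 0 \<noteq> {\<zero>\<^bsub>W\<^esub>} \<and>
    (\<forall>m n. \<forall>a\<in>Alg_deg m. \<forall>w\<in>G n. a \<odot>\<^bsub>W\<^esub> w \<in> grade_int W G (m + int n))"

definition graded_submodule ::
  "(alg_elem, 'w, 'm) module_scheme \<Rightarrow> (nat \<Rightarrow> 'w set) \<Rightarrow> 'w set \<Rightarrow> bool"
  where "graded_submodule W G U \<longleftrightarrow>
    submodule U Alg W \<and> (\<forall>u\<in>U. \<exists>f. grade_decomposition W (\<lambda>n. U \<inter> G n) u f)"

definition irreducible_N_graded_module ::
  "(alg_elem, 'w, 'm) module_scheme \<Rightarrow> (nat \<Rightarrow> 'w set) \<Rightarrow> bool"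
  where "irreducible_N_graded_module W G \<longleftrightarrow>
    N_graded_module W G \<and>
    (\<forall>U. graded_submodule W G U \<longrightarrow> U = {\<zero>\<^bsub>W\<^esub>} \<or> U = carrier W)"

definition maximal_proper_graded_submodule ::
  "(alg_elem, 'w, 'm) module_scheme \<Rightarrow> (nat \<Rightarrow> 'w set) \<Rightarrow> 'w set \<Rightarrow> bool"
  where "maximal_proper_graded_submodule W G J \<longleftrightarrow>
    graded_submodule W G J \<and> J \<noteq> carrier W \<and>
    (\<forall>U. graded_submodule W G U \<and> U \<noteq> carrier W \<and> J \<subseteq> U \<longrightarrow> U = J)"

definition isomorphic_modules ::
  "(alg_elem, 'v, 'm) module_scheme \<Rightarrow> (alg_elem, 'w, 'n) module_scheme \<Rightarrow> bool"
  where "isomorphic_modules V W \<longleftrightarrow> module_iso Alg V W \<noteq> {}"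

definition isomorphic_graded_modules ::
  "(alg_elem, 'v, 'm) module_scheme \<Rightarrow> (nat \<Rightarrow> 'v set) \<Rightarrow>
    (alg_elem, 'w, 'n) module_scheme \<Rightarrow> (nat \<Rightarrow> 'w set) \<Rightarrow> bool"
  where "isomorphic_graded_modules V G W H \<longleftrightarrow>
    (\<exists>h\<in>module_iso Alg V W. \<forall>n. h ` G n = H n)"


section \<open>The modules \<open>M(\<mu>)\<close> and \<open>L(\<mu>)\<close>\<close>

definition Alg0 :: "alg_elem ring"
  where "Alg0 = Alg\<lparr>carrier := Alg_deg 0\<rparr>"

definition I0 :: "alg_elem set"
  where "I0 = generate (add_monoid Alg)
    {a \<otimes>\<^bsub>Alg\<^esub> b | a b n. n \<ge> 1 \<and> a \<in> Alg_deg n \<and> b \<in> Alg_deg (- n)}"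

definition Alg0bar :: "alg_elem set ring"
  where "Alg0bar = Alg0 Quot I0"

definition bar_class :: "alg_elem \<Rightarrow> alg_elem set"
  where "bar_class a = I0 +>\<^bsub>Alg0\<^esub> a"

definition complex_module :: "('a \<Rightarrow> complex \<Rightarrow> complex) \<Rightarrow> ('a, complex) module"
  where "complex_module act =
    \<lparr>carrier = UNIV, mult = undefined, one = undefined, zero = 0, add = (+), smult = act\<rparr>"

text \<open>The conditions below determine the action on the carrier of \<open>Alg0bar\<close>; only its values
  there are used, so the choice is immaterial.\<close>

definition Cbar_action :: "complex \<Rightarrow> alg_elem set \<Rightarrow> complex \<Rightarrow> complex"
  where "Cbar_action \<mu> = (SOME act.
    left_module Alg0bar (complex_module act) \<and>
    (\<forall>c z. act (bar_class (scalar c)) z = c * z) \<and>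
    (\<forall>z. act (bar_class (Y 0)) z = \<mu> * z) \<and>
    (\<forall>z. act (bar_class (Ys 0)) z = inverse \<mu> * z))"

text \<open>\<open>\<complex>\<^sub>\<mu>\<close> as a module over \<open>Alg_nonpos\<close>: the negative part acts as zero, and the
  degree-zero part through its image in \<open>Alg0bar\<close>.\<close>

definition C_module :: "complex \<Rightarrow> (alg_elem, complex) module"
  where "C_module \<mu> = complex_module (\<lambda>b z. THE w.
    \<exists>x\<in>Alg_neg. \<exists>a\<in>Alg_deg 0. b = x \<oplus>\<^bsub>Alg\<^esub> a \<and> w = Cbar_action \<mu> (bar_class a) z)"

definition M_module :: "complex \<Rightarrow> (alg_elem, ((alg_elem \<times> complex) \<Rightarrow>\<^sub>0 int) set) module"
  where "M_module \<mu> = tensor_module Alg Alg_nonpos (C_module \<mu>)"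

definition M_grade :: "complex \<Rightarrow> nat \<Rightarrow> ((alg_elem \<times> complex) \<Rightarrow>\<^sub>0 int) set set"
  where "M_grade \<mu> n = generate (add_monoid (M_module \<mu>))
    {pure_tensor Alg Alg_nonpos (C_module \<mu>) a z | a z. a \<in> Alg_deg (int n)}"

definition J_submodule :: "complex \<Rightarrow> ((alg_elem \<times> complex) \<Rightarrow>\<^sub>0 int) set set"
  where "J_submodule \<mu> = (THE J. maximal_proper_graded_submodule (M_module \<mu>) (M_grade \<mu>) J)"

definition L_module :: "complex \<Rightarrow> (alg_elem, ((alg_elem \<times> complex) \<Rightarrow>\<^sub>0 int) set set) module"
  where "L_module \<mu> = quotient_module (M_module \<mu>) (J_submodule \<mu>)"

definition L_grade :: "complex \<Rightarrow> nat \<Rightarrow> ((alg_elem \<times> complex) \<Rightarrow>\<^sub>0 int) set set set"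
  where "L_grade \<mu> n = (\<lambda>x. J_submodule \<mu> +>\<^bsub>M_module \<mu>\<^esub> x) ` M_grade \<mu> n"

end

theory Submission
  imports Defs "HOL-Computational_Algebra.Fundamental_Theorem_Algebra"
begin

text \<open>The relations straighten every word of negative degree into a combination of words ending in
  a generator of negative degree, and every word of degree zero into such words plus words in
  \<open>Y\<^sub>0, Y\<^sup>*\<^sub>0\<close>.  Hence a vacuum vector \<open>x\<close> (of degree \<open>0\<close>) with \<open>Y\<^sub>0 x = \<mu> x\<close> is an
  eigenvector of the whole degree-zero part, for a character \<open>\<Phi>\<close> that depends only on \<open>\<mu>\<close>.  That
  \<open>\<Phi>\<close> exists for every \<open>\<mu> \<noteq> 0\<close> is seen on the fermionic Fock space, where \<open>Y\<^sub>n\<close> and \<open>Y\<^sup>*\<^sub>n\<close> act as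
  charge-dependent creation and annihilation operators and \<open>\<Phi>\<close> is the vacuum expectation value,
  extended by zero to the other degrees.  A graded module generated by such a vector is irreducible
  iff the annihilator of the vector is the left ideal \<open>{p. \<forall>q. \<Phi>(q p) = 0}\<close>; both \<open>L(\<mu>)\<close> and every
  irreducible graded module with eigenvalue \<open>\<mu>\<close> are therefore the quotient of the algebra by this
  ideal.  An eigenvector exists in the degree-zero part because \<open>Y\<^sub>0\<close> satisfies a nonzero polynomial
  equation on some vacuum vector, and any vector killed by the negative part and with \<open>Y\<^sub>0\<close>-eigenvalue
  \<open>\<mu>\<close> in \<open>L(\<nu>)\<close> is a multiple of the vacuum, so \<open>\<mu> = \<nu>\<close>.\<close>

section \<open>The free algebra and its grading\<close>

text \<open>The algebra is a Clifford algebra in disguise: its relations become anticommutation only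
  after each index is shifted by the charge. The Fock model must therefore contain all charges at
  once. Since \<open>Y\<^sub>0\<close> raises the charge by one, an eigenvector with nonzero
  eigenvalue is an infinite sum over charges, which is why states are arbitrary functions rather
  than finite combinations. No basis of the algebra is constructed. Straightening only bounds things
  from above, and \<Phi> supplies the matching lower bounds, so computations can stay with
  representatives in the free algebra. The degree-zero part of an irreducible module is not known in
  advance to be finite dimensional, so an eigenvalue needs an argument. On vacuum vectors
  \<open>Y\<^sup>*\<^sub>0\<close> inverts \<open>Y\<^sub>0\<close>, hence degree zero acts by
  Laurent polynomials in \<open>Y\<^sub>0\<close>. If \<open>(Y\<^sub>0 - 1) x\<close> is nonzero,
  irreducibility recovers \<open>x\<close> from it; clearing denominators equates a power of
  \<open>Y\<^sub>0\<close> with a multiple of \<open>Y\<^sub>0 - 1\<close> on \<open>x\<close>, a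
  nontrivial equation because the two polynomials are coprime.\<close>

abbreviation mon :: "gen list \<Rightarrow> complex \<Rightarrow> free_elem"
  where "mon u c \<equiv> Poly_Mapping.single (Word u) c"

abbreviation const :: "complex \<Rightarrow> free_elem"
  where "const c \<equiv> Poly_Mapping.single 0 c"

abbreviation deg :: "gen list \<Rightarrow> int"
  where "deg u \<equiv> sum_list (map gen_degree u)"

lemma const_eq_mon: "const c = mon [] c"
  by (simp add: zero_word_def)

lemma mon_mult: "mon u a * mon v b = mon (u @ v) (a * b)"
  by (simp add: mult_single plus_word_def)

lemma const_mult_mon: "const a * mon v b = mon v (a * b)" "mon v b * const a = mon v (a * b)"
  by (simp_all add: const_eq_mon mon_mult mult.commute)

lemma free_elem_expansion:
  "p = (\<Sum>w\<in>Poly_Mapping.keys p. mon (letters w) (Poly_Mapping.lookup p w))"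
  by (rule poly_mapping_eqI) (simp add: lookup_sum lookup_single when_def in_keys_iff)

text \<open>The monomial case may use that the word occurs in \<open>p\<close>; through this
  \<open>homog_induct\<close> inherits the degree condition.\<close>

lemma free_elem_induct [case_names zero mon add]:
  assumes "P 0" and "\<And>u c. Word u \<in> Poly_Mapping.keys p \<Longrightarrow> P (mon u c)"
    and "\<And>p q. P p \<Longrightarrow> P q \<Longrightarrow> P (p + q)"
  shows "P p"
proof -
  have "P (\<Sum>w\<in>S. mon (letters w) (Poly_Mapping.lookup p w))"
    if "S \<subseteq> Poly_Mapping.keys p" "finite S" for S
    using that(2,1) by (induction S) (use assms(1,3) assms(2)[of "letters _"] in auto)
  from this[of "Poly_Mapping.keys p"] show ?thesis
    using free_elem_expansion[of p] by simp
qed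

lemma const_mult_commute: "const a * p = p * const a"
  by (induction p rule: free_elem_induct) (simp_all add: const_mult_mon mult.commute algebra_simps)

section \<open>Grading of the free algebra by word degree\<close>

definition homog :: "int \<Rightarrow> free_elem set"
  where "homog n = {p. \<forall>w\<in>Poly_Mapping.keys p. word_degree w = n}"

definition hpart :: "int \<Rightarrow> free_elem \<Rightarrow> free_elem"
  where "hpart n = Poly_Mapping.mapp (\<lambda>w c. c when word_degree w = n)"

lemma lookup_hpart:
  "Poly_Mapping.lookup (hpart n p) w = (if word_degree w = n then Poly_Mapping.lookup p w else 0)"
  by (simp add: hpart_def lookup_mapp when_def in_keys_iff)

lemma hpart_homog [simp]: "hpart n p \<in> homog n"
  by (auto simp: homog_def in_keys_iff lookup_hpart split: if_splits)

lemma hpart_add: "hpart n (p + q) = hpart n p + hpart n q"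
  by (rule poly_mapping_eqI) (simp add: lookup_hpart lookup_add)

lemma homog_zero [simp]: "0 \<in> homog n"
  by (simp add: homog_def)

lemma homog_mon [simp]: "deg u = n \<Longrightarrow> mon u c \<in> homog n"
  by (simp add: homog_def word_degree_def)

lemma homog_const [simp]: "const c \<in> homog 0"
  by (simp add: const_eq_mon)

lemma homog_one [simp]: "1 \<in> homog 0"
  using homog_const[of 1] by simp

lemma homog_add: "p \<in> homog n \<Longrightarrow> q \<in> homog n \<Longrightarrow> p + q \<in> homog n"
  using keys_add[of p q] by (auto simp: homog_def)

lemma homog_uminus: "p \<in> homog n \<Longrightarrow> - p \<in> homog n"
  by (auto simp: homog_def in_keys_iff)

lemma homog_diff: "p \<in> homog n \<Longrightarrow> q \<in> homog n \<Longrightarrow> p - q \<in> homog n"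
  using homog_add[of p n "- q"] homog_uminus[of q n] by simp

lemma homog_mult: "p \<in> homog m \<Longrightarrow> q \<in> homog n \<Longrightarrow> p * q \<in> homog (m + n)"
  using keys_mult[of p q] by (fastforce simp: homog_def word_degree_def plus_word_def)

lemma homog_induct [consumes 1, case_names zero mon add]:
  assumes "p \<in> homog n" and "P 0" and "\<And>u c. deg u = n \<Longrightarrow> P (mon u c)"
    and "\<And>p q. P p \<Longrightarrow> P q \<Longrightarrow> P (p + q)"
  shows "P p"
  by (rule free_elem_induct) (use assms in \<open>force simp: homog_def word_degree_def\<close>)+

lemma homog_decomposition:
  "\<exists>N. finite N \<and> p = (\<Sum>n\<in>N. hpart n p) \<and> (\<forall>n. n \<notin> N \<longrightarrow> hpart n p = 0)"
proof (intro exI conjI allI impI)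
  let ?N = "word_degree ` Poly_Mapping.keys p"
  show "finite ?N" by simp
  have zero: "Poly_Mapping.lookup p w = 0" if "word_degree w \<notin> ?N" for w
    using that by (auto simp: in_keys_iff)
  show "p = (\<Sum>n\<in>?N. hpart n p)"
    by (rule poly_mapping_eqI) (simp add: lookup_sum lookup_hpart zero)
  show "hpart n p = 0" if "n \<notin> ?N" for n
    using that zero by (intro poly_mapping_eqI) (auto simp: lookup_hpart)
qed

section \<open>Passing to the quotient by the relations\<close>

lemma free_algebra_simps [simp]:
  "carrier free_algebra = UNIV" "monoid.mult free_algebra = (*)" "one free_algebra = 1"
  "zero free_algebra = 0" "add free_algebra = (+)"
  by (simp_all add: free_algebra_def)

lemma ring_free_algebra: "ring free_algebra"
proof (rule ringI)
  show "abelian_group free_algebra"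
    by (rule abelian_groupI) (auto simp: add.assoc add.commute intro: exI[of _ "- _"] add.left_inverse)
  show "Group.monoid free_algebra"
    by (rule Group.monoidI) (auto simp: mult.assoc)
qed (auto simp: algebra_simps)

interpretation Free: ring free_algebra
  by (rule ring_free_algebra)

lemma ideal_relation_ideal: "ideal relation_ideal free_algebra"
  unfolding relation_ideal_def by (rule Free.genideal_ideal) simp

lemma a_inv_free [simp]: "a_inv free_algebra p = - p"
  by (rule Free.minus_equality) simp_all

lemma relation_ideal_closed:
  "0 \<in> relation_ideal"
  "p \<in> relation_ideal \<Longrightarrow> q \<in> relation_ideal \<Longrightarrow> p + q \<in> relation_ideal"
  "p \<in> relation_ideal \<Longrightarrow> - p \<in> relation_ideal"
  "p \<in> relation_ideal \<Longrightarrow> r * p \<in> relation_ideal"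
  "p \<in> relation_ideal \<Longrightarrow> p * r \<in> relation_ideal"
proof -
  interpret Rel: ideal relation_ideal free_algebra by (rule ideal_relation_ideal)
  show "0 \<in> relation_ideal"
    using Rel.zero_closed by simp
  show "p + q \<in> relation_ideal" if "p \<in> relation_ideal" "q \<in> relation_ideal"
    using Rel.a_closed[OF that] by simp
  show "- p \<in> relation_ideal" if "p \<in> relation_ideal"
    using Rel.a_inv_closed[OF that] by simp
  show "r * p \<in> relation_ideal" "p * r \<in> relation_ideal" if "p \<in> relation_ideal"
    using Rel.I_l_closed[OF that, of r] Rel.I_r_closed[OF that, of r] by simp_all
qed

lemma relation_ideal_minimal:
  assumes "defining_relations \<subseteq> I" "0 \<in> I" "\<And>p q. p \<in> I \<Longrightarrow> q \<in> I \<Longrightarrow> p + q \<in> I"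
    "\<And>p r. p \<in> I \<Longrightarrow> r * p \<in> I" "\<And>p r. p \<in> I \<Longrightarrow> p * r \<in> I"
  shows "relation_ideal \<subseteq> I"
proof -
  have neg: "- p \<in> I" if "p \<in> I" for p
    using assms(4)[OF that, of "- 1"] by simp
  have "ideal I free_algebra"
  proof (rule idealI[OF ring_free_algebra])
    show "subgroup I (add_monoid free_algebra)"
      by (rule Free.add.subgroupI)
         (use assms neg in \<open>auto simp: a_inv_def[symmetric]\<close>)
  qed (use assms in auto)
  then show ?thesis
    unfolding relation_ideal_def using assms(1) by (rule Free.genideal_minimal)
qed

lemma defining_relations_subset: "defining_relations \<subseteq> relation_ideal"
  unfolding relation_ideal_def by (rule Free.genideal_self) simp

text \<open>The relations as rewrite rules inside a word: a generator of the ideal is multiplied by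
  the context \<open>u\<close>, which carries the coefficient, and by \<open>v\<close>.\<close>

lemma relation_word:
  "mon (u @ [GenY m, GenY n] @ v) c + mon (u @ [GenY (n + 1), GenY (m - 1)] @ v) c \<in> relation_ideal"
  "mon (u @ [GenYs m, GenYs n] @ v) c + mon (u @ [GenYs (n + 1), GenYs (m - 1)] @ v) c \<in> relation_ideal"
  "mon (u @ [GenY m, GenYs n] @ v) c + mon (u @ [GenYs (n - 1), GenY (m + 1)] @ v) c
     - (if m + n = 0 then mon (u @ v) c else 0) \<in> relation_ideal"
proof -
  have *: "mon u c * r * mon v 1 \<in> relation_ideal" if "r \<in> defining_relations" for r
    using that defining_relations_subset by (blast intro: relation_ideal_closed)
  have "freeY m * freeY n + freeY (n + 1) * freeY (m - 1) \<in> defining_relations"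
    by (auto simp: defining_relations_def)
  from *[OF this] show "mon (u @ [GenY m, GenY n] @ v) c + mon (u @ [GenY (n + 1), GenY (m - 1)] @ v) c \<in> relation_ideal"
    by (simp add: algebra_simps freeY_def mon_mult)
  have "freeYs m * freeYs n + freeYs (n + 1) * freeYs (m - 1) \<in> defining_relations"
    by (auto simp: defining_relations_def)
  from *[OF this] show "mon (u @ [GenYs m, GenYs n] @ v) c + mon (u @ [GenYs (n + 1), GenYs (m - 1)] @ v) c \<in> relation_ideal"
    by (simp add: algebra_simps freeYs_def mon_mult)
  have "freeY m * freeYs n + freeYs (n - 1) * freeY (m + 1) - (if m + n = 0 then 1 else 0) \<in> defining_relations"
    by (force simp: defining_relations_def)
  from *[OF this] show "mon (u @ [GenY m, GenYs n] @ v) c + mon (u @ [GenYs (n - 1), GenY (m + 1)] @ v) c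
     - (if m + n = 0 then mon (u @ v) c else 0) \<in> relation_ideal"
    by (auto simp: algebra_simps freeYs_def freeY_def mon_mult split: if_splits)
qed

lemma (in abelian_subgroup) a_rcos_eq_iff:
  assumes "x \<in> carrier G" "y \<in> carrier G"
  shows "H +> x = H +> y \<longleftrightarrow> x \<ominus> y \<in> H"
proof
  assume "H +> x = H +> y"
  with assms have "x \<in> H +> y" using a_rcos_self by blast
  then show "x \<ominus> y \<in> H" using a_rcos_module[of y x] assms by (simp add: minus_eq)
next
  assume "x \<ominus> y \<in> H"
  then have "x \<in> H +> y" using a_rcos_module[of y x] assms by (simp add: minus_eq)
  then show "H +> x = H +> y" using a_repr_independence'[of x y] assms by simp
qed

lemma alg_class_eq_iff: "alg_class p = alg_class q \<longleftrightarrow> p - q \<in> relation_ideal"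
proof -
  have "abelian_subgroup relation_ideal free_algebra"
    using ideal_relation_ideal by (simp add: abelian_subgroupI3 ideal.axioms Free.abelian_group_axioms)
  from abelian_subgroup.a_rcos_eq_iff[OF this, of p q] show ?thesis
    by (simp add: alg_class_def a_minus_def)
qed

lemma carrier_Alg: "carrier Alg = range alg_class"
  by (auto simp: Alg_def FactRing_def A_RCOSETS_defs alg_class_def a_r_coset_def r_coset_def)

lemma alg_class_carrier [simp]: "alg_class p \<in> carrier Alg"
  by (simp add: carrier_Alg)

lemma alg_class_ops [simp]:
  "alg_class p \<oplus>\<^bsub>Alg\<^esub> alg_class q = alg_class (p + q)"
  "alg_class p \<otimes>\<^bsub>Alg\<^esub> alg_class q = alg_class (p * q)"
  "\<one>\<^bsub>Alg\<^esub> = alg_class 1"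
  "\<zero>\<^bsub>Alg\<^esub> = alg_class 0"
proof -
  interpret Rel: ideal relation_ideal free_algebra by (rule ideal_relation_ideal)
  show "\<zero>\<^bsub>Alg\<^esub> = alg_class 0"
    using Rel.a_rcos_const[of 0] by (simp add: Alg_def FactRing_def alg_class_def relation_ideal_closed)
qed (use ideal.a_rcos_sum[OF ideal_relation_ideal] ideal.rcoset_mult_add[OF ideal_relation_ideal] in \<open>auto simp: Alg_def FactRing_def alg_class_def\<close>)

lemma ring_Alg: "ring Alg"
  unfolding Alg_def by (rule ideal.quotient_is_ring[OF ideal_relation_ideal])

interpretation Alg: ring Alg
  by (rule ring_Alg)

lemma a_inv_Alg [simp]: "a_inv Alg (alg_class p) = alg_class (- p)"
  by (rule Alg.minus_equality) simp_all

lemma Alg_deg_eq: "Alg_deg n = alg_class ` homog n"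
  by (simp add: Alg_deg_def homog_def)

section \<open>Straightening words\<close>

fun gen_index :: "gen \<Rightarrow> int" where
  "gen_index (GenY n) = n"
| "gen_index (GenYs n) = n"

fun inversions :: "gen list \<Rightarrow> nat" where
  "inversions [] = 0"
| "inversions (GenY m # w) = length (filter (\<lambda>g. g \<in> range GenYs) w) + inversions w"
| "inversions (GenYs m # w) = inversions w"

abbreviation square_sum :: "gen list \<Rightarrow> nat"
  where "square_sum w \<equiv> sum_list (map (\<lambda>g. nat ((gen_index g)\<^sup>2)) w)"

lemma inversions_append:
  "inversions (u @ v) = inversions u + inversions v +
    length (filter (\<lambda>g. g \<in> range GenY) u) * length (filter (\<lambda>g. g \<in> range GenYs) v)"
  by (induction u rule: inversions.induct) auto

text \<open>A star anywhere to the right of an unstarred letter forces such a pair at adjacent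
  positions, so excluding adjacent pairs already fixes the shape of the word.\<close>

lemma stars_first:
  assumes "\<And>u v a b. w \<noteq> u @ [GenY a, GenYs b] @ v"
  obtains i j where "w = map GenYs i @ map GenY j"
proof -
  have "\<exists>i j. w = map GenYs i @ map GenY j"
    using assms
  proof (induction w)
    case (Cons x w)
    have "w \<noteq> u @ [GenY a, GenYs b] @ v" for u v a b
      using Cons.prems[of "x # u"] by simp
    then obtain i j where w: "w = map GenYs i @ map GenY j"
      using Cons.IH by blast
    show ?case
    proof (cases x)
      case (GenY a)
      have "i = []"
        using Cons.prems[of "[]" a "hd i" "map GenYs (tl i) @ map GenY j"] w GenY by (cases i) auto
      then show ?thesis
        using w GenY by (intro exI[of _ "[]"] exI[of _ "a # j"]) simp
    next
      case (GenYs b)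
      then show ?thesis
        using w by (intro exI[of _ "b # i"] exI[of _ j]) simp
    qed
  qed simp
  then show ?thesis using that by blast
qed

lemma sorted_if_adjacent:
  fixes w :: "int list"
  assumes "\<And>u v m n. w = u @ [m, n] @ v \<Longrightarrow> m \<le> n"
  shows "sorted w"
proof -
  have "w ! i \<le> w ! Suc i" if "Suc i < length w" for i
  proof -
    have "w = take i w @ [w ! i, w ! Suc i] @ drop (Suc (Suc i)) w"
      using that by (simp add: Cons_nth_drop_Suc)
    from assms[OF this] show ?thesis .
  qed
  then show ?thesis by (simp add: sorted_iff_nth_Suc)
qed

lemma map_butlast_last: "xs \<noteq> [] \<Longrightarrow> map f xs = map f (butlast xs) @ [f (last xs)]"
  by (induction xs rule: rev_induct) simp_all

text \<open>The difference of the two sides is \<open>2 * (m - n - 1)\<close>. The bound on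
  \<open>m\<close> is sharp: for \<open>m = n + 1\<close> the swap returns the same pair.\<close>

lemma square_swap:
  fixes m n :: int
  assumes "m \<ge> n + 2"
  shows "nat ((n + 1)\<^sup>2) + nat ((m - 1)\<^sup>2) < nat (m\<^sup>2) + nat (n\<^sup>2)"
proof -
  have "(n + 1)\<^sup>2 + (m - 1)\<^sup>2 < m\<^sup>2 + n\<^sup>2"
    using assms by (simp add: power2_eq_square algebra_simps)
  then have "nat ((n + 1)\<^sup>2 + (m - 1)\<^sup>2) < nat (m\<^sup>2 + n\<^sup>2)"
    by (subst nat_less_eq_zless) simp_all
  then show ?thesis by (simp add: nat_add_distrib)
qed

text \<open>A predicate on words instead of elements of an algebra, so that one termination argument
  serves the Fock space, the dual vacuum and the abstract algebra. The pair \<open>m\<close>,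
  \<open>m - 1\<close> is its own rewrite, so the relation says that twice the word is zero; this is
  why such words must satisfy \<open>Q\<close> outright. \<open>SY\<close> is the relation of
  \<open>YS\<close> read backwards, needed to push a star to the right end.\<close>

locale straightening =
  fixes Q :: "gen list \<Rightarrow> bool"
  assumes YY_zero: "\<And>u v m. Q (u @ [GenY m, GenY (m - 1)] @ v)"
    and SS_zero: "\<And>u v m. Q (u @ [GenYs m, GenYs (m - 1)] @ v)"
    and YY: "\<And>u v m n. Q (u @ [GenY (n + 1), GenY (m - 1)] @ v) \<Longrightarrow> Q (u @ [GenY m, GenY n] @ v)"
    and SS: "\<And>u v m n. Q (u @ [GenYs (n + 1), GenYs (m - 1)] @ v) \<Longrightarrow> Q (u @ [GenYs m, GenYs n] @ v)"
    and YS: "\<And>u v m n. Q (u @ [GenYs (n - 1), GenY (m + 1)] @ v) \<Longrightarrow> (m + n = 0 \<Longrightarrow> Q (u @ v)) \<Longrightarrow>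
      Q (u @ [GenY m, GenYs n] @ v)"
    and SY: "\<And>u v m n. Q (u @ [GenY m, GenYs n] @ v) \<Longrightarrow> (m + n = 0 \<Longrightarrow> Q (u @ v)) \<Longrightarrow>
      Q (u @ [GenYs (n - 1), GenY (m + 1)] @ v)"
    and last_pos: "\<And>u m. m > 0 \<Longrightarrow> Q (u @ [GenY m])" "\<And>u m. m > 0 \<Longrightarrow> Q (u @ [GenYs m])"
begin

text \<open>Here rewriting runs against the order in which stars come first. It still ends: each
  step shortens the list behind the star and raises the star's index, so the star arrives at the end
  with positive index. The contraction terms keep the degree and lose two letters, so the hypothesis
  on words shorter than \<open>L\<close> covers them.\<close>

lemma move_star_right:
  assumes "\<And>w. length w < L \<Longrightarrow> deg w \<le> 0 \<Longrightarrow> Q w"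
    and "n > 0" "\<forall>j\<in>set js. j \<le> 0"
    and "length (u @ [GenYs n] @ map GenY js) \<le> L" "deg (u @ [GenYs n] @ map GenY js) \<le> 0"
  shows "Q (u @ [GenYs n] @ map GenY js)"
  using assms(2-)
proof (induction js arbitrary: u n)
  case Nil
  then show ?case using last_pos(2) by simp
next
  case (Cons j js)
  have "Q ((u @ [GenY (j - 1)]) @ [GenYs (n + 1)] @ map GenY js)"
    by (rule Cons.IH) (use Cons.prems in auto)
  moreover have "Q (u @ map GenY js)" if "(j - 1) + (n + 1) = 0"
    by (rule assms(1)) (use Cons.prems that in auto)
  ultimately have "Q (u @ [GenYs ((n + 1) - 1), GenY ((j - 1) + 1)] @ map GenY js)"
    by (intro SY) simp_all
  then show ?case by simp
qed

text \<open>Sortedness puts the largest index of each block last. If a last index is positive, the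
  word already ends well or its last star can be moved to the end. Otherwise all indices are at most
  0, so the degree is at least 0; being also at most 0, it vanishes, and with it every
  index.\<close>

lemma sorted_case:
  assumes "\<And>w. length w < L \<Longrightarrow> deg w \<le> 0 \<Longrightarrow> Q w"
    and base: "\<And>w. set w \<subseteq> {GenY 0, GenYs 0} \<Longrightarrow> Q w"
    and "sorted i" "sorted j" "length (map GenYs i @ map GenY j) \<le> L"
    and deg: "deg (map GenYs i @ map GenY j) \<le> 0"
  shows "Q (map GenYs i @ map GenY j)"
proof (cases "j \<noteq> [] \<and> last j > 0")
  case True
  then have "map GenYs i @ map GenY j = (map GenYs i @ map GenY (butlast j)) @ [GenY (last j)]"
    by (simp add: map_butlast_last)
  then show ?thesis using last_pos(1) True by metis
next
  case False
  have le_last: "x \<le> last xs" if "sorted xs" "x \<in> set xs" for x :: int and xs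
    using that by (induction xs) (auto split: if_splits)
  have "sum_list (map uminus xs) = - sum_list xs" for xs :: "int list"
    by (induction xs) simp_all
  then have sum: "deg (map GenYs i) = - sum_list i" "deg (map GenY j) = - sum_list j"
    by (simp_all add: comp_def)
  have j: "\<forall>x\<in>set j. x \<le> 0"
    using False le_last[OF \<open>sorted j\<close>] by (cases "j = []") force+
  then have sum_j: "sum_list j \<le> 0" using sum_list_nonpos by blast
  show ?thesis
  proof (cases "i \<noteq> [] \<and> last i > 0")
    case True
    then have *: "map GenYs i @ map GenY j = map GenYs (butlast i) @ [GenYs (last i)] @ map GenY j"
      by (simp add: map_butlast_last)
    show ?thesis
      unfolding *
    proof (rule move_star_right)
      show "Q w" if "length w < L" "deg w \<le> 0" for w using that by (rule assms(1))
    qed (use True j assms(5) deg in \<open>unfold *, blast+\<close>)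
  next
    case False
    have i: "\<forall>x\<in>set i. x \<le> 0"
      using False le_last[OF \<open>sorted i\<close>] by (cases "i = []") force+
    then have "sum_list i \<le> 0" using sum_list_nonpos by blast
    with sum deg sum_j have "sum_list i = 0" "sum_list j = 0" by auto
    have zero: "\<forall>x\<in>set xs. x = 0" if "\<forall>x\<in>set xs. x \<le> 0" "sum_list xs = 0" for xs :: "int list"
      using that by (induction xs) (auto simp: sum_list_nonpos add_nonpos_eq_0_iff)
    show ?thesis
      by (rule base) (use zero[OF i] zero[OF j] \<open>sum_list i = 0\<close> \<open>sum_list j = 0\<close> in auto)
  qed
qed

text \<open>Rewriting terminates: moving \<open>Y\<^sub>m\<close> past \<open>Y\<^sup>*\<^sub>n\<close> removes an inversion, and replacing
  \<open>Y\<^sub>m Y\<^sub>n\<close> by \<open>Y\<^bsub>n+1\<^esub> Y\<^bsub>m-1\<^esub>\<close> with \<open>m \<ge> n + 2\<close> lowers the sum of the squared indices.\<close>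

theorem nonpositive_degree:
  assumes base: "\<And>w. set w \<subseteq> {GenY 0, GenYs 0} \<Longrightarrow> Q w"
  shows "deg w \<le> 0 \<Longrightarrow> Q w"
proof (induction w rule: wf_induct_rule[OF wf_measures[of "[length, inversions, square_sum]"]])
  case (1 w)
  note IH = 1(1) and deg = 1(2)
  show ?case
  proof (cases "\<exists>u v a b. w = u @ [GenY a, GenYs b] @ v")
    case True
    then obtain u v a b where w: "w = u @ [GenY a, GenYs b] @ v" by blast
    show ?thesis
      unfolding w
      by (rule YS; rule IH) (use deg in \<open>auto simp: w inversions_append\<close>)
  next
    case no_YS: False
    show ?thesis
    proof (cases "\<exists>u v m n. n < m \<and> (w = u @ [GenY m, GenY n] @ v \<or> w = u @ [GenYs m, GenYs n] @ v)")
      case True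
      then obtain u v m n where "n < m" and
        w: "w = u @ [GenY m, GenY n] @ v \<or> w = u @ [GenYs m, GenYs n] @ v" by blast
      show ?thesis
      proof (cases "n = m - 1")
        case True
        then show ?thesis using w YY_zero SS_zero by metis
      next
        case False
        with \<open>n < m\<close> have sq: "nat ((n + 1)\<^sup>2) + nat ((m - 1)\<^sup>2) < nat (m\<^sup>2) + nat (n\<^sup>2)"
          by (intro square_swap) simp
        from w show ?thesis
        proof
          assume w: "w = u @ [GenY m, GenY n] @ v"
          show ?thesis
            unfolding w by (rule YY; rule IH) (use deg sq in \<open>auto simp: w inversions_append\<close>)
        next
          assume w: "w = u @ [GenYs m, GenYs n] @ v"
          show ?thesis
            unfolding w by (rule SS; rule IH) (use deg sq in \<open>auto simp: w inversions_append\<close>)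
        qed
      qed
    next
      case False
      obtain i j where w: "w = map GenYs i @ map GenY j"
        using no_YS by (metis stars_first)
      have "sorted i"
      proof (rule sorted_if_adjacent)
        fix u v m n assume "i = u @ [m, n] @ v"
        then have "w = map GenYs u @ [GenYs m, GenYs n] @ (map GenYs v @ map GenY j)" using w by simp
        then show "m \<le> n" using False by (metis not_le)
      qed
      moreover have "sorted j"
      proof (rule sorted_if_adjacent)
        fix u v m n assume "j = u @ [m, n] @ v"
        then have "w = (map GenYs i @ map GenY u) @ [GenY m, GenY n] @ map GenY v" using w by simp
        then show "m \<le> n" using False by (metis not_le)
      qed
      moreover have "Q w'" if "length w' < length w" "deg w' \<le> 0" for w'
        using IH that by simp
      ultimately show ?thesis
        unfolding w using deg base by (intro sorted_case[of "length w"]) (auto simp: w)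
    qed
  qed
qed

end

text \<open>The relations preserve degree, so \<open>deg w < 0 \<longrightarrow> Q w\<close> is
  again closed under them, and the words in \<open>GenY 0\<close> and \<open>GenYs 0\<close> satisfy
  it vacuously because their degree is 0.\<close>

lemma (in straightening) negative_degree:
  assumes "deg w < 0"
  shows "Q w"
proof -
  interpret W: straightening "\<lambda>w. deg w < 0 \<longrightarrow> Q w"
  proof unfold_locales
  qed (auto intro: YY_zero[simplified] SS_zero[simplified] YY[simplified] SS[simplified]
      YS[simplified] SY[simplified] last_pos)
  show ?thesis
  proof (rule W.nonpositive_degree[rule_format, OF _ _ assms])
    fix w assume "set w \<subseteq> {GenY 0, GenYs 0}" "deg w < 0"
    moreover have "deg w = 0" if "set w \<subseteq> {GenY 0, GenYs 0}" for w
      using that by (induction w) auto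
    ultimately show "Q w" by simp
  qed (use assms in simp)
qed

section \<open>The vacuum functional\<close>

text \<open>A state assigns a coefficient to each charge and each set of occupied levels.  The vacuum of
  charge \<open>c\<close> has exactly the levels below \<open>c\<close> occupied.\<close>

type_synonym fock = "int \<Rightarrow> int set \<Rightarrow> complex"

text \<open>Sets with infinitely many elements above \<open>k\<close> get the junk sign \<open>0\<close>; they never occur in an
  \<open>admissible\<close> state.\<close>

definition csign :: "int \<Rightarrow> int set \<Rightarrow> complex"
  where "csign k S = (if finite {s\<in>S. k < s} then (-1) ^ card {s\<in>S. k < s} else 0)"

text \<open>Exterior multiplication on semi-infinite wedges written with the highest level first:
  the new factor enters in front and passes the occupied levels above \<open>k\<close>. States are
  coefficient functions, so the value at \<open>S\<close> is read from the set before the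
  operation.\<close>

definition create :: "int \<Rightarrow> (int set \<Rightarrow> complex) \<Rightarrow> int set \<Rightarrow> complex"
  where "create k f S = (if k \<in> S then csign k S * f (S - {k}) else 0)"

definition annih :: "int \<Rightarrow> (int set \<Rightarrow> complex) \<Rightarrow> int set \<Rightarrow> complex"
  where "annih k f S = (if k \<in> S then 0 else csign k S * f (insert k S))"

lemma csign_remove: "csign b (S - {a}) = (if a \<in> S \<and> b < a then - csign b S else csign b S)"
proof (cases "a \<in> S \<and> b < a")
  case True
  let ?A = "{s\<in>S - {a}. b < s}"
  have "{s\<in>S. b < s} = insert a ?A" using True by auto
  then show ?thesis using True by (auto simp: csign_def)
next
  case False
  then have "{s\<in>S - {a}. b < s} = {s\<in>S. b < s}" by auto
  then show ?thesis using False by (simp add: csign_def)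
qed

lemma csign_insert: "csign b (insert a S) = (if a \<notin> S \<and> b < a then - csign b S else csign b S)"
  using csign_remove[of b "insert a S" a] csign_remove[of b S a] by (auto simp: insert_absorb)

lemma csign_square: "csign k S * csign k S = (if finite {s\<in>S. k < s} then 1 else 0)"
  by (simp add: csign_def flip: power_add mult_2)

lemma create_create: "create a (create b g) S = - create b (create a g) S"
  by (cases a b rule: linorder_cases) (auto simp: create_def csign_remove Diff_insert2[symmetric] insert_commute
    simp flip: Diff_insert)

lemma annih_annih: "annih a (annih b g) S = - annih b (annih a g) S"
  by (cases a b rule: linorder_cases) (auto simp: annih_def csign_insert insert_commute)

text \<open>For \<open>a = b\<close> exactly one of the two products survives, according to whether
  the level is occupied, and it carries the square of a sign. Boundedness of \<open>S\<close> leaves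
  finitely many levels above \<open>a\<close>, so that this square is 1 and not the junk value
  0.\<close>

lemma create_annih:
  assumes "g S \<noteq> 0 \<Longrightarrow> bdd_above S"
  shows "create a (annih b g) S = - annih b (create a g) S + (if a = b then g S else 0)"
proof (cases "a = b")
  case False
  then show ?thesis
    by (cases a b rule: linorder_cases)
       (auto simp: create_def annih_def csign_insert csign_remove insert_Diff_if)
next
  case True
  have "csign a S * csign a S * g S = g S"
  proof (cases "g S = 0")
    case False
    then obtain B where "\<And>s. s \<in> S \<Longrightarrow> s \<le> B"
      using assms by (auto simp: bdd_above_def)
    then have "{s\<in>S. a < s} \<subseteq> {a..B}" by auto
    then have "finite {s\<in>S. a < s}" by (rule finite_subset) simp
    then show ?thesis by (simp add: csign_square)
  qed simp
  then show ?thesis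
    using True by (auto simp: create_def annih_def csign_insert csign_remove insert_absorb mult.assoc)
qed

text \<open>The shift of the level by the charge turns \<open>Y\<^sub>m Y\<^sub>n = - Y\<^bsub>n+1\<^esub> Y\<^bsub>m-1\<^esub>\<close> into the
  anticommutation of creation operators.\<close>

fun gen_act :: "gen \<Rightarrow> fock \<Rightarrow> fock" where
  "gen_act (GenY n) f = (\<lambda>c. create (c - 1 - n) (f (c - 1)))"
| "gen_act (GenYs n) f = (\<lambda>c. annih (n + c) (f (c + 1)))"

abbreviation word_act :: "gen list \<Rightarrow> fock \<Rightarrow> fock"
  where "word_act \<equiv> foldr gen_act"

definition lin_comb :: "complex \<Rightarrow> fock \<Rightarrow> complex \<Rightarrow> fock \<Rightarrow> fock"
  where "lin_comb a f b g = (\<lambda>c S. a * f c S + b * g c S)"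

lemma gen_act_lin_comb: "gen_act x (lin_comb a f b g) = lin_comb a (gen_act x f) b (gen_act x g)"
  by (cases x) (auto simp: lin_comb_def fun_eq_iff create_def annih_def algebra_simps)

lemma word_act_lin_comb: "word_act w (lin_comb a f b g) = lin_comb a (word_act w f) b (word_act w g)"
  by (induction w) (simp_all add: gen_act_lin_comb)

lemma word_act_scale: "word_act w (\<lambda>c S. a * f c S) = (\<lambda>c S. a * word_act w f c S)"
  using word_act_lin_comb[of w a f 0 f] by (simp add: lin_comb_def)

lemma word_act_zero: "word_act w (\<lambda>c S. 0) = (\<lambda>c S. 0)"
  using word_act_scale[of w 0] by simp

definition admissible :: "fock \<Rightarrow> bool"
  where "admissible f \<longleftrightarrow> (\<forall>c S. f c S \<noteq> 0 \<longrightarrow> bdd_above S)"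

lemma admissible_word_act:
  assumes "admissible f" shows "admissible (word_act w f)"
proof (induction w)
  case (Cons x w)
  have mono: "bdd_above S" if "bdd_above T" "S \<subseteq> insert k T" for S T and k :: int
    using that(2) by (rule bdd_above_mono[rotated]) (simp add: that(1))
  have IH: "bdd_above S" if "word_act w f c S \<noteq> 0" for c S
    using Cons that by (simp add: admissible_def)
  show ?case
    unfolding admissible_def
  proof (intro allI impI)
    fix c S assume nz: "word_act (x # w) f c S \<noteq> 0"
    show "bdd_above S"
    proof (cases x)
      case (GenY n)
      then have "word_act w f (c - 1) (S - {c - 1 - n}) \<noteq> 0"
        using nz by (simp add: create_def split: if_splits)
      then have "bdd_above (S - {c - 1 - n})" by (rule IH)
      then show ?thesis by (rule mono[of _ _ "c - 1 - n"]) blast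
    next
      case (GenYs n)
      then have "word_act w f (c + 1) (insert (n + c) S) \<noteq> 0"
        using nz by (simp add: annih_def split: if_splits)
      then have "bdd_above (insert (n + c) S)" by (rule IH)
      then show ?thesis by (rule mono) blast
    qed
  qed
qed (use assms in simp)

text \<open>At charge \<open>c\<close> the two letters of \<open>Y\<^sub>m Y\<^sub>n\<close> create
  the levels \<open>c - 1 - m\<close> and \<open>c - 2 - n\<close>; exchanging the levels turns the
  indices into \<open>n + 1\<close> and \<open>m - 1\<close>. For
  \<open>Y\<^sub>m Y\<^sup>*\<^sub>n\<close> the levels are \<open>c - 1 - m\<close> and
  \<open>c - 1 + n\<close>, which coincide exactly when \<open>m + n = 0\<close>.\<close>

lemma word_act_relations:
  assumes "admissible f"
  shows "word_act (u @ [GenY m, GenY n] @ v) f c S = - word_act (u @ [GenY (n + 1), GenY (m - 1)] @ v) f c S"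
    and "word_act (u @ [GenYs m, GenYs n] @ v) f c S = - word_act (u @ [GenYs (n + 1), GenYs (m - 1)] @ v) f c S"
    and "word_act (u @ [GenY m, GenYs n] @ v) f c S = - word_act (u @ [GenYs (n - 1), GenY (m + 1)] @ v) f c S
      + (if m + n = 0 then word_act (u @ v) f c S else 0)"
proof -
  define g where "g = word_act v f"
  have g: "admissible g" unfolding g_def using assms by (rule admissible_word_act)
  have "word_act [GenY m, GenY n] g = lin_comb (-1) (word_act [GenY (n + 1), GenY (m - 1)] g) 0 g"
    by (simp add: lin_comb_def fun_eq_iff) (subst create_create, simp add: algebra_simps)
  from arg_cong[OF this, of "word_act u"]
  show "word_act (u @ [GenY m, GenY n] @ v) f c S = - word_act (u @ [GenY (n + 1), GenY (m - 1)] @ v) f c S"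
    by (simp add: word_act_lin_comb flip: g_def) (simp add: lin_comb_def)
  have "word_act [GenYs m, GenYs n] g = lin_comb (-1) (word_act [GenYs (n + 1), GenYs (m - 1)] g) 0 g"
    by (simp add: lin_comb_def fun_eq_iff) (subst annih_annih, simp add: algebra_simps)
  from arg_cong[OF this, of "word_act u"]
  show "word_act (u @ [GenYs m, GenYs n] @ v) f c S = - word_act (u @ [GenYs (n + 1), GenYs (m - 1)] @ v) f c S"
    by (simp add: word_act_lin_comb flip: g_def) (simp add: lin_comb_def)
  have "word_act [GenY m, GenYs n] g =
      lin_comb (-1) (word_act [GenYs (n - 1), GenY (m + 1)] g) (if m + n = 0 then 1 else 0) g"
    using g by (auto simp: lin_comb_def fun_eq_iff admissible_def create_annih algebra_simps)
  from arg_cong[OF this, of "word_act u"]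
  show "word_act (u @ [GenY m, GenYs n] @ v) f c S = - word_act (u @ [GenYs (n - 1), GenY (m + 1)] @ v) f c S
      + (if m + n = 0 then word_act (u @ v) f c S else 0)"
    by (simp add: word_act_lin_comb flip: g_def) (simp add: lin_comb_def)
qed

text \<open>States may have infinite support, so the eigenvector of \<open>Y\<^sub>0\<close> can be taken as the sum over all
  charges \<open>c\<close> of \<open>\<mu>\<^bsup>-c\<^esup>\<close> times the vacuum of charge \<open>c\<close>.\<close>

definition vac :: "complex \<Rightarrow> fock"
  where "vac \<mu> c S = (if S = {..<c} then \<mu> powi (- c) else 0)"

lemma admissible_vac: "admissible (vac \<mu>)"
  by (simp add: admissible_def vac_def)

text \<open>\<open>GenY n\<close> would create the level \<open>c - 1 - n\<close>, which the vacuum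
  of charge \<open>c - 1\<close> already occupies; \<open>GenYs n\<close> would remove the level
  \<open>n + c\<close>, which is empty in the vacuum of charge \<open>c + 1\<close>.\<close>

lemma vac_pos:
  assumes "n > 0"
  shows "gen_act (GenY n) (vac \<mu>) = (\<lambda>c S. 0)" "gen_act (GenYs n) (vac \<mu>) = (\<lambda>c S. 0)"
proof -
  have "S - {c - 1 - n} \<noteq> {..<c - 1}" for S c
    using assms by (metis Diff_iff add_diff_cancel_left' diff_add_cancel insertI1 lessThan_iff less_add_same_cancel1)
  then show "gen_act (GenY n) (vac \<mu>) = (\<lambda>c S. 0)"
    by (auto simp: fun_eq_iff create_def vac_def)
  have "insert (n + c) S \<noteq> {..<c + 1}" for S c
    using assms by (metis add_mono1 insertI1 lessThan_iff less_irrefl not_less zless_add1_eq add_strict_right_mono add_0 less_le_not_le)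
  then show "gen_act (GenYs n) (vac \<mu>) = (\<lambda>c S. 0)"
    by (auto simp: fun_eq_iff annih_def vac_def)
qed

lemma csign_vac: "c - 1 \<le> k \<Longrightarrow> csign k {..<c} = 1"
proof -
  assume "c - 1 \<le> k"
  then have "{s\<in>{..<c}. k < s} = {}" by auto
  then show ?thesis unfolding csign_def by (simp only: card.empty finite.emptyI if_True power_0)
qed

text \<open>\<open>Y\<^sub>0\<close> fills the lowest empty level and so maps the vacuum of charge
  \<open>c - 1\<close> to that of charge \<open>c\<close> with sign 1, while
  \<open>Y\<^sup>*\<^sub>0\<close> goes back. The exponent \<open>- c\<close> in \<open>vac\<close>
  is what makes the eigenvalue \<mu> rather than its inverse.\<close>

lemma vac_zero:
  assumes "\<mu> \<noteq> 0"
  shows "gen_act (GenY 0) (vac \<mu>) = (\<lambda>c S. \<mu> * vac \<mu> c S)"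
    and "gen_act (GenYs 0) (vac \<mu>) = (\<lambda>c S. inverse \<mu> * vac \<mu> c S)"
proof -
  have "c - 1 \<in> S \<and> S - {c - 1} = {..<c - 1} \<longleftrightarrow> S = {..<c}" for c :: int and S
  proof
    assume *: "c - 1 \<in> S \<and> S - {c - 1} = {..<c - 1}"
    then have "S = insert (c - 1) {..<c - 1}" by blast
    then show "S = {..<c}" by auto
  qed auto
  moreover have "\<mu> powi (- (c - 1)) = \<mu> * \<mu> powi (- c)" for c
    using assms power_int_add[of \<mu> 1 "- c"] by (simp add: algebra_simps)
  ultimately show "gen_act (GenY 0) (vac \<mu>) = (\<lambda>c S. \<mu> * vac \<mu> c S)"
    by (auto simp: fun_eq_iff create_def vac_def csign_vac)
  have "c \<notin> S \<and> insert c S = {..<c + 1} \<longleftrightarrow> S = {..<c}" for c :: int and S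
  proof
    assume *: "c \<notin> S \<and> insert c S = {..<c + 1}"
    then have "S = {..<c + 1} - {c}" by blast
    then show "S = {..<c}" by auto
  qed auto
  moreover have "\<mu> powi (- (c + 1)) = inverse \<mu> * \<mu> powi (- c)" for c
    using assms power_int_add[of \<mu> "-1" "- c"] by (simp add: algebra_simps power_int_minus)
  ultimately show "gen_act (GenYs 0) (vac \<mu>) = (\<lambda>c S. inverse \<mu> * vac \<mu> c S)"
    by (auto simp: fun_eq_iff annih_def vac_def csign_vac)
qed

text \<open>The scalar can stay unnamed: it is read off later as the expectation value of the
  word.\<close>

lemma word_act_vac_nonpositive:
  assumes "\<mu> \<noteq> 0" "deg w \<le> 0"
  shows "\<exists>k. word_act w (vac \<mu>) = (\<lambda>c S. k * vac \<mu> c S)"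
proof -
  note rel = word_act_relations[OF admissible_vac]
  interpret straightening "\<lambda>w. \<exists>k. word_act w (vac \<mu>) = (\<lambda>c S. k * vac \<mu> c S)"
  proof
    fix u v m
    show "\<exists>k. word_act (u @ [GenY m, GenY (m - 1)] @ v) (vac \<mu>) = (\<lambda>c S. k * vac \<mu> c S)"
      using rel(1)[of u m "m - 1" v \<mu>] by (intro exI[of _ 0]) (simp add: fun_eq_iff)
    show "\<exists>k. word_act (u @ [GenYs m, GenYs (m - 1)] @ v) (vac \<mu>) = (\<lambda>c S. k * vac \<mu> c S)"
      using rel(2)[of u m "m - 1" v \<mu>] by (intro exI[of _ 0]) (simp add: fun_eq_iff)
  next
    fix u v m n
    assume "\<exists>k. word_act (u @ [GenY (n + 1), GenY (m - 1)] @ v) (vac \<mu>) = (\<lambda>c S. k * vac \<mu> c S)"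
    then obtain k where "word_act (u @ [GenY (n + 1), GenY (m - 1)] @ v) (vac \<mu>) = (\<lambda>c S. k * vac \<mu> c S)" ..
    then show "\<exists>k. word_act (u @ [GenY m, GenY n] @ v) (vac \<mu>) = (\<lambda>c S. k * vac \<mu> c S)"
      using rel(1)[of u m n v \<mu>] by (intro exI[of _ "- k"]) (simp add: fun_eq_iff)
  next
    fix u v m n
    assume "\<exists>k. word_act (u @ [GenYs (n + 1), GenYs (m - 1)] @ v) (vac \<mu>) = (\<lambda>c S. k * vac \<mu> c S)"
    then obtain k where "word_act (u @ [GenYs (n + 1), GenYs (m - 1)] @ v) (vac \<mu>) = (\<lambda>c S. k * vac \<mu> c S)" ..
    then show "\<exists>k. word_act (u @ [GenYs m, GenYs n] @ v) (vac \<mu>) = (\<lambda>c S. k * vac \<mu> c S)"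
      using rel(2)[of u m n v \<mu>] by (intro exI[of _ "- k"]) (simp add: fun_eq_iff)
  next
    fix u v m n
    assume "\<exists>k. word_act (u @ [GenYs (n - 1), GenY (m + 1)] @ v) (vac \<mu>) = (\<lambda>c S. k * vac \<mu> c S)"
      "m + n = 0 \<Longrightarrow> \<exists>k. word_act (u @ v) (vac \<mu>) = (\<lambda>c S. k * vac \<mu> c S)"
    then obtain k l where "word_act (u @ [GenYs (n - 1), GenY (m + 1)] @ v) (vac \<mu>) = (\<lambda>c S. k * vac \<mu> c S)"
      "m + n = 0 \<longrightarrow> word_act (u @ v) (vac \<mu>) = (\<lambda>c S. l * vac \<mu> c S)" by blast
    then show "\<exists>k. word_act (u @ [GenY m, GenYs n] @ v) (vac \<mu>) = (\<lambda>c S. k * vac \<mu> c S)"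
      using rel(3)[of u m n v \<mu>]
      by (intro exI[of _ "- k + (if m + n = 0 then l else 0)"]) (simp add: fun_eq_iff algebra_simps)
  next
    fix u v m n
    assume "\<exists>k. word_act (u @ [GenY m, GenYs n] @ v) (vac \<mu>) = (\<lambda>c S. k * vac \<mu> c S)"
      "m + n = 0 \<Longrightarrow> \<exists>k. word_act (u @ v) (vac \<mu>) = (\<lambda>c S. k * vac \<mu> c S)"
    then obtain k l where "word_act (u @ [GenY m, GenYs n] @ v) (vac \<mu>) = (\<lambda>c S. k * vac \<mu> c S)"
      "m + n = 0 \<longrightarrow> word_act (u @ v) (vac \<mu>) = (\<lambda>c S. l * vac \<mu> c S)" by blast
    then show "\<exists>k. word_act (u @ [GenYs (n - 1), GenY (m + 1)] @ v) (vac \<mu>) = (\<lambda>c S. k * vac \<mu> c S)"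
      using rel(3)[of u m n v \<mu>]
      by (intro exI[of _ "- k + (if m + n = 0 then l else 0)"]) (simp add: fun_eq_iff algebra_simps)
  next
    fix u :: "gen list" and m :: int
    assume "m > 0"
    then show "\<exists>k. word_act (u @ [GenY m]) (vac \<mu>) = (\<lambda>c S. k * vac \<mu> c S)"
      "\<exists>k. word_act (u @ [GenYs m]) (vac \<mu>) = (\<lambda>c S. k * vac \<mu> c S)"
      using vac_pos[of m \<mu>] by (auto simp: word_act_zero intro!: exI[of _ 0])
  qed
  show ?thesis
  proof (rule nonpositive_degree[OF _ assms(2)])
    fix w assume "set w \<subseteq> {GenY 0, GenYs 0}"
    then show "\<exists>k. word_act w (vac \<mu>) = (\<lambda>c S. k * vac \<mu> c S)"
    proof (induction w)
      case Nil
      show ?case by (rule exI[of _ 1]) simp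
    next
      case (Cons x w)
      then obtain k where "word_act w (vac \<mu>) = (\<lambda>c S. k * vac \<mu> c S)" by auto
      then show ?case
        using Cons.prems vac_zero[OF assms(1)] word_act_scale[of "[x]" k "vac \<mu>"]
        by (auto simp del: gen_act.simps simp flip: mult.assoc)
    qed
  qed
qed

lemma word_act_vac_negative:
  assumes "deg w < 0"
  shows "word_act w (vac \<mu>) = (\<lambda>c S. 0)"
proof -
  note rel = word_act_relations[OF admissible_vac, of _ _ _ _ \<mu>]
  interpret straightening "\<lambda>w. word_act w (vac \<mu>) = (\<lambda>c S. 0)"
  proof
    show "word_act (u @ [GenY m, GenY (m - 1)] @ v) (vac \<mu>) = (\<lambda>c S. 0)"
      "word_act (u @ [GenYs m, GenYs (m - 1)] @ v) (vac \<mu>) = (\<lambda>c S. 0)" for u m v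
      using rel(1)[of u m "m - 1" v] rel(2)[of u m "m - 1" v] by (simp_all add: fun_eq_iff)
  next
    show "word_act (u @ [GenY m, GenY n] @ v) (vac \<mu>) = (\<lambda>c S. 0)"
      if "word_act (u @ [GenY (n + 1), GenY (m - 1)] @ v) (vac \<mu>) = (\<lambda>c S. 0)" for u m n v
      using rel(1)[of u m n v] that by (simp add: fun_eq_iff)
    show "word_act (u @ [GenYs m, GenYs n] @ v) (vac \<mu>) = (\<lambda>c S. 0)"
      if "word_act (u @ [GenYs (n + 1), GenYs (m - 1)] @ v) (vac \<mu>) = (\<lambda>c S. 0)" for u m n v
      using rel(2)[of u m n v] that by (simp add: fun_eq_iff)
    show "word_act (u @ [GenY m, GenYs n] @ v) (vac \<mu>) = (\<lambda>c S. 0)"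
      if "word_act (u @ [GenYs (n - 1), GenY (m + 1)] @ v) (vac \<mu>) = (\<lambda>c S. 0)"
        "m + n = 0 \<Longrightarrow> word_act (u @ v) (vac \<mu>) = (\<lambda>c S. 0)" for u m n v
      using rel(3)[of u m n v] that by (cases "m + n = 0") (simp_all add: fun_eq_iff)
    show "word_act (u @ [GenYs (n - 1), GenY (m + 1)] @ v) (vac \<mu>) = (\<lambda>c S. 0)"
      if "word_act (u @ [GenY m, GenYs n] @ v) (vac \<mu>) = (\<lambda>c S. 0)"
        "m + n = 0 \<Longrightarrow> word_act (u @ v) (vac \<mu>) = (\<lambda>c S. 0)" for u m n v
      using rel(3)[of u m n v] that by (cases "m + n = 0") (simp_all add: fun_eq_iff)
  next
    fix u :: "gen list" and m :: int
    assume "m > 0"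
    then show "word_act (u @ [GenY m]) (vac \<mu>) = (\<lambda>c S. 0)"
      "word_act (u @ [GenYs m]) (vac \<mu>) = (\<lambda>c S. 0)"
      using vac_pos[of m \<mu>] by (auto simp: word_act_zero)
  qed
  show ?thesis using assms by (rule negative_degree)
qed

text \<open>Pairing with the dual vacuum of charge 0, the charge at which \<open>vac\<close> has
  coefficient 1, so that the empty word has expectation 1.\<close>

definition expectation :: "complex \<Rightarrow> gen list \<Rightarrow> complex"
  where "expectation \<mu> w = word_act w (vac \<mu>) 0 {..<0}"

fun dual_gen :: "gen \<Rightarrow> gen" where
  "dual_gen (GenY n) = GenYs (- n)"
| "dual_gen (GenYs n) = GenY (- n)"

text \<open>The anti-involution \<open>Y\<^sub>n \<mapsto> Y\<^sup>*\<^bsub>-n\<^esub>\<close> preserves the relations, which transfers the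
  straightening of negative words at the vacuum to positive words at the dual vacuum.\<close>

definition dual :: "gen list \<Rightarrow> gen list"
  where "dual w = rev (map dual_gen w)"

lemma dual_append [simp]: "dual (u @ v) = dual v @ dual u"
  by (simp add: dual_def)

lemma dual_simps [simp]: "dual [] = []" "dual (x # w) = dual w @ [dual_gen x]"
  by (simp_all add: dual_def)

lemma dual_dual [simp]: "dual (dual w) = w"
proof -
  have "dual_gen (dual_gen x) = x" for x by (cases x) simp_all
  then show ?thesis by (simp add: dual_def rev_map comp_def)
qed

lemma deg_dual [simp]: "deg (dual w) = - deg w"
proof (induction w)
  case (Cons x w)
  then show ?case by (cases x) simp_all
qed simp

lemma expectation_positive:
  assumes "deg w > 0"
  shows "expectation \<mu> w = 0"
proof -
  note rel = word_act_relations[OF admissible_vac, of _ _ _ _ \<mu> 0 "{..<0}", folded expectation_def]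
  interpret straightening "\<lambda>w. expectation \<mu> (dual w) = 0"
  proof
    show "expectation \<mu> (dual (u @ [GenY m, GenY (m - 1)] @ v)) = 0"
      "expectation \<mu> (dual (u @ [GenYs m, GenYs (m - 1)] @ v)) = 0" for u m v
      using rel(2)[of "dual v" "- (m - 1)" "- m" "dual u"] rel(1)[of "dual v" "- (m - 1)" "- m" "dual u"]
      by simp_all
  next
    show "expectation \<mu> (dual (u @ [GenY m, GenY n] @ v)) = 0"
      if "expectation \<mu> (dual (u @ [GenY (n + 1), GenY (m - 1)] @ v)) = 0" for u m n v
      using rel(2)[of "dual v" "- n" "- m" "dual u"] that by simp
    show "expectation \<mu> (dual (u @ [GenYs m, GenYs n] @ v)) = 0"
      if "expectation \<mu> (dual (u @ [GenYs (n + 1), GenYs (m - 1)] @ v)) = 0" for u m n v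
      using rel(1)[of "dual v" "- n" "- m" "dual u"] that by simp
    show "expectation \<mu> (dual (u @ [GenY m, GenYs n] @ v)) = 0"
      if "expectation \<mu> (dual (u @ [GenYs (n - 1), GenY (m + 1)] @ v)) = 0"
        "m + n = 0 \<Longrightarrow> expectation \<mu> (dual (u @ v)) = 0" for u m n v
      using rel(3)[of "dual v" "- n" "- m" "dual u"] that by (cases "m + n = 0") simp_all
    show "expectation \<mu> (dual (u @ [GenYs (n - 1), GenY (m + 1)] @ v)) = 0"
      if "expectation \<mu> (dual (u @ [GenY m, GenYs n] @ v)) = 0"
        "m + n = 0 \<Longrightarrow> expectation \<mu> (dual (u @ v)) = 0" for u m n v
      using rel(3)[of "dual v" "- n" "- m" "dual u"] that by (cases "m + n = 0") simp_all
  next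
    fix u :: "gen list" and m :: int
    assume "m > 0"
    \<comment> \<open>After reversal the word starts with \<open>GenYs (- m)\<close>, which empties
      the level \<open>- m\<close>, or with \<open>GenY (- m)\<close>, which fills the level
      \<open>m - 1\<close>. The set \<open>{..<0}\<close> contains the first level and misses the
      second, so its coefficient is 0 in both cases.\<close>
    then show "expectation \<mu> (dual (u @ [GenY m])) = 0" "expectation \<mu> (dual (u @ [GenYs m])) = 0"
      by (auto simp: expectation_def create_def annih_def)
  qed
  have "expectation \<mu> (dual (dual w)) = 0"
    by (rule negative_degree) (use assms in simp)
  then show ?thesis by simp
qed

section \<open>The functional on the free algebra and its invariance under the relations\<close>

definition Phi :: "complex \<Rightarrow> free_elem \<Rightarrow> complex"
  where "Phi \<mu> p = (\<Sum>w\<in>Poly_Mapping.keys p. Poly_Mapping.lookup p w * expectation \<mu> (letters w))"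

lemma Phi_mon: "Phi \<mu> (mon u c) = c * expectation \<mu> u"
  by (simp add: Phi_def)

lemma Phi_zero [simp]: "Phi \<mu> 0 = 0"
  by (simp add: Phi_def)

lemma Phi_add: "Phi \<mu> (p + q) = Phi \<mu> p + Phi \<mu> q"
  unfolding Phi_def by (rule setsum_keys_plus_distrib) (simp_all add: algebra_simps)

lemma Phi_uminus: "Phi \<mu> (- p) = - Phi \<mu> p"
  using Phi_add[of \<mu> p "- p"] by (simp add: eq_neg_iff_add_eq_0 add.commute)

lemma Phi_diff: "Phi \<mu> (p - q) = Phi \<mu> p - Phi \<mu> q"
  using Phi_add[of \<mu> p "- q"] by (simp add: Phi_uminus)

lemma Phi_sum: "Phi \<mu> (\<Sum>i\<in>I. f i) = (\<Sum>i\<in>I. Phi \<mu> (f i))"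
  by (induction I rule: infinite_finite_induct) (simp_all add: Phi_add)

lemma expectation_Nil: "expectation \<mu> [] = 1"
  by (simp add: expectation_def vac_def)

lemma Phi_const [simp]: "Phi \<mu> (const c) = c"
  by (simp add: const_eq_mon Phi_mon expectation_Nil)

lemma Phi_one [simp]: "Phi \<mu> 1 = 1"
  using Phi_const[of \<mu> 1] by simp

lemma Phi_const_mult: "Phi \<mu> (const c * p) = c * Phi \<mu> p"
  by (induction p rule: free_elem_induct) (simp_all add: const_mult_mon Phi_mon Phi_add algebra_simps)

lemma Phi_relation_ideal:
  assumes "p \<in> relation_ideal"
  shows "Phi \<mu> p = 0"
proof -
  note rel = word_act_relations[OF admissible_vac, of _ _ _ _ \<mu> 0 "{..<0}", folded expectation_def]
  \<comment> \<open>The kernel itself is no ideal, so the argument uses the largest two-sided ideal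
    inside it.\<close>
  define I where "I = {p. \<forall>q r. Phi \<mu> (q * p * r) = 0}"
  have "relation_ideal \<subseteq> I"
  proof (rule relation_ideal_minimal)
    have *: "p \<in> I" if p: "\<And>u v a b. Phi \<mu> (mon u a * p * mon v b) = 0" for p
    proof -
      have "Phi \<mu> (q * p * mon v b) = 0" for q v b
        by (induction q rule: free_elem_induct) (simp_all add: p Phi_add distrib_right)
      then have "Phi \<mu> (q * p * r) = 0" for q r
        by (induction r rule: free_elem_induct) (simp_all add: Phi_add distrib_left)
      then show ?thesis by (simp add: I_def)
    qed
    show "defining_relations \<subseteq> I"
      unfolding defining_relations_def
    proof (intro Un_least subsetI)
      fix p assume "p \<in> {freeY m * freeY n + freeY (n + 1) * freeY (m - 1) |m n. True}"
      then obtain m n where p: "p = freeY m * freeY n + freeY (n + 1) * freeY (m - 1)" by blast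
      show "p \<in> I"
        unfolding p
        using rel(1)[of _ m n] by (intro *) (simp add: freeY_def mon_mult algebra_simps Phi_add Phi_mon)
    next
      fix p assume "p \<in> {freeYs m * freeYs n + freeYs (n + 1) * freeYs (m - 1) |m n. True}"
      then obtain m n where p: "p = freeYs m * freeYs n + freeYs (n + 1) * freeYs (m - 1)" by blast
      show "p \<in> I"
        unfolding p
        using rel(2)[of _ m n] by (intro *) (simp add: freeYs_def mon_mult algebra_simps Phi_add Phi_mon)
    next
      fix p assume "p \<in> {freeY m * freeYs n + freeYs (n - 1) * freeY (m + 1) - (if m + n = 0 then 1 else 0) |m n. True}"
      then obtain m n where p: "p = freeY m * freeYs n + freeYs (n - 1) * freeY (m + 1) - (if m + n = 0 then 1 else 0)" by blast
      show "p \<in> I"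
        unfolding p
      proof (rule *)
        fix u v a b
        have "a * b * (expectation \<mu> (u @ [GenY m, GenYs n] @ v) +
          expectation \<mu> (u @ [GenYs (n - 1), GenY (m + 1)] @ v) -
          (if m + n = 0 then expectation \<mu> (u @ v) else 0)) = 0"
          using rel(3)[of u m n v] by simp
        then show "Phi \<mu> (mon u a * (freeY m * freeYs n + freeYs (n - 1) * freeY (m + 1) -
            (if m + n = 0 then 1 else 0)) * mon v b) = 0"
          by (auto simp: freeYs_def freeY_def mon_mult algebra_simps Phi_add Phi_diff Phi_mon split: if_splits)
      qed
    qed
    show "0 \<in> I" by (simp add: I_def)
    show "p + q \<in> I" if "p \<in> I" "q \<in> I" for p q
      using that by (simp add: I_def algebra_simps Phi_add)
    show "r * p \<in> I" "p * r \<in> I" if "p \<in> I" for p r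
      using that by (auto simp: I_def) (metis mult.assoc)+
  qed
  then have "Phi \<mu> (1 * p * 1) = 0" using assms unfolding I_def by blast
  then show ?thesis by simp
qed

lemma Phi_alg_class: "alg_class p = alg_class q \<Longrightarrow> Phi \<mu> p = Phi \<mu> q"
  using Phi_relation_ideal[of "p - q" \<mu>] by (simp add: alg_class_eq_iff Phi_diff)

text \<open>The right factor meets the vacuum first and acts on it by a scalar; this is why only
  \<open>p\<close> is restricted to degree zero while \<open>q\<close> is arbitrary.\<close>

lemma Phi_mult_zero_degree:
  assumes "\<mu> \<noteq> 0" "p \<in> homog 0"
  shows "Phi \<mu> (q * p) = Phi \<mu> q * Phi \<mu> p"
proof -
  have "Phi \<mu> (mon u a * mon v b) = Phi \<mu> (mon u a) * Phi \<mu> (mon v b)" if v: "deg v = 0" for u v a b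
  proof -
    obtain k where k: "word_act v (vac \<mu>) = (\<lambda>c S. k * vac \<mu> c S)"
      using word_act_vac_nonpositive[OF assms(1)] v by fastforce
    then have "expectation \<mu> v = k" by (simp add: expectation_def vac_def)
    moreover have "expectation \<mu> (u @ v) = k * expectation \<mu> u"
      by (simp add: expectation_def k word_act_scale)
    ultimately show ?thesis by (simp add: mon_mult Phi_mon)
  qed
  then have "Phi \<mu> (q * mon v b) = Phi \<mu> q * Phi \<mu> (mon v b)" if v: "deg v = 0" for v b
    by (induction q rule: free_elem_induct) (simp_all add: v Phi_add algebra_simps)
  note * = this
  show ?thesis
    using assms(2) by (induction p rule: homog_induct) (simp_all add: * Phi_add algebra_simps)
qed

lemma Phi_mult_negative:
  assumes "p \<in> homog n" "n < 0"
  shows "Phi \<mu> (q * p) = 0"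
proof -
  have *: "Phi \<mu> (q * mon v b) = 0" if "deg v = n" for v b
    using assms(2) that
    by (induction q rule: free_elem_induct)
       (simp_all add: Phi_mon mon_mult Phi_add algebra_simps expectation_def word_act_vac_negative word_act_zero)
  show ?thesis
    using assms(1) by (induction p rule: homog_induct) (simp_all add: * Phi_add algebra_simps)
qed

lemma Phi_homog:
  assumes "p \<in> homog n" "n \<noteq> 0"
  shows "Phi \<mu> p = 0"
proof (cases "n < 0")
  case True
  then show ?thesis using Phi_mult_negative[OF assms(1), of \<mu> 1] by simp
next
  case False
  with assms(2) have "n > 0" by simp
  show ?thesis
    using assms(1) by (induction p rule: homog_induct)
      (use \<open>n > 0\<close> in \<open>simp_all add: Phi_add Phi_mon expectation_positive\<close>)
qed

lemma Phi_hpart: "Phi \<mu> (hpart 0 p) = Phi \<mu> p"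
proof -
  obtain N where N: "finite N" "p = (\<Sum>n\<in>N. hpart n p)" "\<forall>n. n \<notin> N \<longrightarrow> hpart n p = 0"
    using homog_decomposition[of p] by blast
  have "Phi \<mu> p = (\<Sum>n\<in>N. Phi \<mu> (hpart n p))"
    by (subst N(2)) (simp add: Phi_sum)
  also have "\<dots> = (\<Sum>n\<in>N. if n = 0 then Phi \<mu> (hpart 0 p) else 0)"
    by (intro sum.cong) (auto intro: Phi_homog[OF hpart_homog])
  also have "\<dots> = Phi \<mu> (hpart 0 p)"
    using N(1,3) by (auto simp: sum.delta)
  finally show ?thesis ..
qed

lemma expectation_zero:
  assumes "\<mu> \<noteq> 0"
  shows "expectation \<mu> [GenY 0] = \<mu>" "expectation \<mu> [GenYs 0] = inverse \<mu>"
  using vac_zero[OF assms] by (simp_all add: expectation_def vac_def del: gen_act.simps)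

section \<open>The radical of the vacuum functional\<close>

lemma hpart_mon: "hpart n (mon u c) = (if deg u = n then mon u c else 0)"
  by (rule poly_mapping_eqI) (auto simp: lookup_hpart lookup_single when_def word_degree_def)

lemma hpart_homog_eq: "p \<in> homog m \<Longrightarrow> hpart n p = (if n = m then p else 0)"
  by (rule poly_mapping_eqI) (auto simp: lookup_hpart homog_def in_keys_iff)

lemma hpart_zero [simp]: "hpart n 0 = 0"
  by (rule poly_mapping_eqI) (simp add: lookup_hpart)

lemma hpart_diff: "hpart n (p - q) = hpart n p - hpart n q"
  by (rule poly_mapping_eqI) (simp add: lookup_hpart lookup_minus)

lemma hpart_sum: "hpart n (\<Sum>i\<in>I. f i) = (\<Sum>i\<in>I. hpart n (f i))"
  by (induction I rule: infinite_finite_induct) (simp_all add: hpart_add)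

text \<open>Only opposite degrees pair nontrivially under \<open>Phi\<close>, so projecting one
  factor amounts to projecting the other. This makes the radical a graded left ideal.\<close>

lemma Phi_mult_hpart: "Phi \<mu> (q * hpart n p) = Phi \<mu> (hpart (- n) q * p)"
proof -
  have "Phi \<mu> (mon u a * hpart n (mon v b)) = Phi \<mu> (hpart (- n) (mon u a) * mon v b)" for u v a b
  proof (cases "deg u + deg v = 0")
    case True
    then show ?thesis by (auto simp: hpart_mon)
  next
    case False
    then have "Phi \<mu> (mon u a * mon v b) = 0"
      by (intro Phi_homog[of _ "deg u + deg v"]) (simp_all add: mon_mult)
    then show ?thesis by (simp add: hpart_mon)
  qed
  then have "Phi \<mu> (mon u a * hpart n p) = Phi \<mu> (hpart (- n) (mon u a) * p)" for u a
    by (induction p rule: free_elem_induct) (simp_all add: hpart_add Phi_add algebra_simps)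
  then show ?thesis
    by (induction q rule: free_elem_induct) (simp_all add: hpart_add Phi_add algebra_simps)
qed

definition rad :: "complex \<Rightarrow> free_elem set"
  where "rad \<mu> = {p. \<forall>q. Phi \<mu> (q * p) = 0}"

lemma rad_zero: "0 \<in> rad \<mu>"
  by (simp add: rad_def)

lemma rad_add: "p \<in> rad \<mu> \<Longrightarrow> q \<in> rad \<mu> \<Longrightarrow> p + q \<in> rad \<mu>"
  by (simp add: rad_def distrib_left Phi_add)

lemma rad_diff: "p \<in> rad \<mu> \<Longrightarrow> q \<in> rad \<mu> \<Longrightarrow> p - q \<in> rad \<mu>"
  by (simp add: rad_def right_diff_distrib Phi_diff)

lemma rad_mult: "p \<in> rad \<mu> \<Longrightarrow> q * p \<in> rad \<mu>"
  by (simp add: rad_def flip: mult.assoc)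

lemma rad_Phi: "p \<in> rad \<mu> \<Longrightarrow> Phi \<mu> p = 0"
  unfolding rad_def by (metis (mono_tags, lifting) mem_Collect_eq mult_1)

lemma rad_hpart: "p \<in> rad \<mu> \<Longrightarrow> hpart n p \<in> rad \<mu>"
  by (simp add: rad_def Phi_mult_hpart)

lemma rad_negative: "p \<in> homog n \<Longrightarrow> n < 0 \<Longrightarrow> p \<in> rad \<mu>"
  by (simp add: rad_def Phi_mult_negative)

lemma rad_degree_zero:
  assumes "\<mu> \<noteq> 0" "p \<in> homog 0"
  shows "p - const (Phi \<mu> p) \<in> rad \<mu>"
  using Phi_mult_zero_degree[OF assms]
  by (simp add: rad_def right_diff_distrib Phi_diff Phi_const_mult flip: const_mult_commute)

lemma one_notin_rad: "1 \<notin> rad \<mu>"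
  using rad_Phi[of 1 \<mu>] by auto

section \<open>Modules generated by a vacuum vector\<close>

text \<open>Kept apart from \<open>vacuum_module\<close> because it applies to the orbit map of any
  vector of degree 0 in a graded module, before the vector is known to generate the module or to be
  an eigenvector.\<close>

locale cyclic_map = left_module Alg W for W :: "(alg_elem, 'w, 'm) module_scheme" (structure) +
  fixes h :: "free_elem \<Rightarrow> 'w"
  assumes h_carrier [simp]: "h p \<in> carrier W"
    and h_add: "h (p + q) = h p \<oplus> h q"
    and h_mult: "h (p * q) = alg_class p \<odot>\<^bsub>W\<^esub> h q"
    and h_zero: "h 0 = \<zero>"
    and h_negative: "p \<in> homog k \<Longrightarrow> k < 0 \<Longrightarrow> h p = \<zero>"
begin

lemma h_uminus: "\<ominus> h p = h (- p)"
  by (rule M.minus_equality) (simp_all flip: h_add h_zero)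

lemma h_diff_eq_zero: "h p = h q \<longleftrightarrow> h (p - q) = \<zero>"
proof
  assume "h p = h q"
  then have "h (p - q) = h q \<oplus> h (- q)" using h_add[of p "- q"] by simp
  then show "h (p - q) = \<zero>" by (simp flip: h_add h_zero)
next
  assume "h (p - q) = \<zero>"
  then show "h p = h q" using h_add[of "p - q" q] by simp
qed

lemma h_sum: "finite I \<Longrightarrow> h (\<Sum>i\<in>I. f i) = (\<Oplus>i\<in>I. h (f i))"
  by (induction I rule: finite_induct) (simp_all add: h_zero h_add)

lemma h_sum_zero: "(\<And>i. i \<in> I \<Longrightarrow> h (f i) = \<zero>) \<Longrightarrow> h (\<Sum>i\<in>I. f i) = \<zero>"
  by (induction I rule: infinite_finite_induct) (simp_all add: h_zero h_add)

lemma decomposition: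
  assumes "\<And>n. h (hpart (int n) p) \<in> H n"
  shows "grade_decomposition W H (h p) (\<lambda>n. h (hpart (int n) p))"
proof -
  obtain N where N: "finite N" "p = (\<Sum>n\<in>N. hpart n p)" "\<forall>n. n \<notin> N \<longrightarrow> hpart n p = 0"
    using homog_decomposition[of p] by blast
  let ?S = "{n. h (hpart (int n) p) \<noteq> \<zero>}"
  have sub: "int ` ?S \<subseteq> N" using N(3) h_zero by force
  then have fin: "finite ?S" using N(1) by (meson finite_imageD finite_subset inj_on_of_nat)
  \<comment> \<open>Parts outside \<open>?S\<close> have negative degree or vanishing image, so the
    sum over \<open>N\<close> reduces to the surviving grades.\<close>
  have "h (hpart n p) = \<zero>" if "n \<notin> int ` ?S" for n
  proof (cases "n < 0")
    case True
    then show ?thesis by (intro h_negative[of _ n]) simp_all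
  next
    case False
    then have "n = int (nat n)" by simp
    then show ?thesis using that by (metis (mono_tags, lifting) image_eqI mem_Collect_eq)
  qed
  then have zero: "h (\<Sum>n\<in>N - int ` ?S. hpart n p) = \<zero>"
    by (intro h_sum_zero) blast
  have "h p = h ((\<Sum>n\<in>N - int ` ?S. hpart n p) + (\<Sum>n\<in>int ` ?S. hpart n p))"
    using N(2) sum.subset_diff[OF sub N(1), of "\<lambda>n. hpart n p"] by (rule arg_cong[OF trans])
  also have "\<dots> = h (\<Sum>n\<in>int ` ?S. hpart n p)"
    by (simp add: h_add zero)
  also have "\<dots> = (\<Oplus>n\<in>?S. h (hpart (int n) p))"
    using fin by (simp add: sum.reindex h_sum)
  finally show ?thesis
    using fin assms by (simp add: grade_decomposition_def)
qed

lemma subgroup_image: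
  assumes "0 \<in> S" "\<And>p q. p \<in> S \<Longrightarrow> q \<in> S \<Longrightarrow> p - q \<in> S"
  shows "subgroup (h ` S) (add_monoid W)"
proof (rule M.add.subgroupI)
  have neg: "- p \<in> S" if "p \<in> S" for p using assms(2)[OF assms(1) that] by simp
  show "h ` S \<noteq> {}" using assms(1) by blast
  show "\<ominus> a \<in> h ` S" if "a \<in> h ` S" for a
    using that neg h_uminus by auto
  have "p + q \<in> S" if "p \<in> S" "q \<in> S" for p q
    using assms(2)[OF that(1) neg[OF that(2)]] by simp
  then show "a \<oplus> b \<in> h ` S" if "a \<in> h ` S" "b \<in> h ` S" for a b
    using that by (auto simp flip: h_add)
qed auto

end

text \<open>Here \<open>h p\<close> stands for \<open>p\<close> applied to the vacuum vector \<open>h 1\<close>.\<close>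

locale vacuum_module =
  fixes \<mu> :: complex and W :: "(alg_elem, 'w, 'm) module_scheme" (structure)
    and G :: "nat \<Rightarrow> 'w set" and h :: "free_elem \<Rightarrow> 'w"
  assumes mu_nonzero: "\<mu> \<noteq> 0"
    and h_add: "h (p + q) = h p \<oplus> h q"
    and h_mult: "h (p * q) = alg_class p \<odot>\<^bsub>W\<^esub> h q"
    and h_zero: "h 0 = \<zero>"
    and range_h: "range h = carrier W"
    and kernel_h: "h p = \<zero> \<Longrightarrow> p \<in> rad \<mu>"
    and h_negative: "p \<in> homog k \<Longrightarrow> k < 0 \<Longrightarrow> h p = \<zero>"
    and h_degree_zero: "p \<in> homog 0 \<Longrightarrow> h p = h (const (Phi \<mu> p))"
    and grade: "G n = h ` homog (int n)"
begin

lemma h_carrier [simp]: "h p \<in> carrier W"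
  using range_h by blast

lemma carrierE: assumes "x \<in> carrier W" obtains p where "x = h p"
  using assms range_h by blast

text \<open>The carrier is the image of \<open>h\<close>, so the group and module laws are
  transported from the free algebra; an instance of the locale need not establish them
  separately.\<close>

lemma abelian_group: "abelian_group W"
proof (rule abelian_groupI)
  show "\<zero> \<oplus> x = x" if x: "x \<in> carrier W" for x
    using x by (rule carrierE) (simp flip: h_zero h_add)
  show "\<exists>y\<in>carrier W. y \<oplus> x = \<zero>" if x: "x \<in> carrier W" for x
  proof -
    from x obtain p where "x = h p" by (rule carrierE)
    then show ?thesis by (intro bexI[of _ "h (- p)"]) (simp_all flip: h_add h_zero)
  qed
  fix x y assume "x \<in> carrier W" "y \<in> carrier W"
  then obtain p q where xy: "x = h p" "y = h q" by (metis carrierE)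
  then show "x \<oplus> y \<in> carrier W" "x \<oplus> y = y \<oplus> x"
    by (simp_all add: add.commute flip: h_add)
  fix z assume "z \<in> carrier W"
  then obtain r where "z = h r" by (rule carrierE)
  with xy show "x \<oplus> y \<oplus> z = x \<oplus> (y \<oplus> z)"
    by (simp add: add.assoc flip: h_add)
qed (simp flip: h_zero)

lemma left_module: "left_module Alg W"
proof (intro left_module.intro ring_Alg abelian_group left_module_axioms.intro)
  note elims = carrier_Alg image_iff h_mult[symmetric] h_add[symmetric] distrib_left distrib_right mult.assoc
  show "a \<odot>\<^bsub>W\<^esub> x \<in> carrier W" if "a \<in> carrier Alg" "x \<in> carrier W" for a x
    using that by (auto simp: elims elim!: carrierE)
  show "(a \<oplus>\<^bsub>Alg\<^esub> b) \<odot>\<^bsub>W\<^esub> x = a \<odot>\<^bsub>W\<^esub> x \<oplus> b \<odot>\<^bsub>W\<^esub> x"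
    "(a \<otimes>\<^bsub>Alg\<^esub> b) \<odot>\<^bsub>W\<^esub> x = a \<odot>\<^bsub>W\<^esub> (b \<odot>\<^bsub>W\<^esub> x)"
    if "a \<in> carrier Alg" "b \<in> carrier Alg" "x \<in> carrier W" for a b x
    using that by (auto simp: elims elim!: carrierE)
  show "a \<odot>\<^bsub>W\<^esub> (x \<oplus> y) = a \<odot>\<^bsub>W\<^esub> x \<oplus> a \<odot>\<^bsub>W\<^esub> y"
    if "a \<in> carrier Alg" "x \<in> carrier W" "y \<in> carrier W" for a x y
    using that by (auto simp: elims elim!: carrierE)
  show "\<one>\<^bsub>Alg\<^esub> \<odot>\<^bsub>W\<^esub> x = x" if "x \<in> carrier W" for x
    using that by (auto simp: elims elim!: carrierE)
qed

sublocale cyclic?: cyclic_map W h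
  using h_add h_mult h_zero h_negative
  by (intro cyclic_map.intro cyclic_map_axioms.intro left_module) simp_all

end

context vacuum_module
begin

lemma h_eqD: "h p = h q \<Longrightarrow> p - q \<in> rad \<mu>"
  using kernel_h h_diff_eq_zero by blast

text \<open>Add up homogeneous preimages of the components; projecting the sum returns each of them.
  Statements about decompositions in \<open>W\<close> thereby become statements about parts of a
  single free element.\<close>

lemma decomposition_lift:
  assumes "grade_decomposition W H w f" "\<And>n. H n \<subseteq> G n"
  obtains r where "w = h r" "\<And>n. f n = h (hpart (int n) r)"
proof -
  let ?S = "{n. f n \<noteq> \<zero>}"
  have fin: "finite ?S" and w: "w = (\<Oplus>n\<in>?S. f n)"
    using assms(1) by (auto simp: grade_decomposition_def)
  have "\<exists>s. s \<in> homog (int n) \<and> f n = h s" for n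
    using assms grade[of n] by (auto simp: grade_decomposition_def image_iff subset_iff) 
  then obtain s where s: "\<And>n. s n \<in> homog (int n)" "\<And>n. f n = h (s n)"
    by metis
  let ?r = "\<Sum>n\<in>?S. s n"
  show thesis
  proof
    show "w = h ?r" using fin by (simp add: w h_sum s(2))
    fix n
    have "hpart (int n) ?r = (\<Sum>i\<in>?S. if n = i then s n else 0)"
      unfolding hpart_sum by (intro sum.cong) (auto simp: hpart_homog_eq[OF s(1)])
    also have "\<dots> = (if n \<in> ?S then s n else 0)" using fin by simp
    finally show "f n = h (hpart (int n) ?r)" using s(2)[of n] h_zero by simp
  qed
qed

text \<open>A graded submodule not contained in the radical contains, up to a scalar, the vacuum vector.\<close>

lemma graded_submodule_full:
  assumes U: "graded_submodule W G U" and p: "h p \<in> U" "p \<notin> rad \<mu>"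
  shows "U = carrier W"
proof -
  from U have sub: "submodule U Alg W" and dec: "\<forall>u\<in>U. \<exists>f. grade_decomposition W (\<lambda>n. U \<inter> G n) u f"
    by (auto simp: graded_submodule_def)
  have smult: "h (q * r) \<in> U" if "h r \<in> U" for q r
    using submodule.smult_closed[OF sub _ that, of "alg_class q"] by (simp add: h_mult)
  from p(2) obtain q where q: "Phi \<mu> (q * p) \<noteq> 0" by (auto simp: rad_def)
  from dec smult[OF p(1), of q] obtain f where f: "grade_decomposition W (\<lambda>n. U \<inter> G n) (h (q * p)) f"
    by blast
  then obtain r where r: "h (q * p) = h r" "\<And>n. f n = h (hpart (int n) r)"
    by (rule decomposition_lift) auto
  \<comment> \<open>\<open>r\<close> and \<open>q * p\<close> may differ, but they have the same
    image, so their difference lies in the radical, where \<open>Phi\<close> vanishes. The component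
    of degree 0 is then a nonzero multiple of \<open>h 1\<close>.\<close>
  have "Phi \<mu> r = Phi \<mu> (q * p)"
    using rad_Phi[OF h_eqD[OF r(1)]] by (simp add: Phi_diff)
  moreover have "f 0 \<in> U"
    using f by (simp add: grade_decomposition_def)
  then have "h (hpart 0 r) \<in> U"
    using r(2)[of 0] by simp
  ultimately have "h (const (Phi \<mu> (q * p))) \<in> U"
    using h_degree_zero[of "hpart 0 r"] by (simp add: Phi_hpart)
  then have "h (const (inverse (Phi \<mu> (q * p))) * const (Phi \<mu> (q * p))) \<in> U"
    by (rule smult)
  then have "h 1 \<in> U" using q by (simp add: mult_single)
  have "h r \<in> U" for r using smult[OF \<open>h 1 \<in> U\<close>, of r] by simp
  then have "carrier W \<subseteq> U" by (auto simp flip: range_h)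
  moreover have "U \<subseteq> carrier W"
    using subgroup.subset[OF submodule.axioms(1)[OF sub]] by simp
  ultimately show ?thesis by blast
qed

text \<open>The kernel of \<open>h\<close> lies inside the radical, so passing to the image loses no
  information about membership.\<close>

lemma image_rad_iff: "h p \<in> h ` rad \<mu> \<longleftrightarrow> p \<in> rad \<mu>"
proof
  assume "h p \<in> h ` rad \<mu>"
  then obtain q where "q \<in> rad \<mu>" "h p = h q" by blast
  then show "p \<in> rad \<mu>" using rad_add[OF h_eqD[of p q]] by fastforce
qed blast

lemma submodule_image_rad: "submodule (h ` rad \<mu>) Alg W"
proof (intro submodule.intro submodule_axioms.intro subgroup_image)
  show "a \<odot>\<^bsub>W\<^esub> x \<in> h ` rad \<mu>" if "a \<in> carrier Alg" "x \<in> h ` rad \<mu>" for a x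
    using that rad_mult by (auto simp: carrier_Alg simp flip: h_mult)
qed (auto intro: rad_zero rad_diff)

lemma graded_submodule_image_rad: "graded_submodule W G (h ` rad \<mu>)"
  unfolding graded_submodule_def
proof (intro conjI ballI)
  show "submodule (h ` rad \<mu>) Alg W" by (rule submodule_image_rad)
  fix u assume "u \<in> h ` rad \<mu>"
  then obtain p where "p \<in> rad \<mu>" "u = h p" by blast
  moreover from this have "h (hpart (int n) p) \<in> h ` rad \<mu> \<inter> G n" for n
    by (simp add: grade rad_hpart)
  ultimately show "\<exists>f. grade_decomposition W (\<lambda>n. h ` rad \<mu> \<inter> G n) u f"
    using decomposition[of p "\<lambda>n. h ` rad \<mu> \<inter> G n"] by (intro exI) simp
qed

lemma image_rad_proper: "h ` rad \<mu> \<noteq> carrier W"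
  using image_rad_iff[of 1] one_notin_rad by auto

text \<open>The image of the radical contains every proper graded submodule; being the largest and
  not merely maximal, it is the only candidate, as the definite description in
  \<open>J_submodule\<close> requires.\<close>

lemma maximal_proper_graded_submodule_iff:
  "maximal_proper_graded_submodule W G J \<longleftrightarrow> J = h ` rad \<mu>"
proof -
  have below: "U \<subseteq> h ` rad \<mu>" if "graded_submodule W G U" "U \<noteq> carrier W" for U
  proof
    fix u assume "u \<in> U"
    moreover have "U \<subseteq> carrier W"
      using that(1) subgroup.subset[of U "add_monoid W"]
      by (simp add: graded_submodule_def submodule_def)
    ultimately obtain p where "u = h p" by (meson carrierE subsetD)
    then show "u \<in> h ` rad \<mu>" using graded_submodule_full[OF that(1)] that(2) \<open>u \<in> U\<close> by blast
  qed
  show ?thesis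
    unfolding maximal_proper_graded_submodule_def
    using below graded_submodule_image_rad image_rad_proper by blast
qed

end

locale irreducible_vacuum_module = vacuum_module +
  assumes h_rad: "p \<in> rad \<mu> \<Longrightarrow> h p = \<zero>"
begin

lemma h_eq_iff: "h p = h q \<longleftrightarrow> p - q \<in> rad \<mu>"
  using h_diff_eq_zero h_rad kernel_h by blast

text \<open>Uniqueness of the decomposition is where the exact kernel enters: two lifts differ by an
  element of the radical, the radical is stable under \<open>hpart\<close>, and all of it is now
  sent to zero.\<close>

lemma N_graded: "N_graded_module W G"
  unfolding N_graded_module_def
proof (intro conjI allI ballI)
  show "left_module Alg W" by (rule left_module_axioms)
  show "subgroup (G n) (add_monoid W)" for n
    unfolding grade by (rule subgroup_image) (auto intro: homog_diff)
  show "G 0 \<noteq> {\<zero>}"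
  proof
    assume "G 0 = {\<zero>}"
    then have "h 1 = \<zero>" using grade[of 0] by auto
    then show False using kernel_h one_notin_rad by blast
  qed
  show "\<exists>!f. grade_decomposition W G w f" if "w \<in> carrier W" for w
  proof (rule ex_ex1I)
    from that obtain p where "w = h p" by (rule carrierE)
    then show "\<exists>f. grade_decomposition W G w f"
      using decomposition[of p G] grade by auto
    fix f g assume "grade_decomposition W G w f" "grade_decomposition W G w g"
    then obtain r s where r: "w = h r" "\<And>n. f n = h (hpart (int n) r)"
      and s: "w = h s" "\<And>n. g n = h (hpart (int n) s)"
      by (metis decomposition_lift order_refl)
    then have "r - s \<in> rad \<mu>" using h_eqD by simp
    then have "hpart (int n) r - hpart (int n) s \<in> rad \<mu>" for n
      using rad_hpart[of "r - s"] by (simp add: hpart_diff)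
    then show "f = g" using r(2) s(2) by (simp add: fun_eq_iff h_eq_iff)
  qed
  show "a \<odot>\<^bsub>W\<^esub> w \<in> grade_int W G (m + int n)" if "a \<in> Alg_deg m" "w \<in> G n" for m n a w
  proof -
    from that obtain p q where "a = alg_class p" "p \<in> homog m" "w = h q" "q \<in> homog (int n)"
      by (auto simp: Alg_deg_eq grade)
    then have "a \<odot>\<^bsub>W\<^esub> w = h (p * q)" "p * q \<in> homog (m + int n)"
      by (simp_all add: h_mult homog_mult)
    then show ?thesis
      using h_negative[of "p * q" "m + int n"] grade by (auto simp: grade_int_def)
  qed
qed

lemma irreducible: "irreducible_N_graded_module W G"
  unfolding irreducible_N_graded_module_def
proof (intro conjI allI impI)
  fix U assume U: "graded_submodule W G U"
  show "U = {\<zero>} \<or> U = carrier W"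
  proof (rule disjCI)
    assume proper: "U \<noteq> carrier W"
    have sub: "subgroup U (add_monoid W)"
      using U by (simp add: graded_submodule_def submodule_def)
    have "U \<subseteq> carrier W" using subgroup.subset[OF sub] by simp
    then have "u = \<zero>" if "u \<in> U" for u
    proof -
      from that \<open>U \<subseteq> carrier W\<close> obtain p where p: "u = h p" by (meson carrierE subsetD)
      then have "p \<in> rad \<mu>" using graded_submodule_full[OF U] proper that by blast
      then show ?thesis unfolding p by (rule h_rad)
    qed
    moreover have "\<zero> \<in> U" using subgroup.one_closed[OF sub] by simp
    ultimately show "U = {\<zero>}" by blast
  qed
qed (rule N_graded)

end

section \<open>Classification of irreducible vacuum modules by the eigenvalue\<close>

lemma vacuum_module_isomorphic:
  fixes V :: "(alg_elem, 'v, 'm) module_scheme" and W :: "(alg_elem, 'w, 'n) module_scheme"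
  assumes "irreducible_vacuum_module \<mu> V G h" "irreducible_vacuum_module \<mu> W H k"
  shows "isomorphic_graded_modules V G W H"
proof -
  interpret V: irreducible_vacuum_module \<mu> V G h by fact
  interpret W: irreducible_vacuum_module \<mu> W H k by fact
  define g where "g x = k (SOME p. x = h p)" for x
  have g: "g (h p) = k p" for p
  proof -
    define q where "q = (SOME q. h p = h q)"
    have "h p = h q" unfolding q_def by (rule someI) (rule refl)
    then have "k p = k q" by (simp only: V.h_eq_iff W.h_eq_iff)
    then show ?thesis by (simp only: g_def q_def)
  qed
  have "bij_betw g (carrier V) (carrier W)"
    unfolding bij_betw_def V.range_h[symmetric] W.range_h[symmetric]
    by (auto simp: inj_on_def g V.h_eq_iff W.h_eq_iff image_image)
  then have "g \<in> module_iso Alg V W"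
    by (auto simp: module_iso_def g carrier_Alg simp flip: V.range_h V.h_add W.h_add V.h_mult W.h_mult)
  moreover have "g ` G n = H n" for n
    by (simp add: V.grade W.grade image_image g)
  ultimately show ?thesis unfolding isomorphic_graded_modules_def by blast
qed

text \<open>The isomorphism may mix degrees, so the image \<open>k r\<close> of the vacuum need not
  be homogeneous. Still \<open>Phi \<nu>\<close> is multiplicative against \<open>r\<close>; hence
  \<open>Phi \<nu> r\<close> is nonzero, and evaluating on \<open>Y\<^sub>0 - \<mu>\<close>, which
  kills the source vacuum, compares the parameters.\<close>

lemma vacuum_module_parameter_unique:
  fixes V :: "(alg_elem, 'v, 'm) module_scheme" and W :: "(alg_elem, 'w, 'n) module_scheme"
  assumes "irreducible_vacuum_module \<mu> V G h" "irreducible_vacuum_module \<nu> W H k"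
    and "isomorphic_modules V W"
  shows "\<mu> = \<nu>"
proof -
  interpret V: irreducible_vacuum_module \<mu> V G h by fact
  interpret W: irreducible_vacuum_module \<nu> W H k by fact
  from assms(3) obtain g where g: "g \<in> module_iso Alg V W"
    by (auto simp: isomorphic_modules_def)
  then have lin: "g (h (p * q)) = alg_class p \<odot>\<^bsub>W\<^esub> g (h q)" for p q
    by (simp add: module_iso_def V.h_mult)
  have inj: "inj_on g (carrier V)" and car: "g (h p) \<in> carrier W" for p
    using g by (auto simp: module_iso_def bij_betw_def)
  have g0: "g (h 0) = \<zero>\<^bsub>W\<^esub>"
    using lin[of 0 0] car[of 0] W.h_mult[of 0] W.h_zero by (metis W.carrierE mult_zero_left)
  obtain r where r: "g (h 1) = k r" using car W.carrierE by blast
  have kr: "g (h p) = k (p * r)" for p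
    using lin[of p 1] by (simp add: r W.h_mult)
  have ker: "p \<in> rad \<mu> \<longleftrightarrow> p * r \<in> rad \<nu>" for p
  proof -
    have "p \<in> rad \<mu> \<longleftrightarrow> h p = h 0" by (simp add: V.h_eq_iff)
    also have "\<dots> \<longleftrightarrow> g (h p) = g (h 0)" using inj by (auto dest: inj_onD)
    also have "\<dots> \<longleftrightarrow> p * r \<in> rad \<nu>" by (simp add: kr W.h_eq_iff)
    finally show ?thesis .
  qed
  \<comment> \<open>Negative parts of \<open>q\<close> kill the vacuum of \<open>V\<close>, hence
    also its image. Positive parts pair only with negative parts of \<open>r\<close>, which
    contribute nothing as right factors. In degree 0 only \<open>hpart 0 r\<close> matters, and
    there \<open>Phi\<close> is multiplicative.\<close>
  have Phi_r: "Phi \<nu> (q * r) = Phi \<nu> q * Phi \<nu> r" for q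
  proof -
    have "Phi \<nu> (hpart n q * r) = Phi \<nu> (hpart n q) * Phi \<nu> r" for n
    proof (cases n "0 :: int" rule: linorder_cases)
      case less
      then have "hpart n q * r \<in> rad \<nu>" using ker rad_negative hpart_homog by blast
      then show ?thesis using rad_Phi Phi_homog[OF hpart_homog[of n q], of \<nu>] less by simp
    next
      case equal
      then show ?thesis
        using Phi_mult_hpart[of \<nu> q 0 r] Phi_mult_zero_degree[OF W.mu_nonzero hpart_homog[of 0 r]]
        by (simp add: Phi_hpart)
    next
      case greater
      have "Phi \<nu> (hpart n q * r) = 0"
        using Phi_mult_hpart[of \<nu> q "- n" r] Phi_mult_negative[OF hpart_homog[of "- n" r]] greater by simp
      then show ?thesis using Phi_homog[OF hpart_homog[of n q], of \<nu>] greater by simp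
    qed
    then have "Phi \<nu> ((\<Sum>n\<in>N. hpart n q) * r) = Phi \<nu> (\<Sum>n\<in>N. hpart n q) * Phi \<nu> r" for N
      by (simp add: sum_distrib_right Phi_sum)
    moreover obtain N where "q = (\<Sum>n\<in>N. hpart n q)" using homog_decomposition by blast
    ultimately show ?thesis by metis
  qed
  have "Phi \<nu> r \<noteq> 0"
  proof
    assume "Phi \<nu> r = 0"
    then have "r \<in> rad \<nu>" by (simp add: rad_def Phi_r)
    then show False using ker[of 1] one_notin_rad by simp
  qed
  moreover have "mon [GenY 0] 1 - const \<mu> \<in> rad \<mu>"
    using rad_degree_zero[OF V.mu_nonzero homog_mon[of "[GenY 0]" 0 1]]
    by (simp add: Phi_mon expectation_zero[OF V.mu_nonzero])
  then have "Phi \<nu> ((mon [GenY 0] 1 - const \<mu>) * r) = 0"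
    using ker rad_Phi by blast
  then have "(\<nu> - \<mu>) * Phi \<nu> r = 0"
    by (simp add: Phi_r Phi_diff Phi_mon expectation_zero[OF W.mu_nonzero])
  ultimately show ?thesis by simp
qed

section \<open>The degree-zero subalgebra and its characters\<close>

lemma alg_class_relations:
  "alg_class (mon (u @ [GenY m, GenY n] @ v) c) = alg_class (mon (u @ [GenY (n + 1), GenY (m - 1)] @ v) (- c))"
  "alg_class (mon (u @ [GenYs m, GenYs n] @ v) c) = alg_class (mon (u @ [GenYs (n + 1), GenYs (m - 1)] @ v) (- c))"
  "alg_class (mon (u @ [GenY m, GenYs n] @ v) c) =
     alg_class (mon (u @ [GenYs (n - 1), GenY (m + 1)] @ v) (- c) + mon (u @ v) (if m + n = 0 then c else 0))"
proof -
  show "alg_class (mon (u @ [GenY m, GenYs n] @ v) c) =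
     alg_class (mon (u @ [GenYs (n - 1), GenY (m + 1)] @ v) (- c) + mon (u @ v) (if m + n = 0 then c else 0))"
    using relation_word(3)[of u m n v c]
        by (cases "m + n = 0") (simp_all add: alg_class_eq_iff single_uminus diff_diff_eq2 add.commute)
qed (use relation_word(1,2)[of u m n v c] in \<open>simp_all add: alg_class_eq_iff single_uminus\<close>)

text \<open>The relation doubles the word, so it is used with coefficient
  \<open>c / 2\<close>.\<close>

lemma alg_class_consecutive_zero:
  "alg_class (mon (u @ [GenY m, GenY (m - 1)] @ v) c) = alg_class 0"
  "alg_class (mon (u @ [GenYs m, GenYs (m - 1)] @ v) c) = alg_class 0"
  using relation_word(1)[of u m "m - 1" v "c / 2"] relation_word(2)[of u m "m - 1" v "c / 2"]
  by (simp_all add: alg_class_eq_iff flip: single_add)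

text \<open>Straightening recast as induction: modulo the relations, degree zero is built from
  scalars by left multiplication with \<open>Y\<^sub>0\<close> and \<open>Y\<^sup>*\<^sub>0\<close>,
  up to products with a negative right factor, which vanish in \<open>Alg0bar\<close> and on vacuum
  vectors.\<close>

lemma degree_zero_induct [consumes 1, case_names cong add const Y Ys negative]:
  assumes "p \<in> homog 0"
    and cong: "\<And>p q. p \<in> homog 0 \<Longrightarrow> q \<in> homog 0 \<Longrightarrow> alg_class p = alg_class q \<Longrightarrow> P q \<Longrightarrow> P p"
    and add: "\<And>p q. p \<in> homog 0 \<Longrightarrow> q \<in> homog 0 \<Longrightarrow> P p \<Longrightarrow> P q \<Longrightarrow> P (p + q)"
    and const: "\<And>c. P (const c)"
    and Y: "\<And>p. p \<in> homog 0 \<Longrightarrow> P p \<Longrightarrow> P (freeY 0 * p)"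
    and Ys: "\<And>p. p \<in> homog 0 \<Longrightarrow> P p \<Longrightarrow> P (freeYs 0 * p)"
    and negative: "\<And>p q n. n < 0 \<Longrightarrow> p \<in> homog (- n) \<Longrightarrow> q \<in> homog n \<Longrightarrow> P (p * q)"
  shows "P p"
proof -
  have zero: "P 0" using const[of 0] by simp
  \<comment> \<open>Quantifying over the coefficient absorbs the signs that the relations
    produce.\<close>
  define Q where "Q w \<longleftrightarrow> (deg w = 0 \<longrightarrow> (\<forall>c. P (mon w c)))" for w
  have Pcong: "P (mon w c)" if "alg_class (mon w c) = alg_class q" "deg w = 0" "q \<in> homog 0" "P q" for w c q
    using cong[OF _ that(3,1,4)] that(2) by simp
  interpret straightening Q
  proof
    show "Q (u @ [GenY m, GenY (m - 1)] @ v)" "Q (u @ [GenYs m, GenYs (m - 1)] @ v)" for u v m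
      using Pcong[OF alg_class_consecutive_zero(1) _ homog_zero zero]
        Pcong[OF alg_class_consecutive_zero(2) _ homog_zero zero]
      by (simp_all only: Q_def) blast+
  next
    fix u v m n
    assume *: "Q (u @ [GenY (n + 1), GenY (m - 1)] @ v)"
    show "Q (u @ [GenY m, GenY n] @ v)"
      unfolding Q_def
    proof (intro impI allI)
      fix c assume d: "deg (u @ [GenY m, GenY n] @ v) = 0"
      show "P (mon (u @ [GenY m, GenY n] @ v) c)"
        by (rule Pcong[OF alg_class_relations(1) d]) (use * d in \<open>simp_all add: Q_def\<close>)
    qed
  next
    fix u v m n
    assume *: "Q (u @ [GenYs (n + 1), GenYs (m - 1)] @ v)"
    show "Q (u @ [GenYs m, GenYs n] @ v)"
      unfolding Q_def
    proof (intro impI allI)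
      fix c assume d: "deg (u @ [GenYs m, GenYs n] @ v) = 0"
      show "P (mon (u @ [GenYs m, GenYs n] @ v) c)"
        by (rule Pcong[OF alg_class_relations(2) d]) (use * d in \<open>simp_all add: Q_def\<close>)
    qed
  next
    fix u v m n
    assume *: "Q (u @ [GenYs (n - 1), GenY (m + 1)] @ v)" "m + n = 0 \<Longrightarrow> Q (u @ v)"
    show "Q (u @ [GenY m, GenYs n] @ v)"
      unfolding Q_def
    proof (intro impI allI)
      fix c assume d: "deg (u @ [GenY m, GenYs n] @ v) = 0"
      have h: "mon (u @ [GenYs (n - 1), GenY (m + 1)] @ v) (- c) \<in> homog 0"
        "mon (u @ v) (if m + n = 0 then c else 0) \<in> homog 0"
        using d by auto
      show "P (mon (u @ [GenY m, GenYs n] @ v) c)"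
      proof (rule Pcong[OF alg_class_relations(3) d homog_add[OF h] add[OF h]])
        show "P (mon (u @ [GenYs (n - 1), GenY (m + 1)] @ v) (- c))"
          using *(1) d by (simp add: Q_def)
        show "P (mon (u @ v) (if m + n = 0 then c else 0))"
          using *(2) d zero by (cases "m + n = 0") (simp_all add: Q_def)
      qed
    qed
  next
    fix u v m n
    assume *: "Q (u @ [GenY m, GenYs n] @ v)" "m + n = 0 \<Longrightarrow> Q (u @ v)"
    show "Q (u @ [GenYs (n - 1), GenY (m + 1)] @ v)"
      unfolding Q_def
    proof (intro impI allI)
      fix c assume d: "deg (u @ [GenYs (n - 1), GenY (m + 1)] @ v) = 0"
      have h: "mon (u @ [GenY m, GenYs n] @ v) (- c) \<in> homog 0"
        "mon (u @ v) (if m + n = 0 then c else 0) \<in> homog 0"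
        using d by auto
      have rel: "alg_class (mon (u @ [GenYs (n - 1), GenY (m + 1)] @ v) c) =
        alg_class (mon (u @ [GenY m, GenYs n] @ v) (- c) + mon (u @ v) (if m + n = 0 then c else 0))"
        using relation_word(3)[of u m n v c]
        by (cases "m + n = 0") (simp_all add: alg_class_eq_iff single_uminus diff_diff_eq2 add.commute)
      show "P (mon (u @ [GenYs (n - 1), GenY (m + 1)] @ v) c)"
      proof (rule Pcong[OF rel d homog_add[OF h] add[OF h]])
        show "P (mon (u @ [GenY m, GenYs n] @ v) (- c))"
          using *(1) d by (simp add: Q_def)
        show "P (mon (u @ v) (if m + n = 0 then c else 0))"
          using *(2) d zero by (cases "m + n = 0") (simp_all add: Q_def)
      qed
    qed
  next
    fix u m assume m: "(m :: int) > 0"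
    have "P (mon u c * mon [g] 1)" if "deg u = m" "deg [g] = - m" for g c
      by (rule negative[of "- m"]) (use m that in auto)
    then show "Q (u @ [GenY m])" "Q (u @ [GenYs m])"
      by (auto simp: Q_def mon_mult)
  qed
  have "P (mon w c)" if w: "deg w = 0" for w c
  proof -
    have "Q w"
    proof (rule nonpositive_degree)
      fix w assume "set w \<subseteq> {GenY 0, GenYs 0}"
      then have "P (mon w c) \<and> deg w = 0" for c
      proof (induction w)
        case Nil
        show ?case using const[of c] by (simp add: const_eq_mon)
      next
        case (Cons x w)
        then have "P (mon w c)" "mon w c \<in> homog 0" "x = GenY 0 \<or> x = GenYs 0" "deg w = 0" by auto
        then show ?case
          using Y[of "mon w c"] Ys[of "mon w c"] by (auto simp: freeY_def freeYs_def mon_mult)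
      qed
      then show "Q w" by (simp add: Q_def)
    qed (use w in simp)
    then show ?thesis using w by (simp add: Q_def)
  qed
  note mon = this
  have "P p \<and> p \<in> homog 0"
    using assms(1) by (induction p rule: homog_induct) (auto simp: zero mon homog_add intro: add)
  then show ?thesis ..
qed

section \<open>Descent of the functional to the quotient algebra\<close>

definition phi :: "complex \<Rightarrow> alg_elem \<Rightarrow> complex"
  where "phi \<mu> a = Phi \<mu> (SOME p. a = alg_class p)"

lemma phi_alg_class [simp]: "phi \<mu> (alg_class p) = Phi \<mu> p"
proof -
  have "alg_class p = alg_class (SOME q. alg_class p = alg_class q)" by (rule someI) (rule refl)
  then show ?thesis unfolding phi_def by (metis Phi_alg_class)
qed

lemma generate_Alg_induct [consumes 2, case_names gen zero add uminus]:
  assumes "x \<in> generate (add_monoid Alg) S" "S \<subseteq> carrier Alg"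
    and "\<And>p. alg_class p \<in> S \<Longrightarrow> P (alg_class p)" and "P (alg_class 0)"
    and "\<And>p q. P (alg_class p) \<Longrightarrow> P (alg_class q) \<Longrightarrow> P (alg_class (p + q))"
    and "\<And>p. P (alg_class p) \<Longrightarrow> P (alg_class (- p))"
  shows "P x"
proof -
  have "x \<in> carrier Alg \<and> P x"
    using assms(1)
  proof (induction rule: generate.induct)
    case one
    then show ?case using assms(4) by simp
  next
    case (incl h)
    then show ?case using assms(2,3) by (auto simp: carrier_Alg)
  next
    case (inv h)
    then obtain p where "h = alg_class p" using assms(2) by (auto simp: carrier_Alg)
    then show ?case using inv assms(3,6) a_inv_Alg[of p] by (simp add: a_inv_def)
  next
    case (eng h1 h2)
    then show ?case using assms(5) by (auto simp: carrier_Alg)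
  qed
  then show ?thesis ..
qed

lemma generate_Alg_subgroup:
  "S \<subseteq> carrier Alg \<Longrightarrow> subgroup (generate (add_monoid Alg) S) (add_monoid Alg)"
  using Alg.add.generate_is_subgroup by simp

lemma Alg_deg_carrier: "Alg_deg n \<subseteq> carrier Alg"
  by (auto simp: Alg_deg_eq)

lemma Alg_neg_phi:
  assumes "x \<in> Alg_neg"
  shows "x \<in> carrier Alg" "phi \<mu> (alg_class q \<otimes>\<^bsub>Alg\<^esub> x) = 0"
proof -
  have "x \<in> carrier Alg \<and> (\<forall>q. phi \<mu> (alg_class q \<otimes>\<^bsub>Alg\<^esub> x) = 0)"
  proof (rule generate_Alg_induct[OF assms[unfolded Alg_neg_def]])
    fix p assume "alg_class p \<in> (\<Union>n\<in>{1..}. Alg_deg (- n))"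
    then obtain n r where "n \<ge> 1" "r \<in> homog (- n)" "alg_class p = alg_class r"
      by (auto simp: Alg_deg_eq)
    then show "alg_class p \<in> carrier Alg \<and> (\<forall>q. phi \<mu> (alg_class q \<otimes>\<^bsub>Alg\<^esub> alg_class p) = 0)"
      using Phi_mult_negative[of r "- n"] by simp
  qed (use Alg_deg_carrier in \<open>auto simp: distrib_left Phi_add Phi_uminus\<close>)
  then show "x \<in> carrier Alg" "phi \<mu> (alg_class q \<otimes>\<^bsub>Alg\<^esub> x) = 0" by auto
qed

lemma scalar_eq: "scalar c = alg_class (const c)"
  by (simp add: scalar_def)

lemma Y0_homog: "freeY 0 \<in> homog 0" "freeYs 0 \<in> homog 0"
  by (simp_all add: freeY_def freeYs_def)

lemma Phi_Y0:
  assumes "\<mu> \<noteq> 0"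
  shows "Phi \<mu> (freeY 0) = \<mu>" "Phi \<mu> (freeYs 0) = inverse \<mu>"
  using expectation_zero[OF assms] by (simp_all add: freeY_def freeYs_def Phi_mon)

lemma Alg0_simps [simp]:
  "carrier Alg0 = Alg_deg 0" "monoid.mult Alg0 = monoid.mult Alg" "one Alg0 = one Alg"
  "zero Alg0 = zero Alg" "add Alg0 = add Alg"
  by (simp_all add: Alg0_def)

lemma ring_Alg0: "ring Alg0"
proof (rule ringI)
  show "abelian_group Alg0"
  proof (rule abelian_groupI)
    show "\<exists>y\<in>carrier Alg0. y \<oplus>\<^bsub>Alg0\<^esub> x = \<zero>\<^bsub>Alg0\<^esub>" if "x \<in> carrier Alg0" for x
    proof -
      from that obtain p where "p \<in> homog 0" "x = alg_class p" by (auto simp: Alg_deg_eq)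
      then show ?thesis by (intro bexI[of _ "alg_class (- p)"]) (auto simp: Alg_deg_eq homog_uminus)
    qed
  qed (auto simp: Alg_deg_eq homog_add add_ac)
  show "Group.monoid Alg0"
    by (rule Group.monoidI) (use homog_mult[of _ 0 _ 0] in \<open>auto simp: Alg_deg_eq mult.assoc\<close>)
qed (auto simp: Alg_deg_eq algebra_simps)

interpretation Alg0: ring Alg0
  by (rule ring_Alg0)

lemma a_inv_Alg0: "p \<in> homog 0 \<Longrightarrow> a_inv Alg0 (alg_class p) = alg_class (- p)"
  by (rule Alg0.minus_equality) (auto simp: Alg_deg_eq homog_uminus)

section \<open>The ideal generated by products with a negative right factor\<close>

definition I0_gens :: "alg_elem set"
  where "I0_gens = {a \<otimes>\<^bsub>Alg\<^esub> b | a b n. n \<ge> 1 \<and> a \<in> Alg_deg n \<and> b \<in> Alg_deg (- n)}"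

lemma I0_gens_iff:
  "x \<in> I0_gens \<longleftrightarrow> (\<exists>p q n. n \<ge> 1 \<and> p \<in> homog n \<and> q \<in> homog (- n) \<and> x = alg_class (p * q))"
  unfolding I0_gens_def by (auto simp: Alg_deg_eq) (metis alg_class_ops(2) imageI)+

lemma I0_gens_subset: "I0_gens \<subseteq> Alg_deg 0"
  using homog_mult[of _ n _ "- n" for n] by (fastforce simp: I0_gens_iff Alg_deg_eq)

lemma I0_eq: "I0 = generate (add_monoid Alg) I0_gens"
  by (simp add: I0_def I0_gens_def)

lemma I0_subgroup: "subgroup I0 (add_monoid Alg)"
  unfolding I0_eq using I0_gens_subset Alg_deg_carrier by (intro generate_Alg_subgroup) blast

lemma I0_closed:
  "alg_class 0 \<in> I0"
  "alg_class p \<in> I0 \<Longrightarrow> alg_class q \<in> I0 \<Longrightarrow> alg_class (p + q) \<in> I0"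
  "alg_class p \<in> I0 \<Longrightarrow> alg_class (- p) \<in> I0"
  using subgroup.one_closed[OF I0_subgroup] subgroup.m_closed[OF I0_subgroup, of "alg_class p" "alg_class q"]
    subgroup.m_inv_closed[OF I0_subgroup, of "alg_class p"] a_inv_Alg[of p]
  by (simp_all add: a_inv_def)

lemma I0_gen: "n < 0 \<Longrightarrow> p \<in> homog (- n) \<Longrightarrow> q \<in> homog n \<Longrightarrow> alg_class (p * q) \<in> I0"
proof -
  assume "n < 0" "p \<in> homog (- n)" "q \<in> homog n"
  then have "- n \<ge> 1 \<and> p \<in> homog (- n) \<and> q \<in> homog (- (- n)) \<and> alg_class (p * q) = alg_class (p * q)" by simp
  then have "alg_class (p * q) \<in> I0_gens" unfolding I0_gens_iff by blast
  then show ?thesis unfolding I0_eq by (rule generate.incl)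
qed

lemma I0_induct [consumes 1, case_names gen zero add uminus]:
  assumes "x \<in> I0"
    and "\<And>p q n. n < 0 \<Longrightarrow> p \<in> homog (- n) \<Longrightarrow> q \<in> homog n \<Longrightarrow> P (alg_class (p * q))"
    and "P (alg_class 0)"
    and "\<And>p q. P (alg_class p) \<Longrightarrow> P (alg_class q) \<Longrightarrow> P (alg_class (p + q))"
    and "\<And>p. P (alg_class p) \<Longrightarrow> P (alg_class (- p))"
  shows "P x"
proof (rule generate_Alg_induct[OF assms(1)[unfolded I0_eq] _ _ assms(3-5)])
  show "I0_gens \<subseteq> carrier Alg" using I0_gens_subset Alg_deg_carrier by blast
  fix p assume "alg_class p \<in> I0_gens"
  then obtain r q n where "n \<ge> 1" "r \<in> homog n" "q \<in> homog (- n)" "alg_class p = alg_class (r * q)"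
    unfolding I0_gens_iff by blast
  then show "P (alg_class p)" using assms(2)[of "- n" r q] by simp
qed

text \<open>A factor of degree zero is absorbed into the adjacent factor of \<open>p * q\<close>
  without changing either degree.\<close>

lemma I0_mult:
  assumes "x \<in> I0" "r \<in> homog 0"
  shows "alg_class r \<otimes>\<^bsub>Alg\<^esub> x \<in> I0" "x \<otimes>\<^bsub>Alg\<^esub> alg_class r \<in> I0"
proof -
  have "alg_class r \<otimes>\<^bsub>Alg\<^esub> x \<in> I0 \<and> x \<otimes>\<^bsub>Alg\<^esub> alg_class r \<in> I0"
    using assms(1)
  proof (induction rule: I0_induct)
    case (gen p q n)
    have "r * p \<in> homog (- n)" "q * r \<in> homog n"
      using homog_mult[OF assms(2) gen(2)] homog_mult[OF gen(3) assms(2)] by simp_all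
    then show ?case
      using I0_gen[of n "r * p" q] I0_gen[of n p "q * r"] gen by (simp add: mult.assoc)
  qed (auto simp: I0_closed distrib_left distrib_right)
  then show "alg_class r \<otimes>\<^bsub>Alg\<^esub> x \<in> I0" "x \<otimes>\<^bsub>Alg\<^esub> alg_class r \<in> I0" by auto
qed

lemma Alg_deg_class: "p \<in> homog n \<Longrightarrow> alg_class p \<in> Alg_deg n"
  by (simp add: Alg_deg_eq)

lemma Alg_deg_closed:
  "a \<in> Alg_deg n \<Longrightarrow> b \<in> Alg_deg n \<Longrightarrow> a \<oplus>\<^bsub>Alg\<^esub> b \<in> Alg_deg n"
  "a \<in> Alg_deg n \<Longrightarrow> \<ominus>\<^bsub>Alg\<^esub> a \<in> Alg_deg n"
  by (auto simp: Alg_deg_eq homog_add homog_uminus)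

lemma I0_subset: "I0 \<subseteq> Alg_deg 0"
proof
  fix x assume "x \<in> I0"
  then show "x \<in> Alg_deg 0"
  proof (induction rule: I0_induct)
    case (gen p q n)
    then show ?case using homog_mult[OF gen(2,3)] by (auto simp: Alg_deg_eq)
  qed (auto simp: Alg_deg_closed simp flip: alg_class_ops(1) a_inv_Alg intro: Alg_deg_class)
qed

lemma phi_I0: "x \<in> I0 \<Longrightarrow> phi \<mu> x = 0"
  by (induction rule: I0_induct) (auto simp: Phi_mult_negative Phi_add Phi_uminus)

lemma I0_ideal: "ideal I0 Alg0"
proof (rule idealI[OF ring_Alg0])
  show "subgroup I0 (add_monoid Alg0)"
  proof (rule Alg0.add.subgroupI)
    show "\<ominus>\<^bsub>Alg0\<^esub> x \<in> I0" if "x \<in> I0" for x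
      using that I0_subset a_inv_Alg0 I0_closed(3) by (force simp: Alg_deg_eq)
    show "x \<oplus>\<^bsub>Alg0\<^esub> y \<in> I0" if "x \<in> I0" "y \<in> I0" for x y
      using that subgroup.m_closed[OF I0_subgroup] by simp
  qed (use I0_subset I0_closed(1) in auto)
qed (use I0_mult in \<open>auto simp: Alg_deg_eq\<close>)

section \<open>Characters of the reduced degree-zero algebra\<close>

lemma bar_class_eq_iff:
  assumes "p \<in> homog 0" "q \<in> homog 0"
  shows "bar_class (alg_class p) = bar_class (alg_class q) \<longleftrightarrow> alg_class (p - q) \<in> I0"
proof -
  have "abelian_subgroup I0 Alg0"
    using I0_ideal by (simp add: abelian_subgroupI3 ideal.axioms Alg0.abelian_group_axioms)
  from abelian_subgroup.a_rcos_eq_iff[OF this, of "alg_class p" "alg_class q"] assms show ?thesis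
    by (simp add: bar_class_def a_minus_def a_inv_Alg0 Alg_deg_eq)
qed

lemma carrier_Alg0bar: "carrier Alg0bar = bar_class ` alg_class ` homog 0"
  by (auto simp: Alg0bar_def FactRing_def A_RCOSETS_defs bar_class_def a_r_coset_def r_coset_def Alg_deg_eq)

lemma bar_class_ops:
  assumes "p \<in> homog 0" "q \<in> homog 0"
  shows "bar_class (alg_class p) \<oplus>\<^bsub>Alg0bar\<^esub> bar_class (alg_class q) = bar_class (alg_class (p + q))"
    and "bar_class (alg_class p) \<otimes>\<^bsub>Alg0bar\<^esub> bar_class (alg_class q) = bar_class (alg_class (p * q))"
    and "\<one>\<^bsub>Alg0bar\<^esub> = bar_class (alg_class 1)"
  using ideal.a_rcos_sum[OF I0_ideal, of "alg_class p" "alg_class q"]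
    ideal.rcoset_mult_add[OF I0_ideal, of "alg_class p" "alg_class q"] assms
  by (simp_all add: Alg0bar_def FactRing_def bar_class_def Alg_deg_eq)

lemma complex_module_simps [simp]:
  "carrier (complex_module act) = UNIV" "add (complex_module act) = (+)"
  "zero (complex_module act) = 0" "module.smult (complex_module act) = act"
  by (simp_all add: complex_module_def)

definition bar_phi :: "complex \<Rightarrow> alg_elem set \<Rightarrow> complex"
  where "bar_phi \<mu> X = Phi \<mu> (SOME p. p \<in> homog 0 \<and> X = bar_class (alg_class p))"

lemma bar_phi_class:
  assumes "p \<in> homog 0"
  shows "bar_phi \<mu> (bar_class (alg_class p)) = Phi \<mu> p"
proof -
  define q where "q = (SOME q. q \<in> homog 0 \<and> bar_class (alg_class p) = bar_class (alg_class q))"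
  have q: "q \<in> homog 0 \<and> bar_class (alg_class p) = bar_class (alg_class q)"
    unfolding q_def by (rule someI[of _ p]) (simp add: assms)
  then have "alg_class (p - q) \<in> I0" using bar_class_eq_iff[OF assms, of q] by blast
  then have "Phi \<mu> (p - q) = 0" using phi_I0 by fastforce
  then show ?thesis by (simp add: bar_phi_def flip: q_def) (simp add: Phi_diff)
qed

text \<open>The condition under the choice in \<open>Cbar_action\<close>, isolated so that existence
  and uniqueness can be treated separately.\<close>

definition is_character :: "complex \<Rightarrow> (alg_elem set \<Rightarrow> complex \<Rightarrow> complex) \<Rightarrow> bool"
  where "is_character \<mu> act \<longleftrightarrow>
    left_module Alg0bar (complex_module act) \<and>
    (\<forall>c z. act (bar_class (scalar c)) z = c * z) \<and>
    (\<forall>z. act (bar_class (Y 0)) z = \<mu> * z) \<and>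
    (\<forall>z. act (bar_class (Ys 0)) z = inverse \<mu> * z)"

text \<open>The Fock space pays off here: \<open>Phi\<close> vanishes on \<open>I0\<close> and is
  multiplicative in degree zero, so every nonzero value of \<open>Y\<^sub>0\<close> is
  realized.\<close>

lemma is_character_exists:
  assumes "\<mu> \<noteq> 0"
  shows "is_character \<mu> (\<lambda>X z. bar_phi \<mu> X * z)"
  unfolding is_character_def
proof (intro conjI allI)
  have "abelian_group (complex_module act)" for act :: "alg_elem set \<Rightarrow> complex \<Rightarrow> complex"
    by (rule abelian_groupI) (auto simp: add_ac intro: exI[of _ "- _"] add.left_inverse)
  moreover have "ring Alg0bar"
    unfolding Alg0bar_def by (rule ideal.quotient_is_ring[OF I0_ideal])
  ultimately show "left_module Alg0bar (complex_module (\<lambda>X z. bar_phi \<mu> X * z))"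
    using homog_mult[of _ 0 _ 0]
    by (intro left_module.intro left_module_axioms.intro)
       (auto simp: carrier_Alg0bar bar_class_ops bar_phi_class homog_add Phi_add
         Phi_mult_zero_degree[OF assms] algebra_simps bar_class_ops(3)[OF homog_zero homog_zero])
qed (use Y0_homog Phi_Y0[OF assms] in \<open>simp_all add: scalar_eq Y_def Ys_def bar_phi_class\<close>)

text \<open>Any action with these values agrees with \<open>Phi\<close> on the whole carrier, so the
  choice in \<open>Cbar_action\<close> cannot affect the modules built from it.\<close>

lemma is_character_unique:
  assumes "\<mu> \<noteq> 0" "is_character \<mu> act" "p \<in> homog 0"
  shows "act (bar_class (alg_class p)) z = Phi \<mu> p * z"
proof -
  interpret left_module Alg0bar "complex_module act"
    using assms(2) by (simp add: is_character_def)
  have act: "act (bar_class (scalar c)) z = c * z" "act (bar_class (Y 0)) z = \<mu> * z"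
    "act (bar_class (Ys 0)) z = inverse \<mu> * z" for c z
    using assms(2) by (auto simp: is_character_def)
  have car: "bar_class (alg_class p) \<in> carrier Alg0bar" if "p \<in> homog 0" for p
    using that by (auto simp: carrier_Alg0bar)
  have act_mult: "act (bar_class (alg_class (p * q))) z = act (bar_class (alg_class p)) (act (bar_class (alg_class q)) z)"
    if "p \<in> homog 0" "q \<in> homog 0" for p q z
    using smult_assoc[OF car[OF that(1)] car[OF that(2)], of z] that by (simp add: bar_class_ops)
  have act_zero: "act (bar_class (alg_class 0)) z = 0" for z
    using act(1)[of 0] by (simp add: scalar_eq)
  show ?thesis
    using assms(3)
  proof (induction p arbitrary: z rule: degree_zero_induct)
    case (cong p q)
    then show ?case using Phi_alg_class[of p q \<mu>] by simp
  next
    case (add p q)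
    then show ?case
      using smult_l_distr[OF car[OF add(1)] car[OF add(2)], of z]
      by (simp add: bar_class_ops Phi_add algebra_simps)
  next
    case (const c)
    then show ?case using act(1) by (simp add: scalar_eq)
  next
    case (Y p)
    then show ?case
      using act_mult[OF Y0_homog(1) Y(1)] act(2) Phi_Y0(1)[OF assms(1)]
      by (simp add: Y_def[symmetric] Phi_mult_zero_degree[OF assms(1)])
  next
    case (Ys p)
    then show ?case
      using act_mult[OF Y0_homog(2) Ys(1)] act(3) Phi_Y0(2)[OF assms(1)]
      by (simp add: Ys_def[symmetric] Phi_mult_zero_degree[OF assms(1)])
  next
    case (negative p q n)
    then have "p * q \<in> homog 0" using homog_mult[OF negative(2,3)] by simp
    then have "bar_class (alg_class (p * q)) = bar_class (alg_class 0)"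
      using I0_gen[OF negative] by (simp add: bar_class_eq_iff)
    then show ?case using act_zero Phi_mult_negative[OF negative(3,1)] by simp
  qed
qed

lemma Cbar_action_class:
  assumes "\<mu> \<noteq> 0" "p \<in> homog 0"
  shows "Cbar_action \<mu> (bar_class (alg_class p)) z = Phi \<mu> p * z"
proof -
  have "is_character \<mu> (Cbar_action \<mu>)"
    unfolding Cbar_action_def is_character_def[symmetric]
    by (rule someI[of "is_character \<mu>"]) (rule is_character_exists[OF assms(1)])
  then show ?thesis by (rule is_character_unique[OF assms(1) _ assms(2)])
qed

section \<open>The one-dimensional module over the nonpositive part\<close>

lemma Alg_nonposE:
  assumes "b \<in> Alg_nonpos"
  obtains x p where "x \<in> Alg_neg" "p \<in> homog 0" "b = x \<oplus>\<^bsub>Alg\<^esub> alg_class p"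
  using assms unfolding Alg_nonpos_def by (auto simp: set_add_def set_mult_def Alg_deg_eq)

lemma phi_add: "a \<in> carrier Alg \<Longrightarrow> b \<in> carrier Alg \<Longrightarrow> phi \<mu> (a \<oplus>\<^bsub>Alg\<^esub> b) = phi \<mu> a + phi \<mu> b"
  by (auto simp: carrier_Alg Phi_add)

lemma phi_Alg_neg: "x \<in> Alg_neg \<Longrightarrow> phi \<mu> x = 0"
  using Alg_neg_phi(1)[of x] Alg_neg_phi(2)[of x \<mu> 1] Alg.l_one[of x] by simp

lemma Alg_nonpos_carrier: "b \<in> Alg_nonpos \<Longrightarrow> b \<in> carrier Alg"
  using Alg_neg_phi(1) by (auto elim!: Alg_nonposE)

text \<open>This is the balance condition: it lets \<open>phi\<close> define a functional that
  respects the tensor relations over \<open>Alg_nonpos\<close>.\<close>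

lemma phi_mult_nonpos:
  assumes "\<mu> \<noteq> 0" "b \<in> Alg_nonpos" "a \<in> carrier Alg"
  shows "phi \<mu> (a \<otimes>\<^bsub>Alg\<^esub> b) = phi \<mu> a * phi \<mu> b"
proof -
  obtain x p where b: "x \<in> Alg_neg" "p \<in> homog 0" "b = x \<oplus>\<^bsub>Alg\<^esub> alg_class p"
    using assms(2) by (rule Alg_nonposE)
  obtain q where a: "a = alg_class q" using assms(3) by (auto simp: carrier_Alg)
  have x: "x \<in> carrier Alg" using Alg_neg_phi(1)[OF b(1)] .
  have "phi \<mu> (a \<otimes>\<^bsub>Alg\<^esub> b) = phi \<mu> (a \<otimes>\<^bsub>Alg\<^esub> x) + phi \<mu> (a \<otimes>\<^bsub>Alg\<^esub> alg_class p)"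
    unfolding b(3) using x assms(3) by (simp add: Alg.r_distr phi_add)
  then show ?thesis
    using Alg_neg_phi(2)[OF b(1), of \<mu> q] x
    by (simp add: a b(3) phi_add phi_Alg_neg[OF b(1)] Phi_mult_zero_degree[OF assms(1) b(2)])
qed

lemma C_module_simps [simp]:
  "carrier (C_module \<mu>) = UNIV" "add (C_module \<mu>) = (+)" "zero (C_module \<mu>) = 0"
  by (simp_all add: C_module_def)

text \<open>Whatever decomposition of \<open>b\<close> is taken, \<open>phi\<close> kills the
  negative summand, so every candidate value equals \<open>phi \<mu> b * z\<close> and the definite
  description is met.\<close>

lemma C_module_smult:
  assumes "\<mu> \<noteq> 0" "b \<in> Alg_nonpos"
  shows "b \<odot>\<^bsub>C_module \<mu>\<^esub> z = phi \<mu> b * z"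
proof -
  have *: "Cbar_action \<mu> (bar_class a) z = phi \<mu> b * z"
    if "x \<in> Alg_neg" "a \<in> Alg_deg 0" "b = x \<oplus>\<^bsub>Alg\<^esub> a" for x a
    using that Alg_neg_phi(1)[OF that(1)] Alg_deg_carrier[of 0]
    by (auto simp: Alg_deg_eq phi_add phi_Alg_neg Cbar_action_class[OF assms(1)])
  obtain x a where "x \<in> Alg_neg" "a \<in> Alg_deg 0" "b = x \<oplus>\<^bsub>Alg\<^esub> a"
    using assms(2) by (rule Alg_nonposE) (auto simp: Alg_deg_eq)
  then have "(THE w. \<exists>x\<in>Alg_neg. \<exists>a\<in>Alg_deg 0. b = x \<oplus>\<^bsub>Alg\<^esub> a \<and> w = Cbar_action \<mu> (bar_class a) z) = phi \<mu> b * z"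
    using * by (intro the_equality) (metis | blast)+
  then show ?thesis by (simp add: C_module_def)
qed

section \<open>The induced module and its irreducible quotient\<close>

text \<open>Covers both quotients, by the tensor relations and by the maximal submodule. It asks for
  additivity only in the module argument, since on formal pairs the action is not additive in the
  algebra element.\<close>

locale stable_subgroup = abelian_group M for M :: "('a, 'b, 'm) module_scheme" (structure) +
  fixes A :: "'a set" and N :: "'b set"
  assumes subgroup_N: "subgroup N (add_monoid M)"
    and act_closed: "a \<in> A \<Longrightarrow> x \<in> carrier M \<Longrightarrow> a \<odot>\<^bsub>M\<^esub> x \<in> carrier M"
    and act_add: "a \<in> A \<Longrightarrow> x \<in> carrier M \<Longrightarrow> y \<in> carrier M \<Longrightarrow>
      a \<odot>\<^bsub>M\<^esub> (x \<oplus> y) = a \<odot>\<^bsub>M\<^esub> x \<oplus> a \<odot>\<^bsub>M\<^esub> y"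
    and act_N: "a \<in> A \<Longrightarrow> x \<in> N \<Longrightarrow> a \<odot>\<^bsub>M\<^esub> x \<in> N"
begin

sublocale Sub: abelian_subgroup N M
  by (rule abelian_subgroupI3)
     (simp_all add: additive_subgroup_def subgroup_N abelian_group_axioms)

lemma quotient_carrier: "carrier (quotient_module M N) = (\<lambda>x. N +> x) ` carrier M"
  by (auto simp: quotient_module_def A_RCOSETS_defs a_r_coset_def r_coset_def)

lemma quotient_zero: "\<zero>\<^bsub>quotient_module M N\<^esub> = N"
  by (simp add: quotient_module_def)

lemma quotient_add:
  "x \<in> carrier M \<Longrightarrow> y \<in> carrier M \<Longrightarrow> (N +> x) \<oplus>\<^bsub>quotient_module M N\<^esub> (N +> y) = N +> (x \<oplus> y)"
  by (simp add: quotient_module_def Sub.a_rcos_sum)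

lemma coset_eq_iff: "x \<in> carrier M \<Longrightarrow> y \<in> carrier M \<Longrightarrow> N +> x = N +> y \<longleftrightarrow> x \<ominus> y \<in> N"
  by (rule Sub.a_rcos_eq_iff)

lemma coset_eq_self_iff: "x \<in> carrier M \<Longrightarrow> N +> x = N \<longleftrightarrow> x \<in> N"
  using Sub.a_rcos_const Sub.a_rcos_self by blast

lemma quotient_smult:
  assumes a: "a \<in> A" and x: "x \<in> carrier M"
  shows "a \<odot>\<^bsub>quotient_module M N\<^esub> (N +> x) = N +> (a \<odot>\<^bsub>M\<^esub> x)"
proof -
  have "N +> (a \<odot>\<^bsub>M\<^esub> y) = N +> (a \<odot>\<^bsub>M\<^esub> x)" if y: "y \<in> N +> x" for y
  proof -
    obtain n where n: "n \<in> N" "y = n \<oplus> x"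
      using y by (auto simp: a_r_coset_def r_coset_def)
    have nc: "n \<in> carrier M" using n(1) Sub.a_subset by blast
    have "a \<odot>\<^bsub>M\<^esub> y = a \<odot>\<^bsub>M\<^esub> n \<oplus> a \<odot>\<^bsub>M\<^esub> x"
      unfolding n(2) by (rule act_add[OF a nc x])
    then have "a \<odot>\<^bsub>M\<^esub> y \<in> N +> (a \<odot>\<^bsub>M\<^esub> x)"
      using act_N[OF a n(1)] by (auto simp: a_r_coset_def r_coset_def)
    then show ?thesis
      using Sub.a_repr_independence'[of "a \<odot>\<^bsub>M\<^esub> y" "a \<odot>\<^bsub>M\<^esub> x"] act_closed[OF a x] by simp
  qed
  moreover have "x \<in> N +> x" by (rule Sub.a_rcos_self[OF x])
  ultimately have "(\<Union>y\<in>N +> x. N +> (a \<odot>\<^bsub>M\<^esub> y)) = N +> (a \<odot>\<^bsub>M\<^esub> x)" by blast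
  then show ?thesis by (simp add: quotient_module_def)
qed

end

section \<open>The tensor relations and the structure of the induced module\<close>

context
  fixes \<mu> :: complex
  assumes mu: "\<mu> \<noteq> 0"
begin

abbreviation "PM \<equiv> pairs_module Alg (C_module \<mu>)"
abbreviation "TR \<equiv> tensor_relations Alg Alg_nonpos (C_module \<mu>)"

lemma PM_simps:
  "carrier PM = {c. Poly_Mapping.keys c \<subseteq> carrier Alg \<times> UNIV}" "\<zero>\<^bsub>PM\<^esub> = 0" "add PM = (+)"
  "module.smult PM = (\<lambda>a. frag_extend (\<lambda>(r, v). frag_of (a \<otimes>\<^bsub>Alg\<^esub> r, v)))"
  by (simp_all add: pairs_module_def)

lemma PM_carrier_closed:
  "c \<in> carrier PM \<Longrightarrow> d \<in> carrier PM \<Longrightarrow> c + d \<in> carrier PM"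
  "c \<in> carrier PM \<Longrightarrow> d \<in> carrier PM \<Longrightarrow> c - d \<in> carrier PM"
  "c \<in> carrier PM \<Longrightarrow> - c \<in> carrier PM"
  "0 \<in> carrier PM"
  using keys_add[of c d] keys_diff[of c d] by (auto simp: PM_simps)

lemma frag_of_carrier [simp]: "frag_of (alg_class p, v) \<in> carrier PM"
  by (simp add: PM_simps)

lemma PM_abelian_group: "abelian_group PM"
proof (rule abelian_groupI)
  show "\<exists>y\<in>carrier PM. y \<oplus>\<^bsub>PM\<^esub> x = \<zero>\<^bsub>PM\<^esub>" if "x \<in> carrier PM" for x
    using that PM_carrier_closed(3)[OF that] by (intro bexI[of _ "- x"]) (simp_all add: PM_simps(2,3))
qed (auto simp: PM_simps(2,3) PM_carrier_closed add_ac)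

lemma PM_a_inv: "c \<in> carrier PM \<Longrightarrow> \<ominus>\<^bsub>PM\<^esub> c = - c"
  by (rule abelian_group.minus_equality[OF PM_abelian_group]) (simp_all add: PM_carrier_closed PM_simps(2,3))

lemma PM_a_minus: "c \<in> carrier PM \<Longrightarrow> d \<in> carrier PM \<Longrightarrow> c \<ominus>\<^bsub>PM\<^esub> d = c - d"
  by (simp add: a_minus_def PM_a_inv PM_simps(3))

text \<open>The generating relations expressed through representatives, with the action on the
  one-dimensional module already evaluated to \<open>Phi\<close>.\<close>

inductive tensor_relator :: "((alg_elem \<times> complex) \<Rightarrow>\<^sub>0 int) \<Rightarrow> bool" where
  left: "tensor_relator (frag_of (alg_class (p + q), v) - frag_of (alg_class p, v) - frag_of (alg_class q, v))"
| right: "tensor_relator (frag_of (alg_class p, v + w) - frag_of (alg_class p, v) - frag_of (alg_class p, w))"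
| balance: "alg_class q \<in> Alg_nonpos \<Longrightarrow>
    tensor_relator (frag_of (alg_class (p * q), v) - frag_of (alg_class p, Phi \<mu> q * v))"

lemma TR_eq: "TR = generate (add_monoid PM) (Collect tensor_relator)"
proof -
  have "{frag_of (r \<oplus>\<^bsub>Alg\<^esub> s, v) - frag_of (r, v) - frag_of (s, v) | r s v.
        r \<in> carrier Alg \<and> s \<in> carrier Alg \<and> v \<in> carrier (C_module \<mu>)} \<union>
     {frag_of (r, v \<oplus>\<^bsub>C_module \<mu>\<^esub> w) - frag_of (r, v) - frag_of (r, w) | r v w.
        r \<in> carrier Alg \<and> v \<in> carrier (C_module \<mu>) \<and> w \<in> carrier (C_module \<mu>)} \<union>
     {frag_of (r \<otimes>\<^bsub>Alg\<^esub> b, v) - frag_of (r, b \<odot>\<^bsub>C_module \<mu>\<^esub> v) | r b v.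
        r \<in> carrier Alg \<and> b \<in> Alg_nonpos \<and> v \<in> carrier (C_module \<mu>)} = Collect tensor_relator" (is "?L = ?R")
  proof
    show "?L \<subseteq> ?R"
    proof (intro Un_least subsetI)
      fix x assume "x \<in> {frag_of (r \<oplus>\<^bsub>Alg\<^esub> s, v) - frag_of (r, v) - frag_of (s, v) | r s v.
        r \<in> carrier Alg \<and> s \<in> carrier Alg \<and> v \<in> carrier (C_module \<mu>)}"
      then show "x \<in> ?R" by (auto simp: carrier_Alg intro: tensor_relator.intros)
    next
      fix x assume "x \<in> {frag_of (r, v \<oplus>\<^bsub>C_module \<mu>\<^esub> w) - frag_of (r, v) - frag_of (r, w) | r v w.
        r \<in> carrier Alg \<and> v \<in> carrier (C_module \<mu>) \<and> w \<in> carrier (C_module \<mu>)}"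
      then show "x \<in> ?R" by (auto simp: carrier_Alg intro: tensor_relator.intros)
    next
      fix x assume "x \<in> {frag_of (r \<otimes>\<^bsub>Alg\<^esub> b, v) - frag_of (r, b \<odot>\<^bsub>C_module \<mu>\<^esub> v) | r b v.
        r \<in> carrier Alg \<and> b \<in> Alg_nonpos \<and> v \<in> carrier (C_module \<mu>)}"
      then obtain r b v where x: "x = frag_of (r \<otimes>\<^bsub>Alg\<^esub> b, v) - frag_of (r, b \<odot>\<^bsub>C_module \<mu>\<^esub> v)"
        "r \<in> carrier Alg" "b \<in> Alg_nonpos" by blast
      obtain p q where "r = alg_class p" "b = alg_class q"
        using x(2) Alg_nonpos_carrier[OF x(3)] by (auto simp: carrier_Alg)
      then show "x \<in> ?R"
        using x C_module_smult[OF mu x(3)] by (simp add: tensor_relator.balance)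
    qed
    show "?R \<subseteq> ?L"
    proof
      fix x assume "x \<in> ?R"
      then have "tensor_relator x" by simp
      then show "x \<in> ?L"
      proof cases
        case (left p q v)
        then show ?thesis
          by (intro UnI1 CollectI exI[of _ "alg_class p"] exI[of _ "alg_class q"] exI[of _ v]) simp
      next
        case (right p v w)
        then show ?thesis
          by (intro UnI1 UnI2 CollectI exI[of _ "alg_class p"] exI[of _ v] exI[of _ w]) simp
      next
        case (balance q p v)
        then show ?thesis
          by (intro UnI2 CollectI exI[of _ "alg_class p"] exI[of _ "alg_class q"] exI[of _ v])
             (simp add: C_module_smult[OF mu])
      qed
    qed
  qed
  then show ?thesis by (simp only: tensor_relations_def)
qed

lemma relator_carrier: "tensor_relator x \<Longrightarrow> x \<in> carrier PM"
  by (induction rule: tensor_relator.induct) (intro PM_carrier_closed frag_of_carrier)+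

lemma TR_subgroup: "subgroup TR (add_monoid PM)"
  unfolding TR_eq
  using abelian_group.a_group[OF PM_abelian_group] relator_carrier
  by (intro group.generate_is_subgroup) auto

lemma TR_induct [consumes 1, case_names relator zero add uminus]:
  assumes "x \<in> TR" and "\<And>x. tensor_relator x \<Longrightarrow> P x" and "P 0"
    and "\<And>x y. x \<in> TR \<Longrightarrow> y \<in> TR \<Longrightarrow> P x \<Longrightarrow> P y \<Longrightarrow> P (x + y)"
    and "\<And>x. P x \<Longrightarrow> P (- x)"
  shows "P x"
proof -
  have "x \<in> generate (add_monoid PM) (Collect tensor_relator)" using assms(1) by (simp add: TR_eq)
  then show ?thesis
  proof (induction rule: generate.induct)
    case (inv h)
    then show ?case
      using assms(2,5)[of h] PM_a_inv[of h] relator_carrier by (simp add: a_inv_def)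
  next
    case (eng h1 h2)
    then show ?case using assms(4)[of h1 h2] by (simp add: PM_simps TR_eq)
  qed (use assms in \<open>auto simp: PM_simps\<close>)
qed

lemma TR_closed:
  "0 \<in> TR" "x \<in> TR \<Longrightarrow> y \<in> TR \<Longrightarrow> x + y \<in> TR" "x \<in> TR \<Longrightarrow> - x \<in> TR"
  "x \<in> TR \<Longrightarrow> y \<in> TR \<Longrightarrow> x - y \<in> TR"
proof -
  show "0 \<in> TR" using subgroup.one_closed[OF TR_subgroup] by (simp add: PM_simps)
  show add: "x + y \<in> TR" if "x \<in> TR" "y \<in> TR" for x y
    using subgroup.m_closed[OF TR_subgroup that] by (simp add: PM_simps)
  show neg: "- x \<in> TR" if "x \<in> TR" for x
    using subgroup.m_inv_closed[OF TR_subgroup that] PM_a_inv[of x] subgroup.subset[OF TR_subgroup] that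
    by (auto simp: a_inv_def)
  show "x - y \<in> TR" if "x \<in> TR" "y \<in> TR"
    using add[OF that(1) neg[OF that(2)]] by simp
qed

lemma relator_TR: "tensor_relator x \<Longrightarrow> x \<in> TR"
  unfolding TR_eq by (rule generate.incl) simp

lemma PM_smult_of: "alg_class a \<odot>\<^bsub>PM\<^esub> frag_of (alg_class p, v) = frag_of (alg_class (a * p), v)"
  by (simp add: PM_simps)

lemma PM_smult_add: "a \<odot>\<^bsub>PM\<^esub> (x + y) = a \<odot>\<^bsub>PM\<^esub> x + a \<odot>\<^bsub>PM\<^esub> y"
  and PM_smult_diff: "a \<odot>\<^bsub>PM\<^esub> (x - y) = a \<odot>\<^bsub>PM\<^esub> x - a \<odot>\<^bsub>PM\<^esub> y"
  and PM_smult_uminus: "a \<odot>\<^bsub>PM\<^esub> (- x) = - (a \<odot>\<^bsub>PM\<^esub> x)"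
  and PM_smult_zero: "a \<odot>\<^bsub>PM\<^esub> 0 = 0"
  by (simp_all add: PM_simps frag_extend_add frag_extend_diff frag_extend_minus)

lemma relator_smult: "tensor_relator x \<Longrightarrow> tensor_relator (alg_class a \<odot>\<^bsub>PM\<^esub> x)"
  by (induction rule: tensor_relator.induct)
     (auto simp: PM_smult_diff PM_smult_of distrib_left simp flip: mult.assoc intro: tensor_relator.intros)

lemma TR_smult:
  assumes "a \<in> carrier Alg" "x \<in> TR" shows "a \<odot>\<^bsub>PM\<^esub> x \<in> TR"
proof -
  obtain p where "a = alg_class p" using assms(1) by (auto simp: carrier_Alg)
  with assms(2) show ?thesis
    by (induction rule: TR_induct)
       (auto simp: PM_smult_add PM_smult_uminus PM_smult_zero TR_closed relator_TR relator_smult)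
qed

lemma PM_smult_closed:
  assumes "a \<in> carrier Alg" "x \<in> carrier PM" shows "a \<odot>\<^bsub>PM\<^esub> x \<in> carrier PM"
proof -
  have "Poly_Mapping.keys (a \<odot>\<^bsub>PM\<^esub> x) \<subseteq> (\<Union>k\<in>Poly_Mapping.keys x. {(a \<otimes>\<^bsub>Alg\<^esub> fst k, snd k)})"
    unfolding PM_simps by (rule order_trans[OF keys_frag_extend]) (auto split: prod.splits)
  then show ?thesis using assms by (fastforce simp: PM_simps)
qed

lemma TR_stable: "stable_subgroup PM (carrier Alg) TR"
  by (intro stable_subgroup.intro stable_subgroup_axioms.intro PM_abelian_group TR_subgroup PM_smult_closed)
     (simp_all add: PM_simps(3) PM_smult_add TR_smult)

interpretation T: stable_subgroup PM "carrier Alg" TR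
  by (rule TR_stable)

abbreviation coset :: "((alg_elem \<times> complex) \<Rightarrow>\<^sub>0 int) \<Rightarrow> ((alg_elem \<times> complex) \<Rightarrow>\<^sub>0 int) set"
  where "coset c \<equiv> TR +>\<^bsub>PM\<^esub> c"

definition vac_M :: "free_elem \<Rightarrow> ((alg_elem \<times> complex) \<Rightarrow>\<^sub>0 int) set"
  where "vac_M p = coset (frag_of (alg_class p, 1))"

lemma M_module_eq: "M_module \<mu> = quotient_module PM TR"
  by (simp add: M_module_def tensor_module_def)

lemma coset_eqI: "c \<in> carrier PM \<Longrightarrow> d \<in> carrier PM \<Longrightarrow> c - d \<in> TR \<Longrightarrow> coset c = coset d"
  by (simp add: T.coset_eq_iff PM_a_minus)

lemma nonposI: "p \<in> homog k \<Longrightarrow> k \<le> 0 \<Longrightarrow> alg_class p \<in> Alg_nonpos"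
proof -
  assume p: "p \<in> homog k" "k \<le> 0"
  have neg0: "alg_class 0 \<in> Alg_neg" unfolding Alg_neg_def
    using generate.one[of "add_monoid Alg"] by simp
  show ?thesis
  proof (cases "k = 0")
    case True
    then have "alg_class 0 \<oplus>\<^bsub>Alg\<^esub> alg_class p \<in> Alg_nonpos"
      unfolding Alg_nonpos_def set_add_def set_mult_def using neg0 p by (auto simp: Alg_deg_eq simp del: alg_class_ops)
    then show ?thesis by simp
  next
    case False
    then have "alg_class p \<in> (\<Union>n\<in>{1..}. Alg_deg (- n))"
      using p by (intro UN_I[of "- k"]) (auto simp: Alg_deg_eq)
    then have "alg_class p \<in> Alg_neg" unfolding Alg_neg_def by (rule generate.incl)
    moreover have "alg_class 0 \<in> Alg_deg 0" by (simp add: Alg_deg_eq)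
    ultimately have "alg_class p \<oplus>\<^bsub>Alg\<^esub> alg_class 0 \<in> Alg_nonpos"
      unfolding Alg_nonpos_def set_add_def set_mult_def by (auto simp del: alg_class_ops)
    then show ?thesis by simp
  qed
qed

text \<open>Scalars have degree zero and hence belong to \<open>Alg_nonpos\<close>, so balance moves
  \<open>z\<close> across the tensor sign. This is how a tensor product built over the integers
  becomes complex linear.\<close>

lemma coset_pure: "coset (frag_of (alg_class p, z)) = vac_M (p * const z)"
proof -
  have "tensor_relator (frag_of (alg_class (p * const z), 1) - frag_of (alg_class p, Phi \<mu> (const z) * 1))"
    by (rule tensor_relator.balance) (rule nonposI[OF homog_const], simp)
  then show ?thesis
    unfolding vac_M_def by (intro sym[OF coset_eqI]) (simp_all add: relator_TR)
qed

lemma vac_M_nonpos: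
  assumes "p \<in> homog k" "k \<le> 0"
  shows "vac_M p = vac_M (const (Phi \<mu> p))"
proof -
  have "tensor_relator (frag_of (alg_class (1 * p), 1) - frag_of (alg_class 1, Phi \<mu> p * 1))"
    by (rule tensor_relator.balance) (rule nonposI[OF assms])
  then have "vac_M p = coset (frag_of (alg_class 1, Phi \<mu> p))"
    unfolding vac_M_def by (intro coset_eqI) (simp_all add: relator_TR)
  then show ?thesis by (simp add: coset_pure)
qed

lemma vac_M_add: "vac_M (p + q) = vac_M p \<oplus>\<^bsub>M_module \<mu>\<^esub> vac_M q"
proof -
  have "vac_M (p + q) = coset (frag_of (alg_class p, 1) + frag_of (alg_class q, 1))"
    unfolding vac_M_def using relator_TR[OF tensor_relator.left[of p q 1]]
    by (intro coset_eqI) (simp_all add: PM_carrier_closed diff_diff_add)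
  then show ?thesis by (simp add: M_module_eq vac_M_def T.quotient_add PM_simps(3))
qed

lemma vac_M_zero: "vac_M 0 = \<zero>\<^bsub>M_module \<mu>\<^esub>"
proof -
  have "- frag_of (alg_class 0, 1) \<in> TR"
    using relator_TR[OF tensor_relator.left[of 0 0 1]] by simp
  then have "frag_of (alg_class 0, 1) \<in> TR" using TR_closed(3) by fastforce
  then show ?thesis by (simp add: vac_M_def M_module_eq T.quotient_zero T.coset_eq_self_iff)
qed

text \<open>In the free abelian group, \<open>coset_pure\<close> settles the generators and
  biadditivity settles differences.\<close>

lemma range_vac_M: "range vac_M = carrier (M_module \<mu>)"
proof
  show "range vac_M \<subseteq> carrier (M_module \<mu>)"
    by (auto simp: M_module_eq T.quotient_carrier vac_M_def)
  have "\<exists>p. coset c = vac_M p" if "Poly_Mapping.keys c \<subseteq> carrier Alg \<times> UNIV" for c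
  proof -
    have "c \<in> carrier PM \<and> (\<exists>p. c - frag_of (alg_class p, 1) \<in> TR)"
      using that
    proof (induction c rule: frag_induction)
      case zero
      have "frag_of (alg_class 0, 1) \<in> TR"
        using vac_M_zero by (simp add: vac_M_def M_module_eq T.quotient_zero T.coset_eq_self_iff)
      then show ?case using TR_closed(3) PM_carrier_closed(4) by (intro conjI exI[of _ 0]) simp_all
    next
      case (one x)
      then obtain p z where x: "x = (alg_class p, z)" by (auto simp: carrier_Alg)
      have "frag_of x - frag_of (alg_class (p * const z), 1) \<in> TR"
        using coset_pure[of p z] T.coset_eq_iff[of "frag_of x" "frag_of (alg_class (p * const z), 1)"]
        by (simp add: x vac_M_def PM_a_minus)
      then show ?case by (auto simp: x)
    next
      case (diff a b)
      then obtain p q where pq: "a \<in> carrier PM" "b \<in> carrier PM"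
        "a - frag_of (alg_class p, 1) \<in> TR" "b - frag_of (alg_class q, 1) \<in> TR" by blast
      \<comment> \<open>Biadditivity is applied to \<open>p = (p - q) + q\<close>, which avoids
        computing the tensor of \<open>- q\<close>.\<close>
      have "frag_of (alg_class p, 1) - frag_of (alg_class (p - q), 1) - frag_of (alg_class q, 1) \<in> TR"
        using relator_TR[OF tensor_relator.left[of "p - q" q 1]] by simp
      from TR_closed(2)[OF TR_closed(4)[OF pq(3,4)] this]
      have "a - b - frag_of (alg_class (p - q), 1) \<in> TR" by (simp add: algebra_simps)
      then show ?case using pq PM_carrier_closed(2) by blast
    qed
    then show ?thesis unfolding vac_M_def by (meson coset_eqI frag_of_carrier)
  qed
  then show "carrier (M_module \<mu>) \<subseteq> range vac_M"
    by (auto simp: M_module_eq T.quotient_carrier PM_simps(1)) (metis rangeI)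
qed

text \<open>This functional on the free group vanishes on the tensor relations, hence detects that
  \<open>p \<otimes> 1 \<noteq> 0\<close> whenever \<open>p\<close> lies outside the radical.\<close>

definition tensor_eval :: "free_elem \<Rightarrow> ((alg_elem \<times> complex) \<Rightarrow>\<^sub>0 int) \<Rightarrow> complex"
  where "tensor_eval q c = (\<Sum>k\<in>Poly_Mapping.keys c.
    of_int (Poly_Mapping.lookup c k) * (phi \<mu> (alg_class q \<otimes>\<^bsub>Alg\<^esub> fst k) * snd k))"

lemma tensor_eval_add: "tensor_eval q (c + d) = tensor_eval q c + tensor_eval q d"
  unfolding tensor_eval_def by (rule setsum_keys_plus_distrib) (simp_all add: algebra_simps)

lemma tensor_eval_of: "tensor_eval q (frag_of (alg_class p, z)) = Phi \<mu> (q * p) * z"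
  by (simp add: tensor_eval_def)

lemma tensor_eval_zero: "tensor_eval q 0 = 0"
  by (simp add: tensor_eval_def)

lemma tensor_eval_uminus: "tensor_eval q (- c) = - tensor_eval q c"
  using tensor_eval_add[of q c "- c"] by (simp add: tensor_eval_zero eq_neg_iff_add_eq_0 add.commute)

lemma tensor_eval_diff: "tensor_eval q (c - d) = tensor_eval q c - tensor_eval q d"
  using tensor_eval_add[of q c "- d"] by (simp add: tensor_eval_uminus)

lemma tensor_eval_TR:
  assumes "c \<in> TR" shows "tensor_eval q c = 0"
  using assms
proof (induction rule: TR_induct)
  case (relator x)
  then show ?case
  proof cases
    case (balance b p v)
    have "Phi \<mu> (q * (p * b)) = Phi \<mu> (q * p) * Phi \<mu> b"
      using phi_mult_nonpos[OF mu balance(2), of "alg_class (q * p)"] by (simp add: mult.assoc)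
    then show ?thesis
      by (simp add: balance(1) tensor_eval_diff tensor_eval_of mult.assoc)
  next
    case (left p r v)
    show ?thesis
      unfolding left by (simp add: tensor_eval_diff tensor_eval_add tensor_eval_of algebra_simps Phi_add)
  next
    case (right p v w)
    show ?thesis
      unfolding right by (simp add: tensor_eval_diff tensor_eval_add tensor_eval_of algebra_simps)
  qed
qed (simp_all add: tensor_eval_zero tensor_eval_add tensor_eval_uminus)

text \<open>The grading is taken as images of homogeneous elements at first; identifying it with
  \<open>M_grade\<close> uses the module structure obtained here.\<close>

lemma vac_M_vacuum_module: "vacuum_module \<mu> (M_module \<mu>) (\<lambda>n. vac_M ` homog (int n)) vac_M"
proof
  show "\<mu> \<noteq> 0" by (rule mu)
  show "vac_M (p + q) = vac_M p \<oplus>\<^bsub>M_module \<mu>\<^esub> vac_M q" for p q by (rule vac_M_add)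
  show "vac_M 0 = \<zero>\<^bsub>M_module \<mu>\<^esub>" by (rule vac_M_zero)
  show "range vac_M = carrier (M_module \<mu>)" by (rule range_vac_M)
  show "vac_M (p * q) = alg_class p \<odot>\<^bsub>M_module \<mu>\<^esub> vac_M q" for p q
    using T.quotient_smult[of "alg_class p" "frag_of (alg_class q, 1)"]
    by (simp add: vac_M_def M_module_eq PM_smult_of)
  show "p \<in> rad \<mu>" if "vac_M p = \<zero>\<^bsub>M_module \<mu>\<^esub>" for p
  proof -
    have "frag_of (alg_class p, 1) \<in> TR"
      using that by (simp add: vac_M_def M_module_eq T.quotient_zero T.coset_eq_self_iff)
    then have "Phi \<mu> (q * p) = 0" for q
      using tensor_eval_TR[of _ q] tensor_eval_of[of q p 1] by simp
    then show ?thesis by (simp add: rad_def)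
  qed
  show "vac_M p = \<zero>\<^bsub>M_module \<mu>\<^esub>" if "p \<in> homog k" "k < 0" for p k
    using vac_M_nonpos[OF that(1)] Phi_homog[OF that(1), of \<mu>] that(2) by (simp add: vac_M_zero)
  show "vac_M p = vac_M (const (Phi \<mu> p))" if "p \<in> homog 0" for p
    using vac_M_nonpos[OF that] by simp
qed simp

lemma M_grade_eq: "M_grade \<mu> n = vac_M ` homog (int n)"
proof -
  interpret M: vacuum_module \<mu> "M_module \<mu>" "\<lambda>n. vac_M ` homog (int n)" vac_M
    by (rule vac_M_vacuum_module)
  have "{pure_tensor Alg Alg_nonpos (C_module \<mu>) a z | a z. a \<in> Alg_deg (int n)} = vac_M ` homog (int n)"
    (is "?S = _")
  proof
    show "?S \<subseteq> vac_M ` homog (int n)"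
    proof
      fix x assume "x \<in> ?S"
      then obtain p z where "p \<in> homog (int n)" "x = coset (frag_of (alg_class p, z))"
        by (auto simp: pure_tensor_def Alg_deg_eq)
      then show "x \<in> vac_M ` homog (int n)"
        using homog_mult[OF _ homog_const[of z]] by (auto simp: coset_pure)
    qed
    show "vac_M ` homog (int n) \<subseteq> ?S"
      by (fastforce simp: pure_tensor_def Alg_deg_eq vac_M_def)
  qed
  moreover have "generate (add_monoid (M_module \<mu>)) (vac_M ` homog (int n)) = vac_M ` homog (int n)"
  proof
    have "subgroup (vac_M ` homog (int n)) (add_monoid (M_module \<mu>))"
      by (rule M.subgroup_image) (auto intro: homog_diff)
    then show "generate (add_monoid (M_module \<mu>)) (vac_M ` homog (int n)) \<subseteq> vac_M ` homog (int n)"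
      using group.generate_subgroup_incl[OF abelian_group.a_group[OF M.abelian_group]] by blast
  qed (auto intro: generate.incl)
  ultimately show ?thesis by (simp add: M_grade_def)
qed

lemma M_module_vacuum_module: "vacuum_module \<mu> (M_module \<mu>) (M_grade \<mu>) vac_M"
proof -
  have "M_grade \<mu> = (\<lambda>n. vac_M ` homog (int n))" using M_grade_eq by blast
  then show ?thesis using vac_M_vacuum_module by simp
qed

lemma J_submodule_eq: "J_submodule \<mu> = vac_M ` rad \<mu>"
  unfolding J_submodule_def
  by (rule the_equality) (simp_all add: vacuum_module.maximal_proper_graded_submodule_iff[OF M_module_vacuum_module])

lemma L_module_vacuum_module:
  "\<exists>h. irreducible_vacuum_module \<mu> (L_module \<mu>) (L_grade \<mu>) h"
proof -
  interpret M: vacuum_module \<mu> "M_module \<mu>" "M_grade \<mu>" vac_M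
    by (rule M_module_vacuum_module)
  have sub: "submodule (J_submodule \<mu>) Alg (M_module \<mu>)"
    unfolding J_submodule_eq by (rule M.submodule_image_rad)
  interpret J: stable_subgroup "M_module \<mu>" "carrier Alg" "J_submodule \<mu>"
    using sub M.abelian_group M.smult_closed M.smult_r_distr submodule.smult_closed[OF sub]
    by (intro stable_subgroup.intro stable_subgroup_axioms.intro) (auto simp: submodule_def)
  define h where "h p = J_submodule \<mu> +>\<^bsub>M_module \<mu>\<^esub> vac_M p" for p
  \<comment> \<open>Dividing by the image of the radical enlarges the kernel to exactly
    \<open>rad \<mu>\<close>, which is the property \<open>h_rad\<close> that the induced module is
    not shown to have.\<close>
  have zero_iff: "h p = \<zero>\<^bsub>L_module \<mu>\<^esub> \<longleftrightarrow> p \<in> rad \<mu>" for p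
    by (simp add: h_def L_module_def J.quotient_zero J.coset_eq_self_iff) (simp add: J_submodule_eq M.image_rad_iff)
  have "irreducible_vacuum_module \<mu> (L_module \<mu>) (L_grade \<mu>) h"
  proof
    show "\<mu> \<noteq> 0" by (rule mu)
    show "h (p + q) = h p \<oplus>\<^bsub>L_module \<mu>\<^esub> h q" for p q
      by (simp add: h_def L_module_def J.quotient_add M.h_add)
    show "h (p * q) = alg_class p \<odot>\<^bsub>L_module \<mu>\<^esub> h q" for p q
      by (simp add: h_def L_module_def J.quotient_smult M.h_mult)
    show "h 0 = \<zero>\<^bsub>L_module \<mu>\<^esub>" by (simp add: zero_iff rad_zero)
    show "range h = carrier (L_module \<mu>)"
      by (auto simp: h_def L_module_def J.quotient_carrier simp flip: M.range_h)
    show "h p = \<zero>\<^bsub>L_module \<mu>\<^esub>" if "p \<in> homog k" "k < 0" for p k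
      using rad_negative[OF that] by (simp add: zero_iff)
    show "h p = h (const (Phi \<mu> p))" if "p \<in> homog 0" for p
      using M.h_degree_zero[OF that] by (simp add: h_def)
    show "L_grade \<mu> n = h ` homog (int n)" for n
      by (auto simp: L_grade_def M_grade_eq h_def)
  qed (simp_all add: zero_iff)
  then show ?thesis by (rule exI[of _ h])
qed

end

section \<open>Irreducible graded modules\<close>

text \<open>Substitution of \<open>freeY 0\<close> for the variable. Polynomials are tracked rather
  than elements because an annihilating one must be split into linear factors.\<close>

definition polyY :: "complex poly \<Rightarrow> free_elem"
  where "polyY p = fold_coeffs (\<lambda>c r. const c + freeY 0 * r) p 0"

lemma polyY_zero [simp]: "polyY 0 = 0"
  by (simp add: polyY_def)

lemma polyY_pCons [simp]: "polyY (pCons c p) = const c + freeY 0 * polyY p"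
  by (cases "p = 0 \<and> c = 0") (auto simp: polyY_def)

lemma polyY_add: "polyY (p + q) = polyY p + polyY q"
  by (induction p q rule: poly_induct2) (simp_all add: single_add algebra_simps)

lemma polyY_smult: "polyY (smult c p) = const c * polyY p"
proof (induction p)
  case (pCons a p)
  have "const c * (freeY 0 * polyY p) = freeY 0 * (const c * polyY p)"
    by (metis const_mult_commute mult.assoc)
  then show ?case using pCons by (simp add: distrib_left mult_single)
qed simp

lemma polyY_mult: "polyY (p * q) = polyY p * polyY q"
  by (induction p) (simp_all add: polyY_add polyY_smult distrib_right mult.assoc)

lemma polyY_diff: "polyY (p - q) = polyY p - polyY q"
  using polyY_add[of "p - q" q] by simp

lemma polyY_commute: "polyY p * polyY q = polyY q * polyY p"
  by (metis polyY_mult mult.commute)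

lemma polyY_homog: "polyY p \<in> homog 0"
  using homog_mult[OF Y0_homog(1)] by (induction p) (simp_all add: homog_add)

lemma polyY_X: "polyY [:0, 1:] = freeY 0" "polyY [:- c, 1:] = freeY 0 - const c"
  by (simp_all add: single_uminus)

locale irreducible_graded =
  fixes W :: "(alg_elem, 'w, 'm) module_scheme" (structure) and G :: "nat \<Rightarrow> 'w set"
  assumes irred: "irreducible_N_graded_module W G"
begin

lemma graded: "N_graded_module W G"
  using irred by (simp add: irreducible_N_graded_module_def)

lemma left_module: "left_module Alg W"
  using graded by (simp add: N_graded_module_def)

sublocale left_module Alg W
  by (rule left_module)

definition act :: "free_elem \<Rightarrow> 'w \<Rightarrow> 'w"
  where "act p x = alg_class p \<odot>\<^bsub>W\<^esub> x"

lemma grade_subgroup: "subgroup (G n) (add_monoid W)"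
  using graded by (simp add: N_graded_module_def)

lemma grade_carrier: "x \<in> G n \<Longrightarrow> x \<in> carrier W"
  using subgroup.subset[OF grade_subgroup] by auto

lemma grade_zero: "\<zero> \<in> G n"
  using subgroup.one_closed[OF grade_subgroup] by simp

lemma decomposition_unique:
  "grade_decomposition W G w f \<Longrightarrow> grade_decomposition W G w g \<Longrightarrow> w \<in> carrier W \<Longrightarrow> f = g"
  using graded unfolding N_graded_module_def by blast

lemma act_closed: "x \<in> carrier W \<Longrightarrow> act p x \<in> carrier W"
  by (simp add: act_def smult_closed)

lemma act_add: "x \<in> carrier W \<Longrightarrow> act (p + q) x = act p x \<oplus> act q x"
  by (simp add: act_def smult_l_distr flip: alg_class_ops)

lemma act_mult: "x \<in> carrier W \<Longrightarrow> act (p * q) x = act p (act q x)"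
  by (simp add: act_def smult_assoc flip: alg_class_ops)

lemma act_one: "x \<in> carrier W \<Longrightarrow> act 1 x = x"
  using smult_one by (simp add: act_def)

lemma act_cong: "alg_class p = alg_class q \<Longrightarrow> act p x = act q x"
  by (simp add: act_def)

lemma act_zero: assumes "x \<in> carrier W" shows "act 0 x = \<zero>"
  using act_add[OF assms, of 0 0] act_closed[OF assms, of 0]
  by (metis M.add.l_cancel_one' add_0)

lemma act_zero_right: "act p \<zero> = \<zero>"
  using act_mult[of \<zero> p 0] act_zero[of \<zero>] by simp

lemma act_grade: "p \<in> homog k \<Longrightarrow> x \<in> G n \<Longrightarrow> act p x \<in> grade_int W G (k + int n)"
  using graded unfolding N_graded_module_def act_def Alg_deg_eq by blast

lemma act_negative: "p \<in> homog k \<Longrightarrow> k < 0 \<Longrightarrow> x \<in> G 0 \<Longrightarrow> act p x = \<zero>"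
  using act_grade[of p k x 0] by (simp add: grade_int_def)

lemma act_nonnegative: "p \<in> homog (int n) \<Longrightarrow> x \<in> G 0 \<Longrightarrow> act p x \<in> G n"
  using act_grade[of p "int n" x 0] by (simp add: grade_int_def)

lemma act_degree_zero: "p \<in> homog 0 \<Longrightarrow> x \<in> G 0 \<Longrightarrow> act p x \<in> G 0"
  using act_nonnegative[of p 0 x] by simp

lemma cyclic_map: "x \<in> G 0 \<Longrightarrow> cyclic_map W (\<lambda>p. act p x)"
  by (intro cyclic_map.intro cyclic_map_axioms.intro left_module)
     (simp_all add: grade_carrier act_closed act_add act_zero act_mult act_negative flip: act_def)

text \<open>The components of \<open>act p x\<close> are the parts of \<open>p\<close> applied to
  \<open>x\<close>, so the orbit of a vector of degree 0 is a graded submodule and irreducibility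
  applies.\<close>

lemma cyclic:
  assumes x: "x \<in> G 0" "x \<noteq> \<zero>"
  shows "range (\<lambda>p. act p x) = carrier W"
proof -
  interpret X: cyclic_map W "\<lambda>p. act p x" by (rule cyclic_map[OF x(1)])
  let ?U = "range (\<lambda>p. act p x)"
  have "submodule ?U Alg W"
  proof (intro submodule.intro submodule_axioms.intro X.subgroup_image)
    show "a \<odot>\<^bsub>W\<^esub> u \<in> ?U" if "a \<in> carrier Alg" "u \<in> ?U" for a u
      using that by (auto simp: carrier_Alg simp flip: X.h_mult)
  qed auto
  moreover have "\<exists>f. grade_decomposition W (\<lambda>n. ?U \<inter> G n) u f" if u: "u \<in> ?U" for u
  proof -
    obtain p where "u = act p x" using u by blast
    then show ?thesis
      using X.decomposition[of p "\<lambda>n. ?U \<inter> G n"] act_nonnegative[OF hpart_homog x(1)] by auto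
  qed
  ultimately have "graded_submodule W G ?U" by (simp add: graded_submodule_def)
  then have "?U = {\<zero>} \<or> ?U = carrier W"
    using irred by (simp add: irreducible_N_graded_module_def)
  moreover have "x \<in> ?U" using act_one[OF grade_carrier[OF x(1)]] by (metis rangeI)
  ultimately show ?thesis using x(2) by blast
qed

text \<open>Two decompositions of the same vector are compared, the one given by the parts of
  \<open>p\<close> and the one concentrated in degree \<open>n\<close>.\<close>

lemma homogeneous_component:
  assumes x: "x \<in> G 0" and w: "act p x \<in> G n"
  shows "act p x = act (hpart (int n) p) x"
proof -
  interpret X: cyclic_map W "\<lambda>p. act p x" by (rule cyclic_map[OF x])
  have "grade_decomposition W G (act p x) (\<lambda>m. act (hpart (int m) p) x)"
    by (rule X.decomposition) (rule act_nonnegative[OF hpart_homog x])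
  moreover have "grade_decomposition W G (act p x) (\<lambda>m. if m = n then act p x else \<zero>)"
  proof (cases "act p x = \<zero>")
    case True
    then show ?thesis by (simp add: grade_decomposition_def grade_zero)
  next
    case False
    then have "{m. (if m = n then act p x else \<zero>) \<noteq> \<zero>} = {n}" by auto
    then show ?thesis using w by (simp add: grade_decomposition_def grade_zero grade_carrier)
  qed
  ultimately have "(\<lambda>m. act (hpart (int m) p) x) = (\<lambda>m. if m = n then act p x else \<zero>)"
    by (rule decomposition_unique) simp
  from fun_cong[OF this, of n] show ?thesis by simp
qed

lemma vacuum_transitive:
  assumes "x \<in> G 0" "x \<noteq> \<zero>" "y \<in> G n"
  shows "\<exists>p\<in>homog (int n). y = act p x"
proof -
  obtain p where "y = act p x"
    using cyclic[OF assms(1,2)] grade_carrier[OF assms(3)] by (metis imageE)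
  then show ?thesis using homogeneous_component[OF assms(1), of p n] assms(3) hpart_homog by metis
qed

lemma act_scalar_zero:
  assumes "x \<in> carrier W" "act (const c) x = \<zero>" "x \<noteq> \<zero>"
  shows "c = 0"
proof (rule ccontr)
  assume "c \<noteq> 0"
  then have "act (const (inverse c) * const c) x = x"
    using act_one[OF assms(1)] by (simp add: mult_single)
  then show False using assms act_mult[OF assms(1)] act_zero_right by metis
qed

text \<open>The relations with indices \<open>0, 0\<close> and \<open>- 1, 1\<close> are those in
  which \<open>Y\<^sub>0\<close> and \<open>Y\<^sup>*\<^sub>0\<close> meet. Their other term ends in
  a generator of index 1, which kills vectors of degree 0.\<close>

lemma Y0_inverse:
  assumes x: "x \<in> G 0"
  shows "act (freeY 0 * freeYs 0) x = x" "act (freeYs 0 * freeY 0) x = x"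
proof -
  note xc = grade_carrier[OF x]
  have kill: "act (p * mon [g] 1) x = \<zero>" if "gen_degree g < 0" for p g
    using act_negative[OF homog_mon[OF refl], of "[g]" x 1] that x by (simp add: act_mult[OF xc] act_zero_right)
  have "alg_class (freeY 0 * freeYs 0 + freeYs (- 1) * freeY 1) = alg_class 1"
    using relation_word(3)[of "[]" 0 0 "[]" 1]
    by (simp add: alg_class_eq_iff freeY_def freeYs_def mon_mult const_eq_mon[symmetric])
  from act_cong[OF this, of x] show "act (freeY 0 * freeYs 0) x = x"
    using kill[of "GenY 1" "freeYs (- 1)"] xc
    by (simp add: act_add act_one act_closed flip: freeY_def)
  have "alg_class (freeY (- 1) * freeYs 1 + freeYs 0 * freeY 0) = alg_class 1"
    using relation_word(3)[of "[]" "- 1" 1 "[]" 1]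
    by (simp add: alg_class_eq_iff freeY_def freeYs_def mon_mult const_eq_mon[symmetric])
  from act_cong[OF this, of x] show "act (freeYs 0 * freeY 0) x = x"
    using kill[of "GenYs 1" "freeY (- 1)"] xc
    by (simp add: act_add act_one act_closed flip: freeYs_def)
qed

text \<open>On vectors of degree 0 the generator \<open>Y\<^sup>*\<^sub>0\<close> inverts
  \<open>Y\<^sub>0\<close>, so \<open>p\<close> acts as a Laurent polynomial in
  \<open>Y\<^sub>0\<close>; the power \<open>k\<close> clears its denominator.\<close>

lemma degree_zero_polynomial:
  assumes x: "x \<in> G 0" and "p \<in> homog 0"
  shows "\<exists>k r. act (polyY (monom 1 k) * p) x = act (polyY r) x"
  using assms(2)
proof (induction p rule: degree_zero_induct)
  case (cong p q)
  have "act (s * p) x = act (s * q) x" for s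
    using cong(3) by (intro act_cong) (metis alg_class_ops(2))
  then show ?case using cong(4) by simp
next
  case (add p q)
  note xc = grade_carrier[OF x]
  from add obtain k r l s where *: "act (polyY (monom 1 k) * p) x = act (polyY r) x"
    "act (polyY (monom 1 l) * q) x = act (polyY s) x" by blast
  have kl: "polyY (monom 1 (k + l)) = polyY (monom 1 l) * polyY (monom 1 k)"
    "polyY (monom 1 (k + l)) = polyY (monom 1 k) * polyY (monom 1 l)"
    by (simp_all add: mult_monom add.commute flip: polyY_mult)
  have "act (polyY (monom 1 (k + l)) * (p + q)) x =
      act (polyY (monom 1 (k + l)) * p) x \<oplus> act (polyY (monom 1 (k + l)) * q) x"
    by (simp add: distrib_left act_add xc)
  also have "act (polyY (monom 1 (k + l)) * p) x = act (polyY (monom 1 l) * polyY r) x"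
    unfolding kl(1) mult.assoc using *(1) by (simp add: act_mult xc)
  also have "act (polyY (monom 1 (k + l)) * q) x = act (polyY (monom 1 k) * polyY s) x"
    unfolding kl(2) mult.assoc using *(2) by (simp add: act_mult xc)
  finally have "act (polyY (monom 1 (k + l)) * (p + q)) x = act (polyY (monom 1 l * r + monom 1 k * s)) x"
    by (simp add: polyY_add polyY_mult act_add xc)
  then show ?case by blast
next
  case (const c)
  show ?case by (intro exI[of _ 0] exI[of _ "[:c:]"]) (simp add: monom_0)
next
  case (Y p)
  note xc = grade_carrier[OF x]
  from Y obtain k r where *: "act (polyY (monom 1 k) * p) x = act (polyY r) x" by blast
  have "polyY (monom 1 k) * (freeY 0 * p) = freeY 0 * (polyY (monom 1 k) * p)"
    using polyY_commute[of "monom 1 k" "[:0, 1:]"] by (simp only: polyY_X flip: mult.assoc)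
  then have "act (polyY (monom 1 k) * (freeY 0 * p)) x = act (polyY ([:0, 1:] * r)) x"
    using * by (simp only: polyY_mult polyY_X act_mult xc act_closed)
  then show ?case by blast
next
  case (Ys p)
  note xc = grade_carrier[OF x]
  from Ys obtain k r where *: "act (polyY (monom 1 k) * p) x = act (polyY r) x" by blast
  have "polyY (monom 1 (Suc k)) = polyY (monom 1 k) * freeY 0"
    using polyY_mult[of "monom 1 k" "[:0, 1:]"] by (simp only: polyY_X) (simp add: monom_Suc mult.commute)
  then have "act (polyY (monom 1 (Suc k)) * (freeYs 0 * p)) x =
      act (polyY (monom 1 k)) (act (freeY 0 * freeYs 0) (act p x))"
    by (simp only: act_mult xc act_closed mult.assoc)
  also have "\<dots> = act (polyY r) x"
    using * Y0_inverse(1)[OF act_degree_zero[OF Ys(1) x]] by (simp add: act_mult xc)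
  finally show ?case by blast
next
  case (negative p q n)
  have "act (polyY (monom 1 0) * (p * q)) x = act (polyY 0) x"
    using act_negative[OF negative(3,1) x] grade_carrier[OF x]
    by (simp add: act_mult act_closed act_zero_right act_zero)
  then show ?case by blast
qed

text \<open>Split off a root \<open>z\<close> of \<open>q\<close>. Either
  \<open>Y\<^sub>0 - z\<close> kills \<open>x\<close>, or it sends \<open>x\<close> to a nonzero
  vector annihilated by the cofactor of smaller degree.\<close>

lemma eigenvector_of_annihilator:
  "x \<in> G 0 \<Longrightarrow> x \<noteq> \<zero> \<Longrightarrow> q \<noteq> 0 \<Longrightarrow> act (polyY q) x = \<zero> \<Longrightarrow>
    \<exists>\<mu> y. y \<in> G 0 \<and> y \<noteq> \<zero> \<and> act (freeY 0 - const \<mu>) y = \<zero>"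
proof (induction "degree q" arbitrary: q x)
  case 0
  then obtain c where "q = [:c:]" "c \<noteq> 0" by (metis degree_eq_zeroE pCons_0_0)
  then show ?case
    using 0 act_scalar_zero[OF grade_carrier[OF 0(2)], of c] by simp
next
  case (Suc d)
  then have "\<not> constant (poly q)" by (simp add: constant_degree)
  then obtain z where "poly q z = 0" using fundamental_theorem_of_algebra by blast
  then obtain s where q: "q = s * [:- z, 1:]" by (metis dvdE mult.commute poly_eq_0_iff_dvd)
  with Suc.prems(3) have "s \<noteq> 0" by auto
  then have "degree q = Suc (degree s)"
    unfolding q by (subst degree_mult_eq) simp_all
  with Suc.hyps(2) \<open>s \<noteq> 0\<close> have s: "s \<noteq> 0" "degree s = d" by simp_all
  let ?y = "act (freeY 0 - const z) x"
  have y: "?y \<in> G 0"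
    using polyY_homog[of "[:- z, 1:]"] Suc.prems(1) by (intro act_degree_zero) (simp_all only: polyY_X)
  show ?case
  proof (cases "?y = \<zero>")
    case True
    then show ?thesis using Suc.prems by blast
  next
    case False
    have "act (polyY s) ?y = \<zero>"
      using Suc.prems(1,4) by (simp only: q polyY_mult polyY_X act_mult grade_carrier)
    then show ?thesis using Suc.hyps(1)[of s ?y] s y False by blast
  qed
qed

lemma eigenvector_exists: "\<exists>\<mu> x. x \<in> G 0 \<and> x \<noteq> \<zero> \<and> act (freeY 0 - const \<mu>) x = \<zero>"
proof -
  have "G 0 \<noteq> {\<zero>}" using graded by (simp add: N_graded_module_def)
  then obtain x where x: "x \<in> G 0" "x \<noteq> \<zero>" using grade_zero[of 0] by blast
  note xc = grade_carrier[OF x(1)]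
  \<comment> \<open>The shift 1 stands for any nonzero number; at 0 the polynomial below could
    vanish identically, because \<open>monom 1 k\<close> may itself be a multiple of the
    variable.\<close>
  let ?y = "act (polyY [:- 1, 1:]) x"
  show ?thesis
  proof (cases "?y = \<zero>")
    case True
    then show ?thesis using x by (auto simp only: polyY_X)
  next
    case False
    have y: "?y \<in> G 0" by (rule act_degree_zero[OF polyY_homog x(1)])
    obtain p where p: "p \<in> homog 0" "x = act p ?y"
      using vacuum_transitive[OF y False x(1)] by auto
    obtain k r where "act (polyY (monom 1 k) * p) ?y = act (polyY r) ?y"
      using degree_zero_polynomial[OF y p(1)] by blast
    then have eq: "act (polyY (monom 1 k)) x = act (polyY (r * [:- 1, 1:])) x"
      using p(2) by (simp only: polyY_mult act_mult xc act_closed)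
    \<comment> \<open>The factor \<open>[:- 1, 1:]\<close> vanishes at 1 and the monomial does not,
      so this annihilating polynomial is nonzero whatever \<open>k\<close> and \<open>r\<close>
      are.\<close>
    let ?q = "monom 1 k - r * [:- 1, 1:]"
    interpret X: cyclic_map W "\<lambda>p. act p x" by (rule cyclic_map[OF x(1)])
    have "act (polyY ?q) x = \<zero>"
      using X.h_diff_eq_zero[of "polyY (monom 1 k)" "polyY (r * [:- 1, 1:])"] eq unfolding polyY_diff by blast
    moreover have "poly ?q 1 = 1" by (simp add: poly_monom)
    then have "?q \<noteq> 0" by (metis poly_0 zero_neq_one)
    ultimately show ?thesis using eigenvector_of_annihilator[OF x] by blast
  qed
qed

lemma vacuum_module_exists: "\<exists>\<mu> h. irreducible_vacuum_module \<mu> W G h"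
proof -
  obtain \<mu> x where x: "x \<in> G 0" "x \<noteq> \<zero>" and eig: "act (freeY 0 - const \<mu>) x = \<zero>"
    using eigenvector_exists by blast
  note xc = grade_carrier[OF x(1)]
  interpret X: cyclic_map W "\<lambda>p. act p x" by (rule cyclic_map[OF x(1)])
  have Yx: "act (freeY 0) x = act (const \<mu>) x"
    using eig X.h_diff_eq_zero by blast
  have YsYx: "act (freeYs 0 * const \<mu>) x = x"
    using Y0_inverse(2)[OF x(1)] Yx by (simp add: act_mult xc)
  \<comment> \<open>The eigenvalue is nonzero because \<open>Y\<^sup>*\<^sub>0\<close> undoes
    \<open>Y\<^sub>0\<close> on \<open>x\<close>.\<close>
  have mu: "\<mu> \<noteq> 0"
  proof
    assume "\<mu> = 0"
    then show False using YsYx x(2) act_zero[OF xc] by simp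
  qed
  have Ysx: "act (freeYs 0) x = act (const (inverse \<mu>)) x"
  proof -
    have "freeYs 0 = freeYs 0 * const \<mu> * const (inverse \<mu>)"
      using mu by (simp add: mult.assoc mult_single)
    also have "\<dots> = const (inverse \<mu>) * (freeYs 0 * const \<mu>)"
      by (rule const_mult_commute[symmetric])
    finally show ?thesis using YsYx by (metis act_mult xc)
  qed
  have Phi_act: "act p x = act (const (Phi \<mu> p)) x" if "p \<in> homog 0" for p
    using that
  proof (induction p rule: degree_zero_induct)
    case (cong p q)
    then show ?case using act_cong[OF cong(3)] Phi_alg_class[OF cong(3)] by metis
  next
    case (add p q)
    then show ?case by (simp add: act_add xc Phi_add single_add)
  next
    case (const c)
    show ?case by simp
  next
    case (Y p)
    have "act (freeY 0 * p) x = act (const (Phi \<mu> p) * freeY 0) x"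
      using Y(2) by (simp add: act_mult xc const_mult_commute)
    also have "\<dots> = act (const (Phi \<mu> (freeY 0 * p))) x"
      using Yx by (simp add: act_mult xc Phi_mult_zero_degree[OF mu Y(1)] Phi_Y0[OF mu])
        (simp add: mult_single mult.commute flip: act_mult[OF xc])
    finally show ?case .
  next
    case (Ys p)
    have "act (freeYs 0 * p) x = act (const (Phi \<mu> p) * freeYs 0) x"
      using Ys(2) by (simp add: act_mult xc const_mult_commute)
    also have "\<dots> = act (const (Phi \<mu> (freeYs 0 * p))) x"
      using Ysx by (simp add: act_mult xc Phi_mult_zero_degree[OF mu Ys(1)] Phi_Y0[OF mu])
        (simp add: mult_single mult.commute flip: act_mult[OF xc])
    finally show ?case .
  next
    case (negative p q n)
    then show ?case
      using act_negative[OF negative(3,1) x(1)]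
      by (simp add: act_mult xc act_zero_right Phi_mult_negative[OF negative(3,1)] act_zero)
  qed
  \<comment> \<open>If \<open>p\<close> kills \<open>x\<close>, so does \<open>q * p\<close>, and by
    uniqueness of components so does its part of degree 0, which acts on \<open>x\<close> as the
    scalar \<open>Phi \<mu> (q * p)\<close>.\<close>
  have kernel: "p \<in> rad \<mu>" if "act p x = \<zero>" for p
  proof -
    have "Phi \<mu> (q * p) = 0" for q
    proof -
      have *: "act (q * p) x = \<zero>" using that by (simp add: act_mult xc act_zero_right)
      then have "act (hpart 0 (q * p)) x = \<zero>"
        using homogeneous_component[OF x(1), of "q * p" 0] grade_zero by simp
      then have "act (const (Phi \<mu> (q * p))) x = \<zero>"
        using Phi_act[OF hpart_homog[of 0 "q * p"]] by (simp add: Phi_hpart)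
      then show ?thesis by (rule act_scalar_zero[OF xc _ x(2)])
    qed
    then show ?thesis by (simp add: rad_def)
  qed
  interpret V: vacuum_module \<mu> W G "\<lambda>p. act p x"
  proof
    show "range (\<lambda>p. act p x) = carrier W" by (rule cyclic[OF x])
    show "G n = (\<lambda>p. act p x) ` homog (int n)" for n
      using vacuum_transitive[OF x] act_nonnegative[OF _ x(1)] by blast
  qed (fact mu X.h_add X.h_mult X.h_zero X.h_negative Phi_act kernel)+
  \<comment> \<open>The image of the radical is a proper graded submodule; irreducibility makes it
    zero, which completes the description of the kernel.\<close>
  have "(\<lambda>p. act p x) ` rad \<mu> = {\<zero>}"
    using irred V.graded_submodule_image_rad V.image_rad_proper
    unfolding irreducible_N_graded_module_def by blast
  then have "irreducible_vacuum_module \<mu> W G (\<lambda>p. act p x)"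
    by unfold_locales blast
  then show ?thesis by blast
qed

end

theorem theorem3p10:
  shows "(\<forall>\<mu>. \<mu> \<noteq> 0 \<longrightarrow> irreducible_N_graded_module (L_module \<mu>) (L_grade \<mu>)) \<and>
    (\<forall>(W :: (alg_elem, 'w) module) (G :: nat \<Rightarrow> 'w set).
       irreducible_N_graded_module W G \<longrightarrow>
         (\<exists>!\<mu>. \<mu> \<noteq> 0 \<and> isomorphic_modules W (L_module \<mu>)) \<and>
         (\<exists>!\<mu>. \<mu> \<noteq> 0 \<and> isomorphic_graded_modules W G (L_module \<mu>) (L_grade \<mu>)))"
proof (intro conjI allI impI)
  fix \<mu> :: complex assume "\<mu> \<noteq> 0"
  then obtain h where "irreducible_vacuum_module \<mu> (L_module \<mu>) (L_grade \<mu>) h"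
    using L_module_vacuum_module by blast
  then show "irreducible_N_graded_module (L_module \<mu>) (L_grade \<mu>)"
    by (rule irreducible_vacuum_module.irreducible)
next
  fix W :: "(alg_elem, 'w) module" and G :: "nat \<Rightarrow> 'w set"
  assume "irreducible_N_graded_module W G"
  then interpret irreducible_graded W G by unfold_locales
  obtain \<mu> h where W: "irreducible_vacuum_module \<mu> W G h"
    using vacuum_module_exists by blast
  then have mu: "\<mu> \<noteq> 0"
    by (simp add: irreducible_vacuum_module_def vacuum_module_def)
  obtain k where "irreducible_vacuum_module \<mu> (L_module \<mu>) (L_grade \<mu>) k"
    using L_module_vacuum_module[OF mu] by blast
  with W have iso: "isomorphic_graded_modules W G (L_module \<mu>) (L_grade \<mu>)"
    by (rule vacuum_module_isomorphic)
  \<comment> \<open>Uniqueness is proved for isomorphisms that may ignore the grading; forgetting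
    the grading carries it over to graded ones.\<close>
  have forget: "isomorphic_modules W (L_module \<nu>)"
    if "isomorphic_graded_modules W G (L_module \<nu>) (L_grade \<nu>)" for \<nu>
    using that by (auto simp: isomorphic_graded_modules_def isomorphic_modules_def)
  have unique: "\<nu> = \<mu>" if nu: "\<nu> \<noteq> 0" "isomorphic_modules W (L_module \<nu>)" for \<nu>
  proof -
    obtain l where "irreducible_vacuum_module \<nu> (L_module \<nu>) (L_grade \<nu>) l"
      using L_module_vacuum_module[OF nu(1)] by blast
    from vacuum_module_parameter_unique[OF W this nu(2)] show ?thesis by simp
  qed
  show "\<exists>!\<mu>. \<mu> \<noteq> 0 \<and> isomorphic_modules W (L_module \<mu>)"
  proof (rule ex1I)
    show "\<mu> \<noteq> 0 \<and> isomorphic_modules W (L_module \<mu>)"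
      by (intro conjI mu forget iso)
  qed (elim conjE, rule unique)
  show "\<exists>!\<mu>. \<mu> \<noteq> 0 \<and> isomorphic_graded_modules W G (L_module \<mu>) (L_grade \<mu>)"
  proof (rule ex1I)
    show "\<mu> \<noteq> 0 \<and> isomorphic_graded_modules W G (L_module \<mu>) (L_grade \<mu>)"
      by (intro conjI mu iso)
  qed (elim conjE, rule unique, assumption, rule forget)
qed

end
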